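(* Let $n\ge1$, $\alpha\in(0,n)$, $0<\beta\le2$, and $p>1$. Consider the Cauchy problem $$u_t+(-\Delta)^{\beta/2}u=I_\alpha(|u|^p),\quad x\in\mathbb{R}^n,\ t>0,\qquad u(x,0)=u_0(x),\quad x\in\mathbb{R}^n. \quad (P)$$ (i) If $u_0\in L^1_{\mathrm{loc}}(\mathbb{R}^n)$ is such that $$\liminf_{R\to\infty}R^{-\alpha}\int_{B_R}u_0(x)\,dx\ge0\qquad\text{and}\qquad 1<p\le p_{\mathrm{Fuj}}(n,\beta,\alpha):=1+\frac{\beta+\alpha}{n-\alpha},$$ then (P) has no global nontrivial nonnegative weak solutions. (ii) If $u_0\in L^1_{\mathrm{loc}}(\mathbb{R}^n)$ and, for some constant $\overline{\varepsilon}>0$ and some exponent $\gamma>0$ (any positive value of $\gamma$ being allowed), $$u_0(x)\ge\overline{\varepsilon}(1+|x|^2)^{-\gamma/2}\qquad\text{and}\qquad p<p_*:=1+\frac{\beta+\alpha}{\gamma},$$ then (P) has no global weak solutions.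
   Context: $B_R$ is the closed ball of radius $R$ centered at the origin of $\mathbb{R}^n$. For $\alpha\in(0,n)$ the Riesz potential (in the space variable) is $I_\alpha f(x)=A_\alpha\int_{\mathbb{R}^n}\frac{f(y)}{|x-y|^{n-\alpha}}\,dy$ with $A_\alpha=\frac{\Gamma((n-\alpha)/2)}{\Gamma(\alpha/2)\,\pi^{n/2}\,2^\alpha}$. The operator $(-\Delta)^{\beta/2}$ acts in $x$; for $\beta=2$ it is $-\Delta$, and for $\beta\in(0,2)$, with $\sigma=\beta/2$, $$(-\Delta)^{\sigma}v(x)=C_{n,\sigma}\,\mathrm{p.v.}\int_{\mathbb{R}^n}\frac{v(x)-v(y)}{|x-y|^{n+2\sigma}}\,dy,\qquad C_{n,\sigma}=\frac{4^{\sigma}\Gamma(\frac n2+\sigma)}{\pi^{n/2}|\Gamma(-\sigma)|}.$$ Weak solution of (P): let $u_0\in L^1_{\mathrm{loc}}(\mathbb{R}^n)$ and $0<T\le\infty$. A function $u\in L^1_{\mathrm{loc}}((0,T)\times\mathbb{R}^n)$ is a weak solution of (P) on $[0,T)\times\mathbb{R}^n$ if $I_\alpha(|u|^p)\in L^1_{\mathrm{loc}}((0,T)\times\mathbb{R}^n)$ and, for every $0\le\tau<T$ and every compactly supported test function $\psi\in C^{1,2}_{t,x}([0,T)\times\mathbb{R}^n)$ with $\psi(\tau,\cdot)=0$, $$\int_0^\tau\!\!\int_{\mathbb{R}^n}I_\alpha(|u|^p)\psi\,dx\,dt+\int_{\mathbb{R}^n}u_0(x)\psi(0,x)\,dx=\int_0^\tau\!\!\int_{\mathbb{R}^n}u\,(-\Delta)^{\beta/2}\psi\,dx\,dt-\int_0^\tau\!\!\int_{\mathbb{R}^n}u\,\psi_t\,dx\,dt,$$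 where all integrals are (absolutely convergent) Lebesgue integrals. If $T=\infty$, $u$ is called a global (in time) weak solution. "Nonnegative" means $u\ge0$ a.e., and "nontrivial" means $u$ is not a.e. equal to $0$. *)

theory Defs
  imports "HOL-Analysis.Analysis"
begin

text \<open>
  Space is \<^typ>\<open>real ^ 'n\<close>, so the dimension is \<open>CARD('n)\<close>. Functions of time and space take
  a pair \<open>(t, x)\<close>. The final time is an extended real, \<open>\<infinity>\<close> being allowed.
\<close>

definition closed_strip :: "ereal \<Rightarrow> (real \<times> (real ^ 'n)) set" where
  "closed_strip T = {z. 0 \<le> fst z \<and> ereal (fst z) < T}"

definition open_strip :: "ereal \<Rightarrow> (real \<times> (real ^ 'n)) set" where
  "open_strip T = {z. 0 < fst z \<and> ereal (fst z) < T}"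

definition L1_loc :: "'a::euclidean_space set \<Rightarrow> ('a \<Rightarrow> real) \<Rightarrow> bool" where
  "L1_loc S f \<longleftrightarrow> (\<forall>K. compact K \<and> K \<subseteq> S \<longrightarrow> set_integrable lebesgue K f)"

definition riesz_const :: "nat \<Rightarrow> real \<Rightarrow> real" where
  "riesz_const n \<alpha> =
     Gamma ((real n - \<alpha>) / 2) / (Gamma (\<alpha> / 2) * pi powr (real n / 2) * 2 powr \<alpha>)"

text \<open>
  The Riesz potential of a nonnegative function, possibly infinite. It is kept in \<^typ>\<open>ennreal\<close>
  because the Bochner integral of a non-integrable function would silently be \<open>0\<close>.
\<close>

definition riesz_potential :: "real \<Rightarrow> (real ^ 'n \<Rightarrow> real) \<Rightarrow> real ^ 'n \<Rightarrow> ennreal" where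
  "riesz_potential \<alpha> f x =
     ennreal (riesz_const CARD('n) \<alpha>) *
     (\<integral>\<^sup>+ y. ennreal (f y / norm (x - y) powr (real CARD('n) - \<alpha>)) \<partial>lebesgue)"

definition partial_x :: "'n \<Rightarrow> (real ^ 'n \<Rightarrow> real) \<Rightarrow> real ^ 'n \<Rightarrow> real" where
  "partial_x i v x = deriv (\<lambda>h. v (x + h *\<^sub>R axis i 1)) 0"

definition has_partial_x :: "'n \<Rightarrow> (real ^ 'n \<Rightarrow> real) \<Rightarrow> real ^ 'n \<Rightarrow> bool" where
  "has_partial_x i v x \<longleftrightarrow> (\<lambda>h. v (x + h *\<^sub>R axis i 1)) differentiable (at 0)"

definition laplacian :: "(real ^ 'n \<Rightarrow> real) \<Rightarrow> real ^ 'n \<Rightarrow> real" where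
  "laplacian v x = (\<Sum>i\<in>UNIV. partial_x i (partial_x i v) x)"

definition frac_const :: "nat \<Rightarrow> real \<Rightarrow> real" where
  "frac_const n \<sigma> =
     4 powr \<sigma> * Gamma (real n / 2 + \<sigma>) / (pi powr (real n / 2) * \<bar>Gamma (- \<sigma>)\<bar>)"

definition frac_integral_outside ::
  "real \<Rightarrow> (real ^ 'n \<Rightarrow> real) \<Rightarrow> real ^ 'n \<Rightarrow> real \<Rightarrow> real" where
  "frac_integral_outside \<sigma> v x \<epsilon> =
     (LINT y:{y. \<epsilon> < norm (x - y)}|lebesgue.
        (v x - v y) / norm (x - y) powr (real CARD('n) + 2 * \<sigma>))"

text \<open>
  \<open>frac_laplacian \<beta>\<close> is \<open>(-\<Delta>)\<close> to the power \<open>\<beta> / 2\<close>. The principal value removes balls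
  around \<open>x\<close>.
\<close>

definition frac_laplacian :: "real \<Rightarrow> (real ^ 'n \<Rightarrow> real) \<Rightarrow> real ^ 'n \<Rightarrow> real" where
  "frac_laplacian \<beta> v x =
     (if \<beta> = 2 then - laplacian v x
      else frac_const CARD('n) (\<beta> / 2) *
           Lim (at_right 0) (frac_integral_outside (\<beta> / 2) v x))"

text \<open>The time derivative is one-sided at the initial time.\<close>

definition partial_t :: "(real \<times> (real ^ 'n) \<Rightarrow> real) \<Rightarrow> real \<times> (real ^ 'n) \<Rightarrow> real" where
  "partial_t \<psi> z = vector_derivative (\<lambda>s. \<psi> (s, snd z)) (at (fst z) within {0..})"

definition has_partial_t :: "(real \<times> (real ^ 'n) \<Rightarrow> real) \<Rightarrow> real \<times> (real ^ 'n) \<Rightarrow> bool" where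
  "has_partial_t \<psi> z \<longleftrightarrow> (\<lambda>s. \<psi> (s, snd z)) differentiable (at (fst z) within {0..})"

abbreviation slice :: "(real \<times> (real ^ 'n) \<Rightarrow> real) \<Rightarrow> real \<Rightarrow> real ^ 'n \<Rightarrow> real" where
  "slice \<psi> t \<equiv> (\<lambda>x. \<psi> (t, x))"

definition C12_tx :: "ereal \<Rightarrow> (real \<times> (real ^ 'n) \<Rightarrow> real) \<Rightarrow> bool" where
  "C12_tx T \<psi> \<longleftrightarrow>
     continuous_on (closed_strip T) \<psi> \<and>
     (\<forall>z\<in>closed_strip T. has_partial_t \<psi> z) \<and>
     continuous_on (closed_strip T) (partial_t \<psi>) \<and>
     (\<forall>i. (\<forall>(t, x)\<in>closed_strip T. has_partial_x i (slice \<psi> t) x) \<and>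
          continuous_on (closed_strip T) (\<lambda>(t, x). partial_x i (slice \<psi> t) x)) \<and>
     (\<forall>i j. (\<forall>(t, x)\<in>closed_strip T. has_partial_x j (partial_x i (slice \<psi> t)) x) \<and>
          continuous_on (closed_strip T) (\<lambda>(t, x). partial_x j (partial_x i (slice \<psi> t)) x))"

text \<open>
  Values of \<open>\<psi>\<close> outside \<open>closed_strip T\<close> are irrelevant. For finite \<open>T\<close>, compactness of the support
  inside the strip keeps it away from time \<open>T\<close>, but not from time \<open>0\<close>.
\<close>

definition compactly_supported :: "ereal \<Rightarrow> (real \<times> (real ^ 'n) \<Rightarrow> real) \<Rightarrow> bool" where
  "compactly_supported T \<psi> \<longleftrightarrow>
     (let S = closure {z \<in> closed_strip T. \<psi> z \<noteq> 0} in compact S \<and> S \<subseteq> closed_strip T)"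

definition riesz_source ::
  "real \<Rightarrow> real \<Rightarrow> (real \<times> (real ^ 'n) \<Rightarrow> real) \<Rightarrow> real \<times> (real ^ 'n) \<Rightarrow> ennreal" where
  "riesz_source \<alpha> p u z = riesz_potential \<alpha> (\<lambda>y. \<bar>u (fst z, y)\<bar> powr p) (snd z)"

text \<open>
  Double integrals are taken over the product \<open>(0, \<tau>) \<times> UNIV\<close>; every integral is required to
  converge absolutely. Local integrability of the source includes its finiteness almost
  everywhere, which has to be stated separately because \<^const>\<open>enn2real\<close> sends \<open>\<infinity>\<close> to \<open>0\<close>.
\<close>

definition weak_solution ::
  "real \<Rightarrow> real \<Rightarrow> real \<Rightarrow> (real ^ 'n \<Rightarrow> real) \<Rightarrow> ereal \<Rightarrow> (real \<times> (real ^ 'n) \<Rightarrow> real) \<Rightarrow> bool" where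
  "weak_solution \<alpha> \<beta> p u0 T u \<longleftrightarrow>
     L1_loc UNIV u0 \<and> 0 < T \<and>
     L1_loc (open_strip T) u \<and>
     (AE z in lebesgue. z \<in> open_strip T \<longrightarrow> riesz_source \<alpha> p u z < \<infinity>) \<and>
     L1_loc (open_strip T) (\<lambda>z. enn2real (riesz_source \<alpha> p u z)) \<and>
     (\<forall>\<tau> \<psi>. 0 \<le> \<tau> \<and> ereal \<tau> < T \<and> C12_tx T \<psi> \<and> compactly_supported T \<psi> \<and>
            (\<forall>x. \<psi> (\<tau>, x) = 0) \<longrightarrow>
        (let Q = {0<..<\<tau>} \<times> UNIV;
             F = (\<lambda>z. enn2real (riesz_source \<alpha> p u z) * \<psi> z);
             I0 = (\<lambda>x. u0 x * \<psi> (0, x));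
             G = (\<lambda>z. u z * frac_laplacian \<beta> (slice \<psi> (fst z)) (snd z));
             H = (\<lambda>z. u z * partial_t \<psi> z)
         in set_integrable lebesgue Q F \<and> integrable lebesgue I0 \<and>
            set_integrable lebesgue Q G \<and> set_integrable lebesgue Q H \<and>
            (LINT z:Q|lebesgue. F z) + (LINT x|lebesgue. I0 x) =
            (LINT z:Q|lebesgue. G z) - (LINT z:Q|lebesgue. H z)))"

definition global_weak_solution ::
  "real \<Rightarrow> real \<Rightarrow> real \<Rightarrow> (real ^ 'n \<Rightarrow> real) \<Rightarrow> (real \<times> (real ^ 'n) \<Rightarrow> real) \<Rightarrow> bool" where
  "global_weak_solution \<alpha> \<beta> p u0 u \<longleftrightarrow> weak_solution \<alpha> \<beta> p u0 \<infinity> u"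

definition nonnegative_ae :: "ereal \<Rightarrow> (real \<times> (real ^ 'n) \<Rightarrow> real) \<Rightarrow> bool" where
  "nonnegative_ae T u \<longleftrightarrow> (AE z in lebesgue. z \<in> open_strip T \<longrightarrow> 0 \<le> u z)"

definition nontrivial :: "ereal \<Rightarrow> (real \<times> (real ^ 'n) \<Rightarrow> real) \<Rightarrow> bool" where
  "nontrivial T u \<longleftrightarrow> \<not> (AE z in lebesgue. z \<in> open_strip T \<longrightarrow> u z = 0)"

definition p_Fuj :: "nat \<Rightarrow> real \<Rightarrow> real \<Rightarrow> real" where
  "p_Fuj n \<beta> \<alpha> = 1 + (\<beta> + \<alpha>) / (real n - \<alpha>)"

definition p_star :: "real \<Rightarrow> real \<Rightarrow> real \<Rightarrow> real" where
  "p_star \<gamma> \<beta> \<alpha> = 1 + (\<beta> + \<alpha>) / \<gamma>"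

end

theory Submission
  imports Defs
begin

text \<open>
  The test function is \<open>\<psi>(t, x) = (1 - t / R\<^sup>\<beta>)\<^sub>+\<^sup>k \<phi>(x / R)\<close> with
  \<open>\<phi>(x) = (1 - |x|\<^sup>2)\<^sub>+\<^sup>3\<close>. The term with the fractional Laplacian is not compactly supported
  and \<open>u\<close> may change sign, but the source is nonlocal as well: for \<open>|x| \<le> R\<close>,
  \<open>I\<^sub>\<alpha>(|u|\<^sup>p)(x)\<close> is at least a constant times \<open>\<integral> |u(y)|\<^sup>p (R + |y|)\<^bsup>\<alpha> - n\<^esup> dy\<close>. So the source
  controls \<open>|u|\<^sup>p\<close> on the whole space with the weight \<open>(1 + |y| / R)\<^bsup>\<alpha> - n\<^esup>\<close>, which by Young's
  inequality absorbs \<open>u (-\<Delta>)\<^bsup>\<beta> / 2\<^esup> \<psi>\<close>, as \<open>(-\<Delta>)\<^bsup>\<beta> / 2\<^esup> \<phi>\<close> decays like \<open>|y|\<^bsup>- n - \<beta>\<^esup>\<close>. With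
  \<open>X\<^sub>R\<close> the weighted space-time integral of \<open>|u|\<^sup>p\<close>, this gives
  \<open>c X\<^sub>R + R\<^bsup>-\<alpha>\<^esup> \<integral> u\<^sub>0 \<phi>(x / R) dx \<le> K R\<^bsup>n - \<alpha> - (\<alpha> + \<beta>) / (p - 1)\<^esup>\<close>.

  In (ii) the integral of \<open>u\<^sub>0\<close> grows like \<open>R\<^bsup>n - \<gamma>\<^esup>\<close>, too fast as \<open>R\<close> tends to infinity. In (i) the
  right-hand side stays bounded, so \<open>|u|\<^sup>p\<close> is integrable. Repeating the estimate separately inside
  and outside a fixed large ball shows \<open>X\<^sub>R \<rightarrow> 0\<close>, also for the critical exponent; as \<open>X\<^sub>R\<close> increases
  with \<open>R\<close>, it vanishes.
\<close>

section \<open>Test functions\<close>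

text \<open>The critical case dictates the form of the estimates. Young's inequality with parameter
  \<theta> leaves a remainder of order R^E with E = n - \<alpha> - (\<alpha> + \<beta>) / (p - 1),
  and E \<le> 0 says exactly that p is at most the Fujita exponent. When E = 0 the remainder does
  not decay. Its coefficient \<theta>^(-1/(p-1)) is small only for large \<theta>, and then the
  source term can no longer be absorbed on the left. Integrability of |u|^p removes this obstacle: a
  large \<theta> multiplies only the tail of a convergent integral, while on a bounded set the
  prefactor R^(-\<alpha>-\<beta>) is enough. The third power in \<phi> is the least integer power
  giving a C^2 function. The power k of the time factor is at least p / (p - 1), so that Young's
  inequality leaves no negative power of that factor near the final time. The horizon R^\<beta>
  makes the time derivative and the fractional Laplacian scale alike. In (i) the data are controlled
  on balls only and may change sign. The passage to the weight \<phi> works because its superlevel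
  sets are balls.\<close>

lemma DERIV_max_0_power:
  fixes s :: real
  shows "((\<lambda>s. (max 0 s) ^ Suc (Suc k)) has_real_derivative real (k + 2) * (max 0 s) ^ Suc k) (at s)"
proof -
  consider "s < 0" | "s = 0" | "s > 0" by linarith
  then show ?thesis
  proof cases
    case 1
    have "((\<lambda>s. 0) has_real_derivative 0) (at s)" by simp
    then have "((\<lambda>s. (max 0 s) ^ Suc (Suc k)) has_real_derivative 0) (at s)"
      by (rule has_field_derivative_transform_within_open[where S="{..<0}"]) (use 1 in auto)
    then show ?thesis using 1 by simp
  next
    case 3
    have "((\<lambda>s. s ^ Suc (Suc k)) has_real_derivative real (k + 2) * s ^ Suc k) (at s)"
      using DERIV_pow[of "Suc (Suc k)" s] by simp
    then have "((\<lambda>s. (max 0 s) ^ Suc (Suc k)) has_real_derivative real (k + 2) * s ^ Suc k) (at s)"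
      by (rule has_field_derivative_transform_within_open[where S="{0<..}"]) (use 3 in auto)
    then show ?thesis using 3 by simp
  next
    case 2
    have "((\<lambda>h::real. \<bar>h\<bar> ^ Suc k) \<longlongrightarrow> \<bar>0\<bar> ^ Suc k) (at 0)"
      by (intro tendsto_intros)
    then have *: "((\<lambda>h::real. \<bar>h\<bar> ^ Suc k) \<longlongrightarrow> 0) (at 0)"
      by simp
    \<comment> \<open>At the corner the difference quotient is squeezed by a positive power of |h|,
      which is available because the exponent is at least 2.\<close>
    have "((\<lambda>h::real. (max 0 h) ^ Suc (Suc k) / h) \<longlongrightarrow> 0) (at 0)"
    proof (rule Lim_null_comparison[OF _ *], rule always_eventually, rule allI)
      fix h :: real
      show "norm ((max 0 h) ^ Suc (Suc k) / h) \<le> \<bar>h\<bar> ^ Suc k"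
        by (cases "h > 0") (auto simp: max_def abs_if mult_nonpos_nonneg)
    qed
    then show ?thesis
      using 2 by (simp add: has_field_derivative_iff)
  qed
qed

text \<open>Squaring the norm makes this a polynomial inside the unit ball, hence smooth at the
  origin; the only corner is on the unit sphere.\<close>

definition cutoff :: "'a::real_inner \<Rightarrow> real" where
  "cutoff x = max 0 (1 - (norm x)\<^sup>2)"

lemma cutoff_nonneg [simp]: "0 \<le> cutoff x" and cutoff_le_1: "cutoff x \<le> 1"
  by (auto simp: cutoff_def)

lemma cutoff_eq_0: "1 \<le> norm x \<Longrightarrow> cutoff x = 0"
  by (auto simp: cutoff_def max_def power2_eq_square) (metis mult_mono' norm_ge_zero mult_1 zero_le_one order.antisym)

lemma continuous_on_cutoff [continuous_intros]:
  "continuous_on S f \<Longrightarrow> continuous_on S (\<lambda>x. cutoff (f x))"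
  unfolding cutoff_def by (intro continuous_intros)

lemma DERIV_cutoff_power:
  "((\<lambda>h. cutoff (z + h *\<^sub>R v) ^ Suc (Suc k)) has_real_derivative
     - 2 * real (k + 2) * cutoff (z + h *\<^sub>R v) ^ Suc k * inner (z + h *\<^sub>R v) v) (at h)"
proof -
  have eq: "1 - (norm (z + h *\<^sub>R v))\<^sup>2 = 1 - (inner z z + 2 * h * inner z v + h\<^sup>2 * inner v v)" for h
    by (simp only: power2_norm_eq_inner)
      (simp add: inner_add_left inner_add_right inner_commute power2_eq_square)
  have d: "((\<lambda>h. 1 - (norm (z + h *\<^sub>R v))\<^sup>2) has_real_derivative - 2 * inner (z + h *\<^sub>R v) v) (at h)"
    unfolding eq by (auto intro!: derivative_eq_intros simp: inner_add_left)
  show ?thesis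
    unfolding cutoff_def
    by (rule DERIV_cong[OF DERIV_chain2[OF DERIV_max_0_power d]]) (simp add: algebra_simps)
qed

text \<open>Second derivatives of the cube still contain a factor \<open>cutoff x\<close>, so they
  are continuous across the unit sphere; those of the square would jump there.\<close>

definition bump :: "'a::real_inner \<Rightarrow> real" where
  "bump x = cutoff x ^ 3"

lemma bump_nonneg [simp]: "0 \<le> bump x" and bump_le_1: "bump x \<le> 1"
  by (auto simp: bump_def cutoff_le_1 power_le_one)

lemma bump_eq_0: "1 \<le> norm x \<Longrightarrow> bump x = 0"
  by (simp add: bump_def cutoff_eq_0)

lemma continuous_on_bump [continuous_intros]:
  "continuous_on S f \<Longrightarrow> continuous_on S (\<lambda>x. bump (f x))"
  unfolding bump_def by (intro continuous_intros)

lemma DERIV_bump: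
  "((\<lambda>h. bump (z + h *\<^sub>R v)) has_real_derivative
     - 6 * cutoff (z + h *\<^sub>R v) ^ 2 * inner (z + h *\<^sub>R v) v) (at h)"
  using DERIV_cutoff_power[of z v 1 h] by (simp add: bump_def numeral_eq_Suc)

text \<open>The directions \<open>v\<close> and \<open>w\<close> are kept separate so that one
  formula covers mixed partial derivatives and the second derivative along a line.\<close>

lemma DERIV_bump2:
  "((\<lambda>h. - 6 * cutoff (z + h *\<^sub>R v) ^ 2 * inner (z + h *\<^sub>R v) w) has_real_derivative
     24 * cutoff (z + h *\<^sub>R v) * inner (z + h *\<^sub>R v) v * inner (z + h *\<^sub>R v) w
     - 6 * cutoff (z + h *\<^sub>R v) ^ 2 * inner v w) (at h)"
proof -
  have d: "((\<lambda>h. cutoff (z + h *\<^sub>R v) ^ 2) has_real_derivative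
     - 4 * cutoff (z + h *\<^sub>R v) * inner (z + h *\<^sub>R v) v) (at h)"
    using DERIV_cutoff_power[of z v 0 h] by (simp add: numeral_eq_Suc)
  have e: "((\<lambda>h. inner (z + h *\<^sub>R v) w) has_real_derivative inner v w) (at h)"
    by (auto simp: inner_add_left intro!: derivative_eq_intros)
  show ?thesis
    by (rule DERIV_cong[OF DERIV_mult[OF DERIV_cmult[OF d, of "-6"] e]]) simp
qed

text \<open>Quadratic smallness in \<open>y\<close> is what compensates the singularity of the
  fractional kernel. The mean value theorem is applied on both sides of \<open>x\<close> and then to
  the first derivative. The constant is 2 * (24 + 6): the bound on the second derivative times the
  largest distance between the two intermediate points.\<close>

lemma bump_second_difference:
  fixes x y :: "'a::real_inner"
  shows "\<bar>2 * bump x - bump (x + y) - bump (x - y)\<bar> \<le> 60 * (norm y)\<^sup>2"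
proof -
  define f f' f'' where "f h = bump (x + h *\<^sub>R y)"
    and "f' h = - 6 * cutoff (x + h *\<^sub>R y) ^ 2 * inner (x + h *\<^sub>R y) y"
    and "f'' h = 24 * cutoff (x + h *\<^sub>R y) * inner (x + h *\<^sub>R y) y * inner (x + h *\<^sub>R y) y
     - 6 * cutoff (x + h *\<^sub>R y) ^ 2 * inner y y" for h
  have d1: "(f has_real_derivative f' h) (at h)" for h
    unfolding f_def f'_def by (rule DERIV_bump)
  have d2: "(f' has_real_derivative f'' h) (at h)" for h
    unfolding f'_def f''_def by (rule DERIV_bump2)
  have b: "\<bar>f'' h\<bar> \<le> 30 * (norm y)\<^sup>2" for h
  proof (cases "1 \<le> norm (x + h *\<^sub>R y)")
    case True
    then show ?thesis by (simp add: f''_def cutoff_eq_0)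
  next
    case False
    let ?z = "x + h *\<^sub>R y"
    have "\<bar>inner ?z y\<bar> \<le> norm ?z * norm y" by (rule Cauchy_Schwarz_ineq2)
    also have "\<dots> \<le> norm y" using False by (simp add: mult_left_le_one_le)
    finally have i: "\<bar>inner ?z y\<bar> \<le> norm y" .
    have s: "(inner ?z y)\<^sup>2 \<le> (norm y)\<^sup>2" using power_mono[OF i, of 2] by simp
    have c: "0 \<le> cutoff ?z" "cutoff ?z \<le> 1" "cutoff ?z ^ 2 \<le> 1"
      by (auto simp: cutoff_le_1 power_le_one)
    have "cutoff ?z * (inner ?z y)\<^sup>2 \<le> 1 * (norm y)\<^sup>2" "cutoff ?z ^ 2 * (norm y)\<^sup>2 \<le> 1 * (norm y)\<^sup>2"
      using s c by (intro mult_mono; simp)+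
    moreover have "0 \<le> cutoff ?z * (inner ?z y)\<^sup>2" "0 \<le> cutoff ?z ^ 2 * (norm y)\<^sup>2"
      using c by simp_all
    moreover have "f'' h = 24 * (cutoff ?z * (inner ?z y)\<^sup>2) - 6 * (cutoff ?z ^ 2 * (norm y)\<^sup>2)"
      by (simp add: f''_def dot_square_norm power2_eq_square)
    ultimately show ?thesis by linarith
  qed
  obtain a where a: "0 < a" "a < 1" "f 1 - f 0 = (1 - 0) * f' a"
    using MVT2[of 0 1 f f'] d1 by auto
  obtain c where c: "-1 < c" "c < 0" "f 0 - f (-1) = (0 - (-1)) * f' c"
    using MVT2[of "-1" 0 f f'] d1 by auto
  obtain e where e: "f' a - f' c = (a - c) * f'' e"
    using MVT2[of c a f' f''] d2 a c by auto
  have "\<bar>2 * bump x - bump (x + y) - bump (x - y)\<bar> = \<bar>f' a - f' c\<bar>"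
    using a(3) c(3) by (simp add: f_def)
  also have "\<dots> = \<bar>a - c\<bar> * \<bar>f'' e\<bar>" by (simp add: e abs_mult)
  also have "\<dots> \<le> 2 * (30 * (norm y)\<^sup>2)"
    using a c b[of e] by (intro mult_mono) auto
  finally show ?thesis by simp
qed

text \<open>\<open>S\<close> is the time horizon and \<open>R\<close> the spatial radius. They are
  independent here and become linked by \<open>S = R powr \<beta>\<close> later.\<close>

definition test_fun :: "nat \<Rightarrow> real \<Rightarrow> real \<Rightarrow> real \<times> (real ^ 'n) \<Rightarrow> real" where
  "test_fun k S R z = max 0 (1 - fst z / S) ^ k * bump (snd z /\<^sub>R R)"

lemma partial_x_scaled_bump:
  fixes x :: "real ^ 'n"
  shows "((\<lambda>h. c * bump ((x + h *\<^sub>R axis i 1) /\<^sub>R R)) has_real_derivative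
      c * (- 6 * cutoff (x /\<^sub>R R) ^ 2 * inner (x /\<^sub>R R) (axis i 1 /\<^sub>R R))) (at 0)"
proof -
  have "(\<lambda>h. c * bump ((x + h *\<^sub>R axis i 1) /\<^sub>R R)) = (\<lambda>h. c * bump (x /\<^sub>R R + h *\<^sub>R (axis i 1 /\<^sub>R R)))"
    by (simp add: algebra_simps scaleR_left_commute)
  then show ?thesis
    using DERIV_cmult[OF DERIV_bump[of "x /\<^sub>R R" "axis i 1 /\<^sub>R R" 0], of c] by simp
qed

lemma partial_x_scaled_bump2:
  fixes x :: "real ^ 'n"
  shows "((\<lambda>h. c * (- 6 * cutoff ((x + h *\<^sub>R axis j 1) /\<^sub>R R) ^ 2 * inner ((x + h *\<^sub>R axis j 1) /\<^sub>R R) w))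
      has_real_derivative
      c * (24 * cutoff (x /\<^sub>R R) * inner (x /\<^sub>R R) (axis j 1 /\<^sub>R R) * inner (x /\<^sub>R R) w
        - 6 * cutoff (x /\<^sub>R R) ^ 2 * inner (axis j 1 /\<^sub>R R) w)) (at 0)"
proof -
  have *: "(x + h *\<^sub>R axis j 1) /\<^sub>R R = x /\<^sub>R R + h *\<^sub>R (axis j 1 /\<^sub>R R)" for h
    by (simp add: algebra_simps scaleR_left_commute)
  show ?thesis
    unfolding * using DERIV_cmult[OF DERIV_bump2[of "x /\<^sub>R R" "axis j 1 /\<^sub>R R" w 0], of c] by simp
qed

lemma partial_x_bump:
  "partial_x i (\<lambda>x. c * bump (x /\<^sub>R R)) =
    (\<lambda>x. c * (- 6 * cutoff (x /\<^sub>R R) ^ 2 * inner (x /\<^sub>R R) (axis i 1 /\<^sub>R R)))"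
  unfolding partial_x_def by (intro ext DERIV_imp_deriv partial_x_scaled_bump)

lemma partial_x_bump2:
  "partial_x j (partial_x i (\<lambda>x. c * bump (x /\<^sub>R R))) =
    (\<lambda>x. c * (24 * cutoff (x /\<^sub>R R) * inner (x /\<^sub>R R) (axis j 1 /\<^sub>R R) * inner (x /\<^sub>R R) (axis i 1 /\<^sub>R R)
        - 6 * cutoff (x /\<^sub>R R) ^ 2 * inner (axis j 1 /\<^sub>R R) (axis i 1 /\<^sub>R R :: real ^ 'n)))"
  unfolding partial_x_bump unfolding partial_x_def
  by (intro ext DERIV_imp_deriv partial_x_scaled_bump2)

lemma test_fun_time_derivative:
  assumes "0 \<le> t"
  shows "((\<lambda>s. test_fun (Suc (Suc k)) S R (s, x)) has_vector_derivative
      - (real (k + 2) / S) * max 0 (1 - t / S) ^ Suc k * bump (x /\<^sub>R R)) (at t within {0..})"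
proof -
  have d: "((\<lambda>s. 1 - s / S) has_real_derivative - (1 / S)) (at t within {0..})"
    by (cases "S = 0") (auto intro!: derivative_eq_intros)
  have "((\<lambda>s. max 0 (1 - s / S) ^ Suc (Suc k)) has_real_derivative
      real (k + 2) * max 0 (1 - t / S) ^ Suc k * - (1 / S)) (at t within {0..})"
    by (rule DERIV_chain2[OF DERIV_max_0_power d])
  then show ?thesis
    unfolding test_fun_def fst_conv snd_conv has_real_derivative_iff_has_vector_derivative[symmetric]
    by (rule DERIV_cong[OF DERIV_cmult_right]) simp
qed

lemma partial_t_test_fun:
  assumes "0 \<le> t"
  shows "partial_t (test_fun (Suc (Suc k)) S R) (t, x) =
      - (real (k + 2) / S) * max 0 (1 - t / S) ^ Suc k * bump (x /\<^sub>R R)"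
proof -
  \<comment> \<open>No point of the half line is isolated in it, so the derivative is unique also at
    \<open>t = 0\<close>, where it is one-sided.\<close>
  have "at_right t \<le> at t within {0..}"
    using assms by (intro at_le) auto
  then have "at t within {0..} \<noteq> bot"
    using trivial_limit_at_right_real[of t] bot.extremum_uniqueI by (metis trivial_limit_def)
  then show ?thesis
    using vector_derivative_within[OF _ test_fun_time_derivative[OF assms, of k S R x]]
    by (simp add: partial_t_def)
qed

lemma C12_tx_test_fun:
  assumes "0 < S"
  shows "C12_tx T (test_fun (Suc (Suc k)) S R :: real \<times> (real ^ 'n) \<Rightarrow> real)"
proof -
  let ?f = "test_fun (Suc (Suc k)) S R :: real \<times> (real ^ 'n) \<Rightarrow> real"
  have sl: "slice ?f t = (\<lambda>x. max 0 (1 - t / S) ^ Suc (Suc k) * bump (x /\<^sub>R R))" for t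
    by (simp add: test_fun_def)
  have pt: "partial_t ?f z = - (real (k + 2) / S) * max 0 (1 - fst z / S) ^ Suc k * bump (snd z /\<^sub>R R)"
    if "z \<in> closed_strip T" for z :: "real \<times> (real ^ 'n)"
    using that partial_t_test_fun[of "fst z" k S R "snd z"] by (simp add: closed_strip_def)
  show ?thesis
    unfolding C12_tx_def
  proof (intro conjI allI)
    show "continuous_on (closed_strip T) ?f"
      unfolding test_fun_def using assms by (intro continuous_intros) auto
    show "\<forall>z\<in>closed_strip T. has_partial_t ?f z"
      using differentiableI_vector[OF test_fun_time_derivative]
      by (auto simp: has_partial_t_def closed_strip_def)
    show "continuous_on (closed_strip T) (partial_t ?f)"
    proof (rule continuous_on_eq[OF _ pt[symmetric]])
      show "continuous_on (closed_strip T)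
          (\<lambda>z. - (real (k + 2) / S) * max 0 (1 - fst z / S) ^ Suc k * bump (snd z /\<^sub>R R))"
        using assms by (intro continuous_intros) auto
    qed
    fix i j :: 'n
    show "\<forall>(t, x)\<in>closed_strip T. has_partial_x i (slice ?f t) x"
      unfolding sl has_partial_x_def
      using real_differentiable_def[THEN iffD2, OF exI, OF partial_x_scaled_bump] by blast
    show "continuous_on (closed_strip T) (\<lambda>(t, x). partial_x i (slice ?f t) x)"
      unfolding sl partial_x_bump case_prod_unfold
      using assms by (intro continuous_intros) auto
    show "\<forall>(t, x)\<in>closed_strip T. has_partial_x j (partial_x i (slice ?f t)) x"
      unfolding sl has_partial_x_def partial_x_bump
      using real_differentiable_def[THEN iffD2, OF exI, OF partial_x_scaled_bump2] by blast
    show "continuous_on (closed_strip T) (\<lambda>(t, x). partial_x j (partial_x i (slice ?f t)) x)"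
      unfolding sl partial_x_bump2 case_prod_unfold
      using assms by (intro continuous_intros) auto
  qed
qed

lemma compactly_supported_test_fun:
  assumes "0 < S" "0 < R" "0 < k"
  shows "compactly_supported \<infinity> (test_fun k S R :: real \<times> (real ^ 'n) \<Rightarrow> real)"
proof -
  let ?A = "{z \<in> closed_strip \<infinity>. test_fun k S R (z :: real \<times> (real ^ 'n)) \<noteq> 0}"
  let ?K = "{0..S} \<times> cball (0 :: real ^ 'n) R"
  have "?A \<subseteq> ?K"
  proof
    fix z assume z: "z \<in> ?A"
    then have "0 \<le> fst z" by (simp add: closed_strip_def)
    moreover have "fst z \<le> S"
    proof (rule ccontr)
      assume "\<not> fst z \<le> S"
      then have "1 - fst z / S \<le> 0" using assms by (simp add: field_simps)
      then show False using z assms by (simp add: test_fun_def max_def split: if_splits)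
    qed
    moreover have "norm (snd z) \<le> R"
    proof (rule ccontr)
      assume "\<not> norm (snd z) \<le> R"
      then have "1 \<le> norm (snd z /\<^sub>R R)" using assms by (simp add: field_simps)
      then show False using z bump_eq_0[of "snd z /\<^sub>R R"] by (simp add: test_fun_def)
    qed
    ultimately show "z \<in> ?K" by (cases z) simp
  qed
  moreover have "compact ?K" by (intro compact_Times) auto
  ultimately have "closure ?A \<subseteq> ?K"
    by (simp add: closure_minimal compact_imp_closed)
  with \<open>compact ?K\<close> have "compact (closure ?A)" "closure ?A \<subseteq> closed_strip \<infinity>"
    by (auto simp: closed_strip_def compact_eq_bounded_closed intro: bounded_subset)
  then show ?thesis by (simp add: compactly_supported_def Let_def)
qed

section \<open>Integrals of powers of the norm\<close>

lemma nn_integral_lborel_affine: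
  fixes f :: "'a::euclidean_space \<Rightarrow> ennreal"
  assumes [measurable]: "f \<in> borel_measurable borel" and c: "c \<noteq> 0"
  shows "(\<integral>\<^sup>+x. f x \<partial>lborel) = ennreal (\<bar>c\<bar> ^ DIM('a)) * (\<integral>\<^sup>+x. f (t + c *\<^sub>R x) \<partial>lborel)"
  by (subst lborel_affine[OF c, of t])
     (simp add: nn_integral_density nn_integral_distr nn_integral_cmult ennreal_power)

lemma integral_lborel_affine:
  fixes f :: "'a::euclidean_space \<Rightarrow> real"
  assumes [measurable]: "f \<in> borel_measurable borel" and c: "c \<noteq> 0"
  shows "(LINT x|lborel. f x) = \<bar>c\<bar> ^ DIM('a) * (LINT x|lborel. f (t + c *\<^sub>R x))"
  by (subst lborel_affine[OF c, of t])
     (simp add: integral_density integral_distr)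

lemma nn_integral_cball_power:
  assumes "0 \<le> r" "0 \<le> a"
  shows "(\<integral>\<^sup>+y. ennreal a * indicator (cball 0 r) y \<partial>(lborel :: 'a::euclidean_space measure))
    = ennreal (a * (unit_ball_vol (DIM('a)) * r ^ DIM('a)))"
  using assms
  by (subst nn_integral_cmult_indicator)
    (auto simp: emeasure_cball ennreal_mult[symmetric] simp del: ennreal_mult intro!: ennreal_mult[symmetric])

text \<open>Domination by a series of indicators of overlapping balls takes the place of a
  decomposition into annuli. Growing radii give decay at infinity, shrinking radii a singularity at
  the origin.\<close>

lemma nn_integral_dyadic_cball_finite:
  fixes f :: "'a::euclidean_space \<Rightarrow> ennreal" and a r :: "nat \<Rightarrow> real"
  assumes a: "\<And>k. 0 \<le> a k" and r: "\<And>k. 0 \<le> r k"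
    and summable: "summable (\<lambda>k. a k * r k ^ DIM('a))"
    and bound: "\<And>y. f y \<noteq> 0 \<Longrightarrow> \<exists>k. norm y \<le> r k \<and> f y \<le> ennreal (a k)"
  shows "(\<integral>\<^sup>+y. f y \<partial>lborel) < \<infinity>"
proof -
  let ?V = "unit_ball_vol (DIM('a))"
  have "f y \<le> (\<Sum>k. ennreal (a k) * indicator (cball 0 (r k)) y)" for y
  proof (cases "f y = 0")
    case False
    then obtain k where k: "norm y \<le> r k" "f y \<le> ennreal (a k)" using bound by blast
    have "f y \<le> (\<Sum>j\<in>{k}. ennreal (a j) * indicator (cball 0 (r j)) y)" using k by simp
    also have "\<dots> \<le> (\<Sum>j. ennreal (a j) * indicator (cball 0 (r j)) y)"
      by (intro sum_le_suminf) auto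
    finally show ?thesis .
  qed simp
  then have "(\<integral>\<^sup>+y. f y \<partial>lborel) \<le> (\<integral>\<^sup>+y. (\<Sum>k. ennreal (a k) * indicator (cball 0 (r k)) y) \<partial>(lborel :: 'a measure))"
    by (intro nn_integral_mono)
  also have "\<dots> = (\<Sum>k. ennreal (a k * (?V * r k ^ DIM('a))))"
  proof (subst nn_integral_suminf)
    fix k
    have [measurable]: "cball (0 :: 'a) (r k) \<in> sets borel" by simp
    show "(\<lambda>y :: 'a. ennreal (a k) * indicator (cball 0 (r k)) y) \<in> borel_measurable lborel"
      unfolding measurable_lborel1 by measurable
  qed (simp add: nn_integral_cball_power a r)
  also have "\<dots> < \<infinity>"
  proof -
    have "summable (\<lambda>k. ?V * (a k * r k ^ DIM('a)))" by (intro summable_mult summable)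
    then have "summable (\<lambda>k. a k * (?V * r k ^ DIM('a)))" by (simp add: mult.left_commute)
    then have "(\<Sum>k. ennreal (a k * (?V * r k ^ DIM('a)))) \<noteq> top"
      by (intro ennreal_suminf_neq_top) (auto simp: a r)
    then show ?thesis by (simp add: top.not_eq_extremum)
  qed
  finally show ?thesis .
qed

lemma nn_integral_decay_finite:
  fixes q :: real
  assumes q: "real DIM('a::euclidean_space) < q"
  shows "(\<integral>\<^sup>+y. ennreal ((1 + norm (y :: 'a)) powr (- q)) \<partial>lborel) < \<infinity>"
proof (rule nn_integral_dyadic_cball_finite[where a="\<lambda>k. 2 powr (- q * real k)" and r="\<lambda>k. 2 ^ Suc k"])
  let ?n = "DIM('a)"
  have eq: "2 powr (- q * real k) * (2 ^ Suc k) ^ ?n = 2 ^ ?n * (2 powr (real ?n - q)) ^ k" for k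
  proof -
    have "(2 ^ Suc k :: real) ^ ?n = 2 ^ ?n * 2 powr (real ?n * real k)"
      by (simp add: powr_realpow[symmetric] powr_powr powr_mult mult.commute power_mult_distrib)
    moreover have "(2 powr (real ?n - q)) ^ k = 2 powr (real ?n * real k) * 2 powr (- q * real k)"
      by (simp add: powr_realpow[symmetric] powr_add[symmetric] powr_powr algebra_simps)
    ultimately show ?thesis by simp
  qed
  have "(2::real) powr (real ?n - q) < 1" using q by (simp add: powr_less_one)
  then show "summable (\<lambda>k. 2 powr (- q * real k) * (2 ^ Suc k :: real) ^ ?n)"
    unfolding eq by (intro summable_mult summable_geometric) simp
  fix y :: 'a
  obtain k0 :: nat where "norm y < 2 ^ k0" using real_arch_pow[of 2 "norm y"] by auto
  then have ex: "norm y \<le> 2 ^ Suc k0"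
    using power_increasing[of k0 "Suc k0" "2 :: real"] by linarith
  define k where "k = (LEAST k. norm y \<le> 2 ^ Suc k)"
  have k: "norm y \<le> 2 ^ Suc k" unfolding k_def using ex by (rule LeastI)
  \<comment> \<open>For positive \<open>k\<close> this is the minimality of \<open>k\<close>; for
    \<open>k = 0\<close> the summand 1 provides it.\<close>
  have "2 ^ k \<le> 1 + norm y"
  proof (cases k)
    case (Suc j)
    then have "\<not> norm y \<le> 2 ^ Suc j" using not_less_Least[of j "\<lambda>k. norm y \<le> 2 ^ Suc k"] k_def by auto
    then show ?thesis using Suc by simp
  qed simp
  then have "(1 + norm y) powr (- q) \<le> (2 ^ k) powr (- q)"
    using q by (intro powr_mono2') auto
  also have "\<dots> = 2 powr (- q * real k)"
    by (simp add: powr_realpow[symmetric] powr_powr mult.commute)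
  finally show "\<exists>k. norm y \<le> 2 ^ Suc k \<and> ennreal ((1 + norm y) powr (- q)) \<le> ennreal (2 powr (- q * real k))"
    using k by (intro exI[of _ k]) (simp add: ennreal_leI)
qed auto

text \<open>The application has s = n + \<beta> - 2, which is negative for n = 1 and \<beta> < 1, so
  both signs are covered. The factor \<open>2 powr \<bar>s\<bar>\<close> pays for the ratio 2
  between the radii that enclose \<open>norm y\<close>.\<close>

lemma nn_integral_singularity_finite:
  fixes s :: real
  assumes s: "s < real DIM('a::euclidean_space)"
  shows "(\<integral>\<^sup>+y. ennreal (indicator (cball 0 1) y * norm (y :: 'a) powr (- s)) \<partial>lborel) < \<infinity>"
proof (rule nn_integral_dyadic_cball_finite[where a="\<lambda>k. 2 powr \<bar>s\<bar> * 2 powr (s * real k)" and r="\<lambda>k. (1/2) ^ k"])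
  let ?n = "DIM('a)"
  have eq: "2 powr \<bar>s\<bar> * 2 powr (s * real k) * ((1/2) ^ k) ^ ?n = 2 powr \<bar>s\<bar> * (2 powr (s - real ?n)) ^ k" for k
  proof -
    have "((1/2) ^ k :: real) ^ ?n = 2 powr (- real ?n * real k)"
      by (simp add: powr_minus power_divide powr_realpow[symmetric] powr_powr field_simps)
    moreover have "(2 powr (s - real ?n)) ^ k = 2 powr (s * real k) * 2 powr (- real ?n * real k)"
      by (simp add: powr_realpow[symmetric] powr_add[symmetric] powr_powr algebra_simps)
    ultimately show ?thesis by simp
  qed
  have "(2::real) powr (s - real ?n) < 1" using s by (simp add: powr_less_one)
  then show "summable (\<lambda>k. 2 powr \<bar>s\<bar> * 2 powr (s * real k) * ((1/2) ^ k :: real) ^ ?n)"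
    unfolding eq by (intro summable_mult summable_geometric) simp
  fix y :: 'a
  assume "ennreal (indicator (cball 0 1) y * norm y powr (- s)) \<noteq> 0"
  \<comment> \<open>As \<open>0 powr (- s)\<close> is \<open>0\<close>, the integrand vanishes at
    the origin, which therefore needs no ball.\<close>
  then have y: "y \<noteq> 0" "norm y \<le> 1" by (auto simp: indicator_def split: if_splits)
  obtain k0 :: nat where "(1/2) ^ k0 < norm y" using real_arch_pow_inv[of "norm y" "1/2"] y by auto
  then have ex: "(1/2) ^ Suc k0 < norm y" 
    using power_decreasing[of k0 "Suc k0" "1/2 :: real"] by linarith
  define k where "k = (LEAST k. (1/2) ^ Suc k < norm y)"
  have k: "(1/2) ^ Suc k < norm y" unfolding k_def using ex by (rule LeastI)
  have k2: "norm y \<le> (1/2) ^ k"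
  proof (cases k)
    case (Suc j)
    then have "\<not> (1/2) ^ Suc j < norm y" using not_less_Least[of j "\<lambda>k. (1/2) ^ Suc k < norm y"] k_def by auto
    then show ?thesis using Suc by simp
  qed (use y in simp)
  have p: "((1/2) ^ m :: real) = 2 powr (- real m)" for m
    by (simp add: powr_minus powr_realpow field_simps power_divide)
  have "norm y powr (- s) \<le> 2 powr \<bar>s\<bar> * 2 powr (s * real k)"
  proof (cases "0 \<le> s")
    case True
    then have "norm y powr (- s) \<le> ((1/2) ^ Suc k) powr (- s)" using k by (intro powr_mono2') auto
    also have "\<dots> = 2 powr \<bar>s\<bar> * 2 powr (s * real k)"
      unfolding p using True by (simp add: powr_powr powr_add[symmetric] algebra_simps)
    finally show ?thesis .
  next
    case False
    then have "norm y powr (- s) \<le> ((1/2) ^ k) powr (- s)" using k2 y by (intro powr_mono2) auto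
    also have "\<dots> = 1 * 2 powr (s * real k)"
      unfolding p by (simp add: powr_powr algebra_simps)
    also have "\<dots> \<le> 2 powr \<bar>s\<bar> * 2 powr (s * real k)"
      by (intro mult_right_mono ge_one_powr_ge_zero) auto
    finally show ?thesis .
  qed
  then show "\<exists>k. norm y \<le> (1/2) ^ k \<and>
      ennreal (indicator (cball 0 1) y * norm y powr (- s)) \<le> ennreal (2 powr \<bar>s\<bar> * 2 powr (s * real k))"
    using k2 y by (intro exI[of _ k]) (simp add: ennreal_leI)
qed auto

lemma integrable_decay:
  assumes "real DIM('a::euclidean_space) < q"
  shows "integrable lborel (\<lambda>y :: 'a. (1 + norm y) powr (- q))"
  using nn_integral_decay_finite[OF assms] by (intro integrableI_nonneg) auto

lemma integrable_singularity:
  assumes "s < real DIM('a::euclidean_space)"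
  shows "integrable lborel (\<lambda>y :: 'a. indicator (cball 0 1) y * norm y powr (- s))"
proof (rule integrableI_nonneg)
  have [measurable]: "cball (0 :: 'a) 1 \<in> sets borel" by simp
  show "(\<lambda>y :: 'a. indicator (cball 0 1) y * norm y powr (- s)) \<in> borel_measurable lborel"
    unfolding measurable_lborel1 by measurable
qed (use nn_integral_singularity_finite[OF assms] in auto)

section \<open>The fractional Laplacian of the bump function\<close>

lemma borel_measurable_bump [measurable]: "(bump :: 'a::euclidean_space \<Rightarrow> real) \<in> borel_measurable borel"
  by (intro borel_measurable_continuous_onI continuous_intros)

text \<open>The first assumption says that r is at least 1/c, hence 1 + r \<le> (1 + c) * r: away
  from the origin a pure power and the regularized one are comparable.\<close>

lemma powr_neg_le_decay:
  fixes r :: real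
  assumes "1 \<le> r * c" "0 < r" "0 < c" "0 \<le> N"
  shows "r powr (- N) \<le> (1 + c) powr N * (1 + r) powr (- N)"
proof -
  have "1 + r \<le> (1 + c) * r" using assms by (simp add: algebra_simps)
  then have "((1 + c) * r) powr (- N) \<le> (1 + r) powr (- N)"
    using assms by (intro powr_mono2') auto
  then have "(1 + c) powr N * ((1 + c) powr (- N) * r powr (- N)) \<le> (1 + c) powr N * (1 + r) powr (- N)"
    using assms by (intro mult_left_mono) (auto simp: powr_mult)
  then show ?thesis using assms by (simp add: powr_minus field_simps)
qed

lemma frac_integral_outside_lborel:
  fixes v :: "real ^ 'n \<Rightarrow> real"
  assumes [measurable]: "v \<in> borel_measurable borel"
  shows "frac_integral_outside \<sigma> v x e = (LINT y|lborel. indicator {y. e < norm (x - y)} y *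
    ((v x - v y) / norm (x - y) powr (real CARD('n) + 2 * \<sigma>)))"
  unfolding frac_integral_outside_def set_lebesgue_integral_def real_scaleR_def
  by (rule integral_completion) measurable

text \<open>Substituting y = x + w and y = x - w and averaging cancels the first-order term. For
  fixed \<open>e\<close> each half is integrable by itself, so the two integrals may be added; the
  symmetric form is the one that survives \<open>e\<close> tending to 0.\<close>

lemma frac_integral_outside_bump:
  fixes x :: "real ^ 'n"
  assumes \<beta>: "0 < \<beta>" and "0 < e"
  shows "frac_integral_outside (\<beta> / 2) bump x e = (LINT w|lborel.
      indicator {w. e < norm w} w * (2 * bump x - bump (x + w) - bump (x - w)) / norm w powr (real CARD('n) + \<beta>)) / 2"
proof -
  define N where "N = real CARD('n) + \<beta>"
  define F where "F y = indicator {y. e < norm (x - y)} y * ((bump x - bump y) / norm (x - y) powr N)" for y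
  have [measurable]: "F \<in> borel_measurable borel" unfolding F_def by measurable
  have eq: "frac_integral_outside (\<beta> / 2) bump x e = (LINT y|lborel. F y)"
    unfolding F_def N_def by (subst frac_integral_outside_lborel) simp_all
  have F: "F (x + w) = indicator {w. e < norm w} w * (bump x - bump (x + w)) / norm w powr N" for w
    by (simp add: F_def indicator_def)
  have int: "integrable lborel (\<lambda>w. F (x + c *\<^sub>R w))" if c: "\<bar>c\<bar> = 1" for c
  proof (rule Bochner_Integration.integrable_bound)
    show "integrable lborel (\<lambda>w :: real ^ 'n. (1 + 1 / e) powr N * (1 + norm w) powr (- N))"
      using \<beta> by (intro integrable_mult_right integrable_decay) (simp add: N_def)
    show "AE w in lborel. norm (F (x + c *\<^sub>R w)) \<le> norm ((1 + 1 / e) powr N * (1 + norm w) powr (- N))"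
    proof (rule AE_I2)
      fix w :: "real ^ 'n"
      have "\<bar>F (x + c *\<^sub>R w)\<bar> \<le> (1 + 1 / e) powr N * (1 + norm w) powr (- N)"
      proof (cases "e < norm w")
        case True
        have "\<bar>bump x - bump (x + c *\<^sub>R w)\<bar> \<le> 1"
          using bump_le_1[of x] bump_le_1[of "x + c *\<^sub>R w"] bump_nonneg[of x] bump_nonneg[of "x + c *\<^sub>R w"]
          by linarith
        then have "\<bar>F (x + c *\<^sub>R w)\<bar> \<le> 1 / norm w powr N"
          using True c unfolding F by (simp add: divide_right_mono)
        also have "\<dots> = norm w powr (- N)" by (simp add: powr_minus_divide)
        also have "\<dots> \<le> (1 + 1 / e) powr N * (1 + norm w) powr (- N)"
          using True assms \<beta> by (intro powr_neg_le_decay) (auto simp: N_def field_simps)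
        finally show ?thesis .
      next
        case False
        then show ?thesis using c by (simp add: F)
      qed
      then show "norm (F (x + c *\<^sub>R w)) \<le> norm ((1 + 1 / e) powr N * (1 + norm w) powr (- N))" by simp
    qed
  qed measurable
  have "2 * (LINT y|lborel. F y) = (LINT w|lborel. F (x + 1 *\<^sub>R w)) + (LINT w|lborel. F (x + (- 1) *\<^sub>R w))"
    using integral_lborel_affine[of F 1 x] integral_lborel_affine[of F "-1" x] by simp
  also have "\<dots> = (LINT w|lborel. F (x + 1 *\<^sub>R w) + F (x + (- 1) *\<^sub>R w))"
    by (intro Bochner_Integration.integral_add[symmetric] int) auto
  also have "\<dots> = (LINT w|lborel.
      indicator {w. e < norm w} w * (2 * bump x - bump (x + w) - bump (x - w)) / norm w powr N)"
    unfolding F by (intro Bochner_Integration.integral_cong) (auto simp: indicator_def add_divide_distrib[symmetric] algebra_simps)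
  finally show ?thesis unfolding eq N_def by simp
qed

text \<open>The majorant \<open>M\<close> depends neither on \<open>x\<close> nor on
  \<open>e\<close>. Inside the unit ball it comes from the second difference and is integrable
  because \<beta> < 2; outside it comes from boundedness of the bump. Dominated convergence then
  gives the principal value, and the integral of \<open>M\<close> the uniform bound.\<close>

lemma frac_integral_outside_bump_limit:
  assumes \<beta>: "0 < \<beta>" and "\<beta> < 2"
  shows "\<exists>C\<ge>0. \<forall>x :: real ^ 'n. (\<forall>e>0. \<bar>frac_integral_outside (\<beta> / 2) bump x e\<bar> \<le> C) \<and>
    (\<exists>L. (frac_integral_outside (\<beta> / 2) bump x \<longlongrightarrow> L) (at_right 0))"
proof -
  define N where "N = real CARD('n) + \<beta>"
  define D where "D x w = 2 * bump x - bump (x + w) - bump (x - w)" for x w :: "real ^ 'n"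
  define G where "G x e w = indicator {w. e < norm w} w * D x w / norm w powr N" for x e w
  define M where "M w = 60 * (indicator (cball 0 1) w * norm w powr (- (N - 2)))
      + 2 * 2 powr N * (1 + norm w) powr (- N)" for w :: "real ^ 'n"
  have [measurable]: "G x e \<in> borel_measurable borel" for x e
    unfolding G_def D_def by measurable
  have M_int: "integrable lborel M"
    unfolding M_def[abs_def] using assms \<beta>
    by (intro Bochner_Integration.integrable_add integrable_mult_right integrable_decay integrable_singularity)
      (auto simp: N_def)
  have D2: "\<bar>D x w\<bar> \<le> 2" for x w
    using bump_le_1[of x] bump_le_1[of "x + w"] bump_le_1[of "x - w"]
      bump_nonneg[of x] bump_nonneg[of "x + w"] bump_nonneg[of "x - w"]
    unfolding D_def by linarith
  have DM: "\<bar>D x w\<bar> / norm w powr N \<le> M w" for x w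
  proof -
    consider "w = 0" | "w \<noteq> 0" "norm w \<le> 1" | "1 < norm w" by linarith
    then show ?thesis
    proof cases
      case 1 then show ?thesis by (simp add: M_def)
    next
      case 2
      have "\<bar>D x w\<bar> / norm w powr N \<le> 60 * (norm w)\<^sup>2 / norm w powr N"
        unfolding D_def by (intro divide_right_mono bump_second_difference) auto
      also have "\<dots> = 60 * norm w powr (- (N - 2))"
        using 2 powr_diff[of "norm w" 2 N] by simp
      also have "\<dots> \<le> M w" using 2 by (simp add: M_def)
      finally show ?thesis .
    next
      case 3
      have "\<bar>D x w\<bar> / norm w powr N \<le> 2 / norm w powr N"
        by (intro divide_right_mono D2) auto
      also have "\<dots> = 2 * norm w powr (- N)" by (simp add: powr_minus_divide)
      also have "\<dots> \<le> 2 * ((1 + 1) powr N * (1 + norm w) powr (- N))"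
        using 3 \<beta> by (intro mult_left_mono powr_neg_le_decay) (auto simp: N_def)
      also have "\<dots> \<le> M w" by (simp add: M_def)
      finally show ?thesis .
    qed
  qed
  have GM: "\<bar>G x e w\<bar> \<le> M w" for x e w
    using DM[of x w] order_trans[OF _ DM[of x w], of 0] by (auto simp: G_def indicator_def)
  have eq: "frac_integral_outside (\<beta> / 2) bump x e = (LINT w|lborel. G x e w) / 2" if "0 < e" for x e
    using frac_integral_outside_bump[OF \<beta> that] by (simp add: G_def D_def N_def)
  have "\<bar>LINT w|lborel. G x e w\<bar> \<le> (LINT w|lborel. M w)" for x e
  proof -
    have "integrable lborel (G x e)"
      by (rule Bochner_Integration.integrable_bound[OF M_int]) (use order_trans[OF GM abs_ge_self] in auto)
    from Bochner_Integration.integral_norm_bound_integral[OF this M_int] GM show ?thesis by simp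
  qed
  then have b: "\<bar>frac_integral_outside (\<beta> / 2) bump x e\<bar> \<le> (LINT w|lborel. M w) / 2"
    if "0 < e" for x :: "real ^ 'n" and e
    using that by (simp add: eq)
  have lim: "(frac_integral_outside (\<beta> / 2) bump x \<longlongrightarrow> (LINT w|lborel. G x 0 w) / 2) (at_right 0)" for x
  proof -
    \<comment> \<open>The radius is written as \<open>inverse t\<close> with \<open>t\<close>
      tending to infinity. For each nonzero \<open>w\<close> the integrand is eventually constant in
      \<open>t\<close>.\<close>
    have "((\<lambda>t. LINT w|lborel. G x (inverse t) w) \<longlongrightarrow> (LINT w|lborel. G x 0 w)) at_top"
    proof (rule integral_dominated_convergence_at_top[OF _ _ M_int])
      show "AE w in lborel. ((\<lambda>t. G x (inverse t) w) \<longlongrightarrow> G x 0 w) at_top"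
      proof (rule AE_I2)
        fix w :: "real ^ 'n"
        show "((\<lambda>t. G x (inverse t) w) \<longlongrightarrow> G x 0 w) at_top"
        proof (cases "w = 0")
          case False
          have "\<forall>\<^sub>F t in at_top. inverse (norm w) < (t::real)" by (rule eventually_gt_at_top)
          then have "\<forall>\<^sub>F t in at_top. G x (inverse t) w = G x 0 w"
          proof eventually_elim
            case (elim t)
            then have "inverse t < norm w"
              using False less_imp_inverse_less[of "inverse (norm w)" t] by simp
            then show ?case using False by (simp add: G_def)
          qed
          then show ?thesis by (rule tendsto_eventually)
        qed (simp add: G_def D_def)
      qed
      show "\<forall>\<^sub>F t in at_top. AE w in lborel. norm (G x (inverse t) w) \<le> M w"
        using GM by simp
    qed simp_all
    then have "((\<lambda>e. LINT w|lborel. G x e w) \<longlongrightarrow> (LINT w|lborel. G x 0 w)) (at_right 0)"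
      by (simp add: filterlim_at_right_to_top)
    then have "((\<lambda>e. (LINT w|lborel. G x e w) / 2) \<longlongrightarrow> (LINT w|lborel. G x 0 w) / 2) (at_right 0)"
      by (intro tendsto_intros) auto
    moreover have "\<forall>\<^sub>F e in at_right 0. (LINT w|lborel. G x e w) / 2 = frac_integral_outside (\<beta> / 2) bump x e"
      using eventually_at_right_less by eventually_elim (simp add: eq)
    ultimately show ?thesis by (rule Lim_transform_eventually)
  qed
  have "0 \<le> (LINT w|lborel. M w) / 2"
    by (intro divide_nonneg_pos integral_nonneg) (auto simp: M_def)
  moreover have "(\<forall>e>0. \<bar>frac_integral_outside (\<beta> / 2) bump x e\<bar> \<le> (LINT w|lborel. M w) / 2) \<and>
      (\<exists>L. (frac_integral_outside (\<beta> / 2) bump x \<longlongrightarrow> L) (at_right 0))" for x :: "real ^ 'n"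
    using b lim[of x] by (intro conjI allI impI exI)
  ultimately show ?thesis by (intro exI[of _ "(LINT w|lborel. M w) / 2"]) simp
qed

text \<open>The bump vanishes at \<open>x\<close>, so only y in the unit ball contributes, and there
  |x - y| \<ge> |x| / 2. No cancellation is involved, hence the bound is uniform in
  \<open>e\<close>.\<close>

lemma frac_integral_outside_bump_far:
  fixes x :: "real ^ 'n"
  assumes \<beta>: "0 < \<beta>" and "2 \<le> norm x"
  shows "\<bar>frac_integral_outside (\<beta> / 2) bump x e\<bar> \<le>
    measure lborel (cball (0 :: real ^ 'n) 1) * (norm x / 2) powr (- (real CARD('n) + \<beta>))"
proof -
  define N where "N = real CARD('n) + \<beta>"
  define F where "F y = indicator {y. e < norm (x - y)} y * ((bump x - bump y) / norm (x - y) powr N)" for y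
  have [measurable]: "F \<in> borel_measurable borel" unfolding F_def by measurable
  have eq: "frac_integral_outside (\<beta> / 2) bump x e = (LINT y|lborel. F y)"
    unfolding F_def N_def by (subst frac_integral_outside_lborel) simp_all
  have b: "\<bar>F y\<bar> \<le> indicator (cball 0 1) y * (norm x / 2) powr (- N)" for y
  proof (cases "norm y \<le> 1")
    case True
    have "norm x / 2 \<le> norm (x - y)" using True assms norm_triangle_ineq2[of x y] by linarith
    then have p: "norm (x - y) powr (- N) \<le> (norm x / 2) powr (- N)"
      using assms \<beta> by (intro powr_mono2') (auto simp: N_def)
    have "\<bar>F y\<bar> \<le> bump y * norm (x - y) powr (- N)"
      using bump_eq_0[of x] assms by (simp add: F_def indicator_def powr_minus_divide abs_mult)
    also have "\<dots> \<le> 1 * (norm x / 2) powr (- N)" using p bump_le_1[of y] by (intro mult_mono) auto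
    finally show ?thesis using True by simp
  next
    case False
    then show ?thesis using bump_eq_0[of x] bump_eq_0[of y] assms by (simp add: F_def)
  qed
  have int: "integrable lborel (\<lambda>y :: real ^ 'n. indicator (cball 0 1) y * (norm x / 2) powr (- N))"
    by (intro integrable_mult_left integrable_real_indicator) (auto simp: emeasure_cball)
  have "\<bar>LINT y|lborel. F y\<bar> \<le> (LINT y|lborel. indicator (cball (0 :: real ^ 'n) 1) y * (norm x / 2) powr (- N))"
  proof -
    have "integrable lborel F"
      by (rule Bochner_Integration.integrable_bound[OF int]) (use order_trans[OF b abs_ge_self] in auto)
    from Bochner_Integration.integral_norm_bound_integral[OF this int] b show ?thesis by simp
  qed
  then show ?thesis unfolding eq by (simp add: N_def)
qed

text \<open>The substitution y = R w. The volume gives R^n and the kernel R^(-n-\<beta>), and the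
  radius of the removed ball is rescaled as well.\<close>

lemma frac_integral_outside_scale:
  fixes x :: "real ^ 'n"
  assumes "0 < R"
  shows "frac_integral_outside (\<beta> / 2) (\<lambda>x. c * bump (x /\<^sub>R R)) x e =
    c * R powr (- \<beta>) * frac_integral_outside (\<beta> / 2) bump (x /\<^sub>R R) (e / R)"
proof -
  define N where "N = real CARD('n) + \<beta>"
  define F where "F y = indicator {y. e < norm (x - y)} y * ((c * bump (x /\<^sub>R R) - c * bump (y /\<^sub>R R)) / norm (x - y) powr N)" for y
  define G where "G y = indicator {y. e / R < norm (x /\<^sub>R R - y)} y * ((bump (x /\<^sub>R R) - bump y) / norm (x /\<^sub>R R - y) powr N)" for y
  define g where "g y = c * bump (y /\<^sub>R R)" for y :: "real ^ 'n"
  have m [measurable]: "g \<in> borel_measurable borel"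
    unfolding g_def by (intro borel_measurable_continuous_onI continuous_intros)
  have fm: "F \<in> borel_measurable borel"
    unfolding F_def g_def[symmetric] by measurable
  have eq: "frac_integral_outside (\<beta> / 2) (\<lambda>x. c * bump (x /\<^sub>R R)) x e = (LINT y|lborel. F y)"
    unfolding F_def N_def g_def[symmetric] by (subst frac_integral_outside_lborel[OF m]) simp
  have eq2: "frac_integral_outside (\<beta> / 2) bump (x /\<^sub>R R) (e / R) = (LINT y|lborel. G y)"
    unfolding G_def N_def by (subst frac_integral_outside_lborel) simp_all
  have FG: "F (0 + R *\<^sub>R w) = c * R powr (- N) * G w" for w
  proof -
    have e: "x - R *\<^sub>R w = R *\<^sub>R (x /\<^sub>R R - w)" using assms by (simp add: scaleR_diff_right)
    have n: "norm (x - R *\<^sub>R w) = R * norm (x /\<^sub>R R - w)"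
      unfolding e norm_scaleR using assms by (simp only: abs_of_pos)
    have i: "indicator {y. e < norm (x - y)} (R *\<^sub>R w) = (indicator {y. e / R < norm (x /\<^sub>R R - y)} w :: real)"
      using assms n by (simp add: indicator_def divide_less_eq mult.commute)
    have p: "(R * d) powr N = R powr N * d powr N" if "0 \<le> d" for d
      using assms that by (simp add: powr_mult)
    have "F (0 + R *\<^sub>R w) = indicator {y. e / R < norm (x /\<^sub>R R - y)} w *
        (c * (bump (x /\<^sub>R R) - bump w) / (R powr N * norm (x /\<^sub>R R - w) powr N))"
      using assms unfolding F_def add_0 i n by (simp add: p right_diff_distrib)
    then show ?thesis by (simp add: G_def powr_minus_divide)
  qed
  have "(LINT y|lborel. F y) = R ^ CARD('n) * (LINT w|lborel. F (0 + R *\<^sub>R w))"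
    using integral_lborel_affine[OF fm, of R 0] assms by simp
  also have "\<dots> = (R ^ CARD('n) * R powr (- N)) * c * (LINT w|lborel. G w)"
    unfolding FG by simp
  also have "R ^ CARD('n) * R powr (- N) = R powr (- \<beta>)"
    using assms by (simp add: N_def powr_realpow[symmetric] powr_add[symmetric])
  finally show ?thesis by (simp add: eq eq2)
qed

text \<open>The uniform bound handles |x| < 2 and the far bound the rest. The number 3 fits both: 1
  + |x| \<le> 3 in the first zone, and (1 + |x|) / 3 \<le> |x| / 2 in the second.\<close>

lemma frac_integral_outside_bump_bound:
  assumes "0 < \<beta>" "\<beta> < 2"
  shows "\<exists>C\<ge>0. \<forall>(x :: real ^ 'n). \<exists>L. (frac_integral_outside (\<beta> / 2) bump x \<longlongrightarrow> L) (at_right 0) \<and>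
    \<bar>L\<bar> \<le> C * (1 + norm x) powr (- (real CARD('n) + \<beta>))"
proof -
  define N where "N = real CARD('n) + \<beta>"
  define V where "V = measure lborel (cball (0 :: real ^ 'n) 1)"
  have "0 \<le> V" by (simp add: V_def)
  obtain C where C: "0 \<le> C"
    and b: "\<And>(x :: real ^ 'n) e. 0 < e \<Longrightarrow> \<bar>frac_integral_outside (\<beta> / 2) bump x e\<bar> \<le> C"
    and lim: "\<And>x :: real ^ 'n. \<exists>L. (frac_integral_outside (\<beta> / 2) bump x \<longlongrightarrow> L) (at_right 0)"
    using frac_integral_outside_bump_limit[OF assms, where 'n='n] by metis
  have "\<bar>frac_integral_outside (\<beta> / 2) bump x e\<bar> \<le> (C + V) * 3 powr N * (1 + norm x) powr (- N)"
    if "0 < e" for x :: "real ^ 'n" and e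
  proof (cases "2 \<le> norm x")
    case True
    have "(norm x / 2) powr (- N) \<le> ((1 + norm x) / 3) powr (- N)"
      using True assms by (intro powr_mono2') (auto simp: N_def)
    also have "\<dots> = 3 powr N * (1 + norm x) powr (- N)"
      by (simp add: powr_divide powr_minus field_simps)
    finally have *: "(norm x / 2) powr (- N) \<le> 3 powr N * (1 + norm x) powr (- N)" .
    have "\<bar>frac_integral_outside (\<beta> / 2) bump x e\<bar> \<le> V * (norm x / 2) powr (- N)"
      unfolding V_def N_def by (rule frac_integral_outside_bump_far[OF assms(1) True])
    also have "\<dots> \<le> (C + V) * (3 powr N * (1 + norm x) powr (- N))"
      using C \<open>0 \<le> V\<close> * by (intro mult_mono) auto
    finally show ?thesis by simp
  next
    case False
    have "3 powr (- N) \<le> (1 + norm x) powr (- N)"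
      using False assms by (intro powr_mono2') (auto simp: N_def add_pos_nonneg)
    then have "3 powr N * 3 powr (- N) \<le> 3 powr N * (1 + norm x) powr (- N)"
      by (intro mult_left_mono) auto
    then have *: "1 \<le> 3 powr N * (1 + norm x) powr (- N)" by (simp add: powr_add[symmetric])
    have "\<bar>frac_integral_outside (\<beta> / 2) bump x e\<bar> \<le> C * 1" using b[OF that, of x] by simp
    also have "\<dots> \<le> (C + V) * (3 powr N * (1 + norm x) powr (- N))"
      using C \<open>0 \<le> V\<close> * by (intro mult_mono) auto
    finally show ?thesis by simp
  qed
  then have bb: "\<forall>\<^sub>F e in at_right 0. \<bar>frac_integral_outside (\<beta> / 2) bump x e\<bar> \<le> (C + V) * 3 powr N * (1 + norm x) powr (- N)"
    for x :: "real ^ 'n"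
    by (auto intro: eventually_mono[OF eventually_at_right_less])
  show ?thesis
  proof (rule exI[of _ "(C + V) * 3 powr N"], intro conjI allI)
    show "0 \<le> (C + V) * 3 powr N" using C \<open>0 \<le> V\<close> by simp
    fix x :: "real ^ 'n"
    obtain L where L: "(frac_integral_outside (\<beta> / 2) bump x \<longlongrightarrow> L) (at_right 0)" using lim by blast
    have "\<bar>L\<bar> \<le> (C + V) * 3 powr N * (1 + norm x) powr (- N)"
      by (rule tendsto_upperbound[OF tendsto_rabs[OF L] bb]) simp
    then show "\<exists>L. (frac_integral_outside (\<beta> / 2) bump x \<longlongrightarrow> L) (at_right 0) \<and>
        \<bar>L\<bar> \<le> (C + V) * 3 powr N * (1 + norm x) powr (- (real CARD('n) + \<beta>))"
      using L by (auto simp: N_def)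
  qed
qed

lemma indicator_le_decay:
  fixes r N :: real
  assumes "0 \<le> r" "r \<le> 1" "0 \<le> N"
  shows "1 \<le> 2 powr N * (1 + r) powr (- N)"
proof -
  have "2 powr (- N) \<le> (1 + r) powr (- N)" using assms by (intro powr_mono2') auto
  then have "2 powr N * 2 powr (- N) \<le> 2 powr N * (1 + r) powr (- N)"
    by (intro mult_left_mono) auto
  then show ?thesis by (simp add: powr_add[symmetric])
qed

text \<open>The classical Laplacian of the bump has compact support. Stating a mere power decay
  gives it the same form as the fractional case with \<beta> = 2.\<close>

lemma laplacian_scaled_bump_bound:
  fixes x :: "real ^ 'n"
  assumes "0 < R" "0 \<le> c"
  shows "\<bar>laplacian (\<lambda>x. c * bump (x /\<^sub>R R)) x\<bar> \<le>
    30 * real CARD('n) * 2 powr (real CARD('n) + 2) * c * R powr (- 2)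
      * (1 + norm x / R) powr (- (real CARD('n) + 2))"
proof (cases "1 \<le> norm (x /\<^sub>R R)")
  case True
  then show ?thesis using assms by (simp add: laplacian_def partial_x_bump2 cutoff_eq_0)
next
  case False
  define z where "z = x /\<^sub>R R"
  define N where "N = real CARD('n) + 2"
  have z: "norm z < 1" "norm z = norm x / R" using False assms by (auto simp: z_def field_simps)
  have t: "\<bar>24 * cutoff z * inner z (axis i 1 /\<^sub>R R) * inner z (axis i 1 /\<^sub>R R)
        - 6 * cutoff z ^ 2 * inner (axis i 1 /\<^sub>R R) (axis i 1 /\<^sub>R R :: real ^ 'n)\<bar> \<le> 30 * R powr (-2)" for i
  proof -
    have "\<bar>z $ i\<bar> \<le> 1" using component_le_norm_cart[of z i] z by linarith
    then have s: "(z $ i)\<^sup>2 \<le> 1" by (simp add: abs_square_le_1)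
    have c: "0 \<le> cutoff z" "cutoff z \<le> 1" "cutoff z ^ 2 \<le> 1"
      by (auto simp: cutoff_le_1 power_le_one)
    have "cutoff z * (z $ i)\<^sup>2 \<le> 1 * 1" using s c by (intro mult_mono) auto
    moreover have "0 \<le> cutoff z * (z $ i)\<^sup>2" "0 \<le> cutoff z ^ 2" by auto
    ultimately have "\<bar>24 * (cutoff z * (z $ i)\<^sup>2) - 6 * cutoff z ^ 2\<bar> \<le> 30" using c by linarith
    then have "\<bar>24 * (cutoff z * (z $ i)\<^sup>2) - 6 * cutoff z ^ 2\<bar> * R powr (-2) \<le> 30 * R powr (-2)"
      by (intro mult_right_mono) auto
    moreover have r: "R powr (-2) = inverse R * inverse R"
      using assms powr_realpow[of R 2] by (simp add: powr_minus power2_eq_square)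
    have "24 * cutoff z * inner z (axis i 1 /\<^sub>R R) * inner z (axis i 1 /\<^sub>R R)
        - 6 * cutoff z ^ 2 * inner (axis i 1 /\<^sub>R R) (axis i 1 /\<^sub>R R :: real ^ 'n)
      = (24 * (cutoff z * (z $ i)\<^sup>2) - 6 * cutoff z ^ 2) * R powr (-2)"
      unfolding r by (simp add: inner_axis inner_axis_axis power2_eq_square algebra_simps)
    ultimately show ?thesis by (simp add: abs_mult)
  qed
  have "\<bar>laplacian (\<lambda>x. c * bump (x /\<^sub>R R)) x\<bar> \<le> (\<Sum>i\<in>(UNIV :: 'n set). c * (30 * R powr (-2)))"
    unfolding laplacian_def partial_x_bump2 z_def[symmetric]
    using t assms by (intro sum_abs[THEN order_trans] sum_mono) (simp add: abs_mult mult_left_mono)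
  also have "\<dots> = (30 * real CARD('n) * c * R powr (-2)) * 1" by simp
  also have "\<dots> \<le> (30 * real CARD('n) * c * R powr (-2)) * (2 powr N * (1 + norm z) powr (- N))"
    using assms z by (intro mult_left_mono indicator_le_decay) (auto simp: N_def)
  finally show ?thesis unfolding z(2) N_def by (simp add: mult_ac)
qed

text \<open>The constant is uniform in \<open>R\<close>, \<open>c\<close> and \<open>x\<close>; the
  factor \<open>c\<close> is later the value of the time factor, frozen at a given time.\<close>

proposition frac_laplacian_scaled_bump_bound:
  assumes "0 < \<beta>" "\<beta> \<le> 2"
  shows "\<exists>C\<ge>0. \<forall>R>0. \<forall>c\<ge>0. \<forall>x :: real ^ 'n. \<bar>frac_laplacian \<beta> (\<lambda>x. c * bump (x /\<^sub>R R)) x\<bar> \<le>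
    C * c * R powr (- \<beta>) * (1 + norm x / R) powr (- (real CARD('n) + \<beta>))"
proof (cases "\<beta> = 2")
  case True
  show ?thesis
    unfolding frac_laplacian_def True using laplacian_scaled_bump_bound[where 'n='n]
    by (intro exI[of _ "30 * real CARD('n) * 2 powr (real CARD('n) + 2)"]) simp
next
  case False
  define N where "N = real CARD('n) + \<beta>"
  define K where "K = \<bar>frac_const CARD('n) (\<beta> / 2)\<bar>"
  from False assms have "\<beta> < 2" by simp
  obtain C where C: "0 \<le> C" and ex: "\<And>x :: real ^ 'n. \<exists>L. (frac_integral_outside (\<beta> / 2) bump x \<longlongrightarrow> L) (at_right 0) \<and>
    \<bar>L\<bar> \<le> C * (1 + norm x) powr (- N)"
    using frac_integral_outside_bump_bound[OF assms(1) \<open>\<beta> < 2\<close>, where 'n='n] unfolding N_def by metis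
  show ?thesis
  proof (intro exI[of _ "K * C"] conjI allI impI)
    show "0 \<le> K * C" using C by (simp add: K_def)
    fix R c :: real and x :: "real ^ 'n" assume R: "0 < R" and c: "0 \<le> c"
    obtain L where L: "(frac_integral_outside (\<beta> / 2) bump (x /\<^sub>R R) \<longlongrightarrow> L) (at_right 0)"
      and bL: "\<bar>L\<bar> \<le> C * (1 + norm (x /\<^sub>R R)) powr (- N)" using ex by blast
    \<comment> \<open>Scaling changes the radius of the removed ball from e to e / R, which tends to
      0 from the right too. Existence of the limit is what gives \<open>Lim\<close> its intended
      value.\<close>
    have "filterlim (\<lambda>e. e / R) (at_right 0) (at_right (0::real))"
      unfolding filterlim_at
      using R by (auto intro!: tendsto_eq_intros eventually_mono[OF eventually_at_right_less])
    from filterlim_compose[OF L this]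
    have "((\<lambda>e. c * R powr (- \<beta>) * frac_integral_outside (\<beta> / 2) bump (x /\<^sub>R R) (e / R)) \<longlongrightarrow> c * R powr (- \<beta>) * L) (at_right 0)"
      by (intro tendsto_intros)
    then have "(frac_integral_outside (\<beta> / 2) (\<lambda>x. c * bump (x /\<^sub>R R)) x \<longlongrightarrow> c * R powr (- \<beta>) * L) (at_right 0)"
      unfolding frac_integral_outside_scale[OF R] .
    then have "Lim (at_right 0) (frac_integral_outside (\<beta> / 2) (\<lambda>x. c * bump (x /\<^sub>R R)) x) = c * R powr (- \<beta>) * L"
      by (intro tendsto_Lim) auto
    then have "\<bar>frac_laplacian \<beta> (\<lambda>x. c * bump (x /\<^sub>R R)) x\<bar> = K * (c * R powr (- \<beta>) * \<bar>L\<bar>)"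
      using False c by (simp add: frac_laplacian_def K_def abs_mult)
    also have "\<dots> \<le> K * (c * R powr (- \<beta>) * (C * (1 + norm (x /\<^sub>R R)) powr (- N)))"
      using c bL by (intro mult_left_mono) (auto simp: K_def)
    also have "norm (x /\<^sub>R R) = norm x / R" using R by (simp add: divide_inverse mult.commute)
    finally show "\<bar>frac_laplacian \<beta> (\<lambda>x. c * bump (x /\<^sub>R R)) x\<bar> \<le>
        K * C * c * R powr (- \<beta>) * (1 + norm x / R) powr (- (real CARD('n) + \<beta>))"
      by (simp add: N_def mult_ac)
  qed
qed

section \<open>The weak formulation\<close>

text \<open>Local integrability yields measurability only on compact subsets of the open half space,
  so these are exhausted by the sets \<open>K m\<close>. A Borel representative has Borel slices at
  every time, as the iterated integrals require.\<close>

lemma borel_representative: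
  fixes u :: "real \<times> (real ^ 'n) \<Rightarrow> real"
  assumes "L1_loc (open_strip \<infinity>) u"
  obtains v where "v \<in> borel_measurable borel" "AE z in lborel. 0 < fst z \<longrightarrow> u z = v z"
proof -
  let ?S = "{z :: real \<times> (real ^ 'n). 0 < fst z}"
  define K where "K m = {1 / real (Suc m)..real (Suc m)} \<times> cball (0 :: real ^ 'n) (real m)" for m
  have sub: "K m \<subseteq> open_strip \<infinity>" for m
  proof
    fix z assume "z \<in> K m"
    then have "1 / real (Suc m) \<le> fst z" by (auto simp: K_def)
    moreover have "0 < 1 / real (Suc m)" by simp
    ultimately have "0 < fst z" by linarith
    then show "z \<in> open_strip \<infinity>" by (simp add: open_strip_def)
  qed
  have "compact (K m)" for m unfolding K_def by (intro compact_Times) auto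
  with sub have "set_integrable lebesgue (K m) u" for m
    using assms by (simp add: L1_loc_def)
  then have meas: "(\<lambda>z. indicator (K m) z * u z) \<in> borel_measurable lebesgue" for m
    unfolding set_integrable_def by (simp add: borel_measurable_integrable)
  have "(\<lambda>z. indicator ?S z * u z) \<in> borel_measurable lebesgue"
  proof (rule borel_measurable_LIMSEQ_real[OF _ meas])
    fix z :: "real \<times> (real ^ 'n)"
    show "(\<lambda>m. indicator (K m) z * u z) \<longlonglongrightarrow> indicator ?S z * u z"
    proof (cases "0 < fst z")
      case True
      obtain m1 :: nat where m1: "1 / fst z < real m1" using reals_Archimedean2 by blast
      obtain m2 :: nat where m2: "fst z < real m2" using reals_Archimedean2 by blast
      obtain m3 :: nat where m3: "norm (snd z) < real m3" using reals_Archimedean2 by blast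
      have "z \<in> K m" if "m1 + m2 + m3 \<le> m" for m
      proof -
        have "real m1 \<le> real m" "real m2 \<le> real m" "real m3 \<le> real m" using that by auto
        then have "1 / fst z < real (Suc m)" "fst z \<le> real (Suc m)" "norm (snd z) \<le> real m"
          using m1 m2 m3 by auto
        moreover from this(1) have "1 / real (Suc m) \<le> fst z" using True by (simp add: field_simps)
        ultimately show ?thesis by (cases z) (simp add: K_def)
      qed
      then have "\<forall>\<^sub>F m in sequentially. indicator (K m) z * u z = indicator ?S z * u z"
        unfolding eventually_sequentially using True by (intro exI[of _ "m1 + m2 + m3"]) auto
      then show ?thesis by (rule tendsto_eventually)
    next
      case False
      have "z \<notin> K m" for m using sub[of m] False by (auto simp: open_strip_def)
      then show ?thesis using False by simp
    qed
  qed
  from completion_ex_borel_measurable_real[OF this]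
  obtain v where v: "v \<in> borel_measurable lborel" "AE z in lborel. indicator ?S z * u z = v z" by blast
  from v(2) have "AE z in lborel. 0 < fst z \<longrightarrow> u z = v z" by eventually_elim auto
  with v(1) show thesis by (intro that) auto
qed

lemma AE_lborel_fst:
  assumes "AE t in lborel. P t"
  shows "AE z in (lborel :: ('a::euclidean_space \<times> 'b::euclidean_space) measure). P (fst z)"
proof -
  obtain N where N: "{t \<in> space lborel. \<not> P t} \<subseteq> N" "emeasure lborel N = 0" "N \<in> sets lborel"
    using assms by (rule AE_E)
  show ?thesis
  proof (rule AE_I)
    show "{z \<in> space lborel. \<not> P (fst z)} \<subseteq> N \<times> (UNIV :: 'b set)" using N(1) by auto
    have "emeasure ((lborel :: 'a measure) \<Otimes>\<^sub>M (lborel :: 'b measure)) (N \<times> UNIV) = 0"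
      using N by (subst lborel.emeasure_pair_measure_Times) auto
    then show "emeasure lborel (N \<times> (UNIV :: 'b set)) = 0" by (simp only: lborel_prod)
    have "N \<times> (UNIV :: 'b set) \<in> sets (lborel \<Otimes>\<^sub>M lborel)" using N(3) by (intro pair_measureI) auto
    then show "N \<times> (UNIV :: 'b set) \<in> sets lborel" by (simp only: lborel_prod)
  qed
qed

text \<open>A null set of space-time has null slices for almost every time. At such a time the
  potentials, being integrals over the whole slice, agree at every point of space.\<close>

lemma riesz_source_cong_AE:
  fixes u v :: "real \<times> (real ^ 'n) \<Rightarrow> real"
  assumes "AE z in lborel. 0 < fst z \<longrightarrow> u z = v z"
  shows "AE z in lborel. 0 < fst z \<longrightarrow> riesz_source \<alpha> p u z = riesz_source \<alpha> p v z"
proof -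
  have "AE z in (lborel :: real measure) \<Otimes>\<^sub>M (lborel :: (real ^ 'n) measure). 0 < fst z \<longrightarrow> u z = v z"
    using assms by (simp only: lborel_prod)
  then have "AE t in lborel. AE y in (lborel :: (real ^ 'n) measure). 0 < t \<longrightarrow> u (t, y) = v (t, y)"
    by (auto dest: lborel_pair.AE_pair)
  then have "AE t in lborel. 0 < t \<longrightarrow> (\<forall>x. riesz_source \<alpha> p u (t, x) = riesz_source \<alpha> p v (t, x))"
  proof eventually_elim
    case (elim t)
    show ?case
    proof (intro impI allI)
      fix x assume "0 < t"
      with elim have "AE y in lborel. u (t, y) = v (t, y)" by simp
      then show "riesz_source \<alpha> p u (t, x) = riesz_source \<alpha> p v (t, x)"
        unfolding riesz_source_def riesz_potential_def nn_integral_completion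
        by (intro arg_cong2[where f="(*)"] refl nn_integral_cong_AE) (auto elim!: eventually_mono)
    qed
  qed
  from AE_lborel_fst[OF this] show ?thesis by eventually_elim (metis prod.collapse)
qed

lemma nn_integral_lborel_fst:
  assumes "f \<in> borel_measurable (borel :: ('a::euclidean_space \<times> 'b::euclidean_space) measure)"
  shows "(\<integral>\<^sup>+z. f z \<partial>lborel) = (\<integral>\<^sup>+x. \<integral>\<^sup>+y. f (x, y) \<partial>lborel \<partial>lborel)"
proof -
  have "f \<in> borel_measurable ((lborel :: 'a measure) \<Otimes>\<^sub>M (lborel :: 'b measure))"
    using assms by (simp add: lborel_prod)
  from lborel.nn_integral_fst[OF this] show ?thesis by (simp add: lborel_prod)
qed

text \<open>Comparing \<open>b\<close> with \<theta> * a^(p-1) shows that one of the two terms on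
  the right already dominates. The dependence on \<theta> matters, the best constant does
  not.\<close>

lemma weighted_Young:
  fixes a b p \<theta> :: real
  assumes "0 \<le> a" "0 \<le> b" "1 < p" "0 < \<theta>"
  shows "a * b \<le> \<theta> * a powr p + \<theta> powr (- 1 / (p - 1)) * b powr (p / (p - 1))"
proof (cases "a = 0 \<or> b = 0")
  case True
  then show ?thesis using assms by auto
next
  case False
  then have ab: "0 < a" "0 < b" using assms by auto
  show ?thesis
  proof (cases "b \<le> \<theta> * a powr (p - 1)")
    case True
    then have "a * b \<le> a * (\<theta> * a powr (p - 1))" using ab by (intro mult_left_mono) auto
    also have "\<dots> = \<theta> * a powr p" using ab by (simp add: powr_diff)
    also have "\<dots> \<le> \<theta> * a powr p + \<theta> powr (- 1 / (p - 1)) * b powr (p / (p - 1))" by simp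
    finally show ?thesis .
  next
    case False
    then have "a powr (p - 1) \<le> b / \<theta>" using assms by (simp add: field_simps)
    then have "(a powr (p - 1)) powr (1 / (p - 1)) \<le> (b / \<theta>) powr (1 / (p - 1))"
      using assms by (intro powr_mono2) auto
    then have "a \<le> b powr (1 / (p - 1)) * \<theta> powr (- 1 / (p - 1))"
      using ab assms by (simp add: powr_powr powr_divide powr_minus field_simps)
    then have "a * b \<le> b powr (1 / (p - 1)) * \<theta> powr (- 1 / (p - 1)) * b"
      using ab by (intro mult_right_mono) auto
    also have "\<dots> = \<theta> powr (- 1 / (p - 1)) * (b powr (1 / (p - 1)) * b powr 1)" using ab by simp
    also have "b powr (1 / (p - 1)) * b powr 1 = b powr (p / (p - 1))"
      using assms by (subst powr_add[symmetric]) (simp add: field_simps)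
    also have "\<theta> powr (- 1 / (p - 1)) * b powr (p / (p - 1))
      \<le> \<theta> * a powr p + \<theta> powr (- 1 / (p - 1)) * b powr (p / (p - 1))" using assms by simp
    finally show ?thesis .
  qed
qed

section \<open>Lower bound for the tested source\<close>

lemma bump_ge:
  assumes "norm z \<le> 1 / 2"
  shows "27 / 64 \<le> bump z"
proof -
  have "(norm z)\<^sup>2 \<le> (1 / 2)\<^sup>2" using assms by (intro power_mono) auto
  then have "3 / 4 \<le> cutoff z" by (simp add: cutoff_def power2_eq_square)
  then have "(3 / 4) ^ 3 \<le> cutoff z ^ 3" by (intro power_mono) auto
  then show ?thesis by (simp add: bump_def power3_eq_cube)
qed

text \<open>The integrand of the quantity X_R. The spatial weight is what remains of the Riesz
  kernel after minimizing over |x| \<le> R, up to a power of R. The indicator stops at the time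
  horizon, so the power has a positive base.\<close>

definition source_density ::
  "real \<Rightarrow> real \<Rightarrow> real \<Rightarrow> nat \<Rightarrow> (real \<times> (real ^ 'n) \<Rightarrow> real) \<Rightarrow> real \<Rightarrow> real \<times> (real ^ 'n) \<Rightarrow> real" where
  "source_density \<alpha> \<beta> p k v R z = indicator {0<..<R powr \<beta>} (fst z) * (1 - fst z / R powr \<beta>) ^ k *
     (\<bar>v z\<bar> powr p * (1 + norm (snd z) / R) powr (- (real CARD('n) - \<alpha>)))"

lemma source_density_nonneg: "0 < R \<Longrightarrow> 0 \<le> source_density \<alpha> \<beta> p k v R z"
  by (auto simp: source_density_def indicator_def)

lemma borel_measurable_source_density:
  assumes "v \<in> borel_measurable borel"
  shows "source_density \<alpha> \<beta> p k v R \<in> borel_measurable borel"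
  using assms unfolding source_density_def[abs_def] borel_prod[symmetric] by measurable

lemma riesz_const_pos: "0 < \<alpha> \<Longrightarrow> \<alpha> < real n \<Longrightarrow> 0 < riesz_const n \<alpha>"
  unfolding riesz_const_def by (intro divide_pos_pos mult_pos_pos Gamma_real_pos) auto

text \<open>Since |x - y| \<le> R + |y| = R * (1 + |y| / R), the kernel has a lower bound in which
  \<open>x\<close> no longer appears.\<close>

lemma riesz_potential_lower_bound:
  fixes x :: "real ^ 'n"
  assumes a: "0 < \<alpha>" "\<alpha> < real CARD('n)" and R: "0 < R" and x: "norm x \<le> R"
    and f: "\<And>y. 0 \<le> f y" and [measurable]: "f \<in> borel_measurable borel"
  shows "ennreal (riesz_const CARD('n) \<alpha> * R powr (- (real CARD('n) - \<alpha>))) *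
      (\<integral>\<^sup>+y. ennreal (f y * (1 + norm y / R) powr (- (real CARD('n) - \<alpha>))) \<partial>lborel)
    \<le> riesz_potential \<alpha> f x"
proof -
  define s where "s = real CARD('n) - \<alpha>"
  have s: "0 < s" using a by (simp add: s_def)
  have "ennreal (R powr (- s)) * (\<integral>\<^sup>+y. ennreal (f y * (1 + norm y / R) powr (- s)) \<partial>lborel)
     = (\<integral>\<^sup>+y. ennreal (R powr (- s)) * ennreal (f y * (1 + norm y / R) powr (- s)) \<partial>lborel)"
    by (rule nn_integral_cmult[symmetric]) measurable
  also have "\<dots> \<le> (\<integral>\<^sup>+y. ennreal (f y / norm (x - y) powr s) \<partial>lborel)"
  proof (rule nn_integral_mono_AE)
    \<comment> \<open>At \<open>y = x\<close> the quotient on the right is 0 by the convention for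
      division, so this point has to be excluded.\<close>
    have "AE y in lborel. y \<noteq> x" by (rule AE_lborel_singleton)
    then show "AE y in lborel. ennreal (R powr (- s)) * ennreal (f y * (1 + norm y / R) powr (- s))
        \<le> ennreal (f y / norm (x - y) powr s)"
    proof eventually_elim
      case (elim y)
      have pos: "0 < 1 + norm y / R" using R by (simp add: add_pos_nonneg)
      have "norm (x - y) \<le> R * (1 + norm y / R)"
        using norm_triangle_ineq4[of x y] x R by (simp add: algebra_simps)
      then have "(R * (1 + norm y / R)) powr (- s) \<le> norm (x - y) powr (- s)"
        using elim s by (intro powr_mono2') auto
      then have "R powr (- s) * (1 + norm y / R) powr (- s) \<le> norm (x - y) powr (- s)"
        using R pos by (simp add: powr_mult)
      then have "f y * (R powr (- s) * (1 + norm y / R) powr (- s)) \<le> f y * norm (x - y) powr (- s)"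
        by (intro mult_left_mono f)
      then show ?case
        using f[of y] by (simp add: ennreal_mult[symmetric] powr_minus_divide mult_ac ennreal_leI)
    qed
  qed
  finally have "ennreal (riesz_const CARD('n) \<alpha>) *
      (ennreal (R powr (- s)) * (\<integral>\<^sup>+y. ennreal (f y * (1 + norm y / R) powr (- s)) \<partial>lborel))
    \<le> ennreal (riesz_const CARD('n) \<alpha>) * (\<integral>\<^sup>+y. ennreal (f y / norm (x - y) powr s) \<partial>lborel)"
    by (intro mult_left_mono) auto
  then show ?thesis
    using riesz_const_pos[OF a]
    by (simp add: riesz_potential_def nn_integral_completion s_def ennreal_mult mult.assoc)
qed

lemma nn_integral_scaled_bump_ge:
  assumes "0 < R"
  shows "ennreal (27 / 64 * (unit_ball_vol (real CARD('n)) * (R / 2) ^ CARD('n)))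
    \<le> (\<integral>\<^sup>+x. ennreal (bump ((x :: real ^ 'n) /\<^sub>R R)) \<partial>lborel)"
proof -
  have "(\<integral>\<^sup>+x. ennreal (27 / 64) * indicator (cball 0 (R / 2)) x \<partial>(lborel :: (real ^ 'n) measure))
    \<le> (\<integral>\<^sup>+x. ennreal (bump ((x :: real ^ 'n) /\<^sub>R R)) \<partial>lborel)"
  proof (rule nn_integral_mono)
    fix x :: "real ^ 'n"
    show "ennreal (27 / 64) * indicator (cball 0 (R / 2)) x \<le> ennreal (bump (x /\<^sub>R R))"
      using bump_ge[of "x /\<^sub>R R"] assms by (auto simp: indicator_def field_simps intro!: ennreal_leI)
  qed
  also have "(\<integral>\<^sup>+x. ennreal (27 / 64) * indicator (cball 0 (R / 2)) x \<partial>(lborel :: (real ^ 'n) measure)) =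
      ennreal (27 / 64 * (unit_ball_vol (real DIM(real ^ 'n)) * (R / 2) ^ DIM(real ^ 'n)))"
    by (rule nn_integral_cball_power) (use assms in auto)
  finally show ?thesis by simp
qed

text \<open>The lower bound for the potential is constant in \<open>x\<close> on the support of the
  bump, so the integral of the bump factors out. It contributes R^n and the kernel R^(\<alpha>-n),
  in total R^\<alpha>. Everything stays in \<open>ennreal\<close> because finiteness is not yet
  known.\<close>

lemma nn_integral_source_lower_bound:
  fixes v :: "real \<times> (real ^ 'n) \<Rightarrow> real"
  assumes a: "0 < \<alpha>" "\<alpha> < real CARD('n)" and R: "0 < R"
    and v: "v \<in> borel_measurable borel"
  shows "ennreal (riesz_const CARD('n) \<alpha> * R powr (- (real CARD('n) - \<alpha>))) *
      ennreal (27 / 64 * (unit_ball_vol (real CARD('n)) * (R / 2) ^ CARD('n))) *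
      (\<integral>\<^sup>+z. ennreal (source_density \<alpha> \<beta> p k v R z) \<partial>lborel)
    \<le> (\<integral>\<^sup>+z. indicator ({0<..<R powr \<beta>} \<times> UNIV) z * (riesz_source \<alpha> p v z * ennreal (test_fun k (R powr \<beta>) R z)) \<partial>lborel)"
    (is "?A * ?B * _ \<le> _")
proof -
  define S where "S = R powr \<beta>"
  define w where "w y = (1 + norm y / R) powr (- (real CARD('n) - \<alpha>))" for y :: "real ^ 'n"
  define J where "J t = (\<integral>\<^sup>+y. ennreal (\<bar>v (t, y)\<bar> powr p * w y) \<partial>lborel)" for t
  define h where "h t = ennreal (indicator {0<..<S} t * (1 - t / S) ^ k)" for t
  have S: "0 < S" using R by (simp add: S_def)
  have [measurable]: "v \<in> borel_measurable (borel \<Otimes>\<^sub>M borel)" using v by (simp add: borel_prod)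
  have [measurable]: "w \<in> borel_measurable borel" unfolding w_def by measurable
  have vt [measurable]: "(\<lambda>y. v (t, y)) \<in> borel_measurable borel" for t by measurable
  have vp: "(\<lambda>z. ennreal (\<bar>v (fst z, snd z)\<bar> powr p * w (snd z))) \<in>
      borel_measurable ((borel :: real measure) \<Otimes>\<^sub>M (lborel :: (real ^ 'n) measure))"
    by measurable
  have J [measurable]: "J \<in> borel_measurable borel"
    unfolding J_def using vp
    by (intro lborel.borel_measurable_nn_integral[of "\<lambda>t y. ennreal (\<bar>v (t, y)\<bar> powr p * w y)"])
      (simp add: case_prod_unfold)
  have h [measurable]: "h \<in> borel_measurable borel" unfolding h_def by measurable
  have bm [measurable]: "(\<lambda>x :: real ^ 'n. bump (x /\<^sub>R R)) \<in> borel_measurable borel"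
    by (intro borel_measurable_continuous_onI continuous_intros)
  have "(\<integral>\<^sup>+z. ennreal (source_density \<alpha> \<beta> p k v R z) \<partial>lborel)
      = (\<integral>\<^sup>+t. \<integral>\<^sup>+y. ennreal (source_density \<alpha> \<beta> p k v R (t, y)) \<partial>lborel \<partial>lborel)"
    using borel_measurable_source_density[OF v] by (intro nn_integral_lborel_fst) measurable
  also have "\<dots> = (\<integral>\<^sup>+t. h t * J t \<partial>lborel)"
  proof (rule nn_integral_cong)
    fix t :: real
    have "ennreal (source_density \<alpha> \<beta> p k v R (t, y)) = h t * ennreal (\<bar>v (t, y)\<bar> powr p * w y)" for y
      unfolding source_density_def h_def w_def S_def[symmetric] using S
      by (subst ennreal_mult[symmetric]) (auto simp: indicator_def)
    then show "(\<integral>\<^sup>+y. ennreal (source_density \<alpha> \<beta> p k v R (t, y)) \<partial>lborel) = h t * J t"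
      by (simp add: J_def nn_integral_cmult)
  qed
  finally have eq: "(\<integral>\<^sup>+z. ennreal (source_density \<alpha> \<beta> p k v R z) \<partial>lborel) = (\<integral>\<^sup>+t. h t * J t \<partial>lborel)" .
  have "?A * ?B * (\<integral>\<^sup>+t. h t * J t \<partial>lborel) = (\<integral>\<^sup>+t. ?A * ?B * (h t * J t) \<partial>lborel)"
    by (rule nn_integral_cmult[symmetric]) measurable
  also have "\<dots> \<le> (\<integral>\<^sup>+t. (?A * (h t * J t)) * (\<integral>\<^sup>+x. ennreal (bump ((x :: real ^ 'n) /\<^sub>R R)) \<partial>lborel) \<partial>lborel)"
  proof (rule nn_integral_mono)
    fix t
    have "?A * (h t * J t) * ?B \<le> (?A * (h t * J t)) * (\<integral>\<^sup>+x. ennreal (bump ((x :: real ^ 'n) /\<^sub>R R)) \<partial>lborel)"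
      by (intro mult_left_mono nn_integral_scaled_bump_ge R) auto
    then show "?A * ?B * (h t * J t) \<le> (?A * (h t * J t)) * (\<integral>\<^sup>+x. ennreal (bump ((x :: real ^ 'n) /\<^sub>R R)) \<partial>lborel)"
      by (simp only: mult_ac)
  qed
  also have "\<dots> = (\<integral>\<^sup>+t. \<integral>\<^sup>+x. ?A * (h t * J t) * ennreal (bump ((x :: real ^ 'n) /\<^sub>R R)) \<partial>lborel \<partial>lborel)"
    by (intro nn_integral_cong nn_integral_cmult[symmetric]) measurable
  also have "\<dots> = (\<integral>\<^sup>+z. ?A * (h (fst z) * J (fst z)) * ennreal (bump ((snd z :: real ^ 'n) /\<^sub>R R)) \<partial>lborel)"
  proof (subst nn_integral_lborel_fst)
    define b where "b x = bump (x /\<^sub>R R)" for x :: "real ^ 'n"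
    have [measurable]: "b \<in> borel_measurable borel" using bm unfolding b_def .
    show "(\<lambda>z. ?A * (h (fst z) * J (fst z)) * ennreal (bump ((snd z :: real ^ 'n) /\<^sub>R R))) \<in> borel_measurable borel"
      unfolding borel_prod[symmetric] b_def[symmetric] by measurable
  qed (simp only: fst_conv snd_conv)
  also have "\<dots> \<le> (\<integral>\<^sup>+z. indicator ({0<..<S} \<times> UNIV) z * (riesz_source \<alpha> p v z * ennreal (test_fun k S R z)) \<partial>lborel)"
  proof (rule nn_integral_mono)
    fix z :: "real \<times> (real ^ 'n)"
    obtain t x where z: "z = (t, x)" by (cases z)
    show "?A * (h (fst z) * J (fst z)) * ennreal (bump (snd z /\<^sub>R R)) \<le>
      indicator ({0<..<S} \<times> UNIV) z * (riesz_source \<alpha> p v z * ennreal (test_fun k S R z))"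
    proof (cases "t \<in> {0<..<S} \<and> norm x \<le> R")
      case False
      then have "h t = 0 \<or> bump (x /\<^sub>R R) = 0"
        using bump_eq_0[of "x /\<^sub>R R"] R by (auto simp: h_def indicator_def field_simps)
      then show ?thesis by (auto simp: z)
    next
      case True
      then have t: "0 < t" "t < S" and x: "norm x \<le> R" by auto
      have "?A * J t \<le> riesz_source \<alpha> p v z"
        unfolding riesz_source_def z fst_conv snd_conv J_def w_def
        by (rule riesz_potential_lower_bound[OF a R x]) auto
      then have "?A * J t * ennreal (test_fun k S R z) \<le> riesz_source \<alpha> p v z * ennreal (test_fun k S R z)"
        by (intro mult_right_mono) auto
      moreover have "ennreal (test_fun k S R z) = h t * ennreal (bump (x /\<^sub>R R))"
        unfolding test_fun_def h_def z fst_conv snd_conv using t S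
        by (subst ennreal_mult[symmetric]) (auto simp: max_def)
      ultimately show ?thesis using True by (simp add: z mult_ac)
    qed
  qed
  finally show ?thesis unfolding eq S_def .
qed

section \<open>Young's inequality for the error terms\<close>

text \<open>A common majorant, up to constants and powers of R, for the two terms with derivatives
  of the test function. Its time power is one lower than that of the test function, because of the
  time derivative; its spatial decay is that of the fractional Laplacian.\<close>

definition error_density ::
  "real \<Rightarrow> nat \<Rightarrow> (real \<times> (real ^ 'n) \<Rightarrow> real) \<Rightarrow> real \<Rightarrow> real \<times> (real ^ 'n) \<Rightarrow> real" where
  "error_density \<beta> k v R z = indicator {0<..<R powr \<beta>} (fst z) * (1 - fst z / R powr \<beta>) ^ k *
     (\<bar>v z\<bar> * (1 + norm (snd z) / R) powr (- (real CARD('n) + \<beta>)))"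

definition decay_density :: "real \<Rightarrow> real \<Rightarrow> real \<Rightarrow> real \<times> (real ^ 'n) \<Rightarrow> real" where
  "decay_density \<beta> q R z = indicator {0<..<R powr \<beta>} (fst z) * (1 + norm (snd z) / R) powr (- q)"

lemma error_density_nonneg: "0 < R \<Longrightarrow> 0 \<le> error_density \<beta> k v R z"
  by (auto simp: error_density_def indicator_def)

lemma decay_density_nonneg: "0 \<le> decay_density \<beta> q R z"
  by (auto simp: decay_density_def)

lemma borel_measurable_error_density:
  assumes "v \<in> borel_measurable borel"
  shows "error_density \<beta> k v R \<in> borel_measurable borel"
  using assms unfolding error_density_def[abs_def] borel_prod[symmetric] by measurable

lemma decay_density_integral:
  assumes R: "0 < R" and q: "real CARD('n) < q"
  shows "integrable lborel (decay_density \<beta> q R :: real \<times> (real ^ 'n) \<Rightarrow> real)"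
    and "(LINT z|lborel. decay_density \<beta> q R (z :: real \<times> (real ^ 'n))) =
      R powr \<beta> * (R ^ CARD('n) * (LINT y|lborel. (1 + norm (y :: real ^ 'n)) powr (- q)))"
proof -
  let ?D = "LINT y|lborel. (1 + norm (y :: real ^ 'n)) powr (- q)"
  have D: "0 \<le> ?D" by (intro Bochner_Integration.integral_nonneg) auto
  have m: "(decay_density \<beta> q R :: real \<times> (real ^ 'n) \<Rightarrow> real) \<in> borel_measurable borel"
    unfolding decay_density_def[abs_def] borel_prod[symmetric] by measurable
  have "(\<integral>\<^sup>+y. ennreal ((1 + norm y / R) powr (- q)) \<partial>(lborel :: (real ^ 'n) measure))
      = ennreal (\<bar>R\<bar> ^ DIM(real ^ 'n)) * (\<integral>\<^sup>+y. ennreal ((1 + norm (0 + R *\<^sub>R y) / R) powr (- q)) \<partial>(lborel :: (real ^ 'n) measure))"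
    by (rule nn_integral_lborel_affine) (use R in auto)
  also have "(\<integral>\<^sup>+y. ennreal ((1 + norm (0 + R *\<^sub>R y) / R) powr (- q)) \<partial>(lborel :: (real ^ 'n) measure)) =
      (\<integral>\<^sup>+y. ennreal ((1 + norm y) powr (- q)) \<partial>(lborel :: (real ^ 'n) measure))"
    using R by simp
  also have "\<dots> = ennreal ?D"
    using q by (intro nn_integral_eq_integral integrable_decay) auto
  also have "ennreal (\<bar>R\<bar> ^ DIM(real ^ 'n)) * ennreal ?D = ennreal (R ^ CARD('n) * ?D)"
    using R D by (simp add: ennreal_mult)
  finally have inner: "(\<integral>\<^sup>+y. ennreal ((1 + norm y / R) powr (- q)) \<partial>(lborel :: (real ^ 'n) measure))
      = ennreal (R ^ CARD('n) * ?D)" .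
  have "(\<integral>\<^sup>+z. ennreal (decay_density \<beta> q R (z :: real \<times> (real ^ 'n))) \<partial>lborel) =
      (\<integral>\<^sup>+t. \<integral>\<^sup>+y. ennreal (decay_density \<beta> q R (t, y :: real ^ 'n)) \<partial>lborel \<partial>lborel)"
    using m by (intro nn_integral_lborel_fst) measurable
  also have "\<dots> = (\<integral>\<^sup>+t. ennreal (R ^ CARD('n) * ?D) * indicator {0<..<R powr \<beta>} t \<partial>lborel)"
  proof (rule nn_integral_cong)
    fix t :: real
    show "(\<integral>\<^sup>+y. ennreal (decay_density \<beta> q R (t, y :: real ^ 'n)) \<partial>lborel) =
        ennreal (R ^ CARD('n) * ?D) * indicator {0<..<R powr \<beta>} t"
      by (cases "t \<in> {0<..<R powr \<beta>}") (simp_all add: decay_density_def inner)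
  qed
  also have "\<dots> = ennreal (R powr \<beta> * (R ^ CARD('n) * ?D))"
    using R D by (subst nn_integral_cmult_indicator) (auto simp: ennreal_mult[symmetric] mult.commute)
  finally have "(\<integral>\<^sup>+z. ennreal (decay_density \<beta> q R (z :: real \<times> (real ^ 'n))) \<partial>lborel) =
      ennreal (R powr \<beta> * (R ^ CARD('n) * ?D))" .
  then have "integrable lborel (decay_density \<beta> q R :: real \<times> (real ^ 'n) \<Rightarrow> real) \<and>
      (LINT z|lborel. decay_density \<beta> q R (z :: real \<times> (real ^ 'n))) = R powr \<beta> * (R ^ CARD('n) * ?D)"
    using R D m by (subst (asm) nn_integral_eq_integrable) (auto simp: decay_density_nonneg)
  then show "integrable lborel (decay_density \<beta> q R :: real \<times> (real ^ 'n) \<Rightarrow> real)"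
    and "(LINT z|lborel. decay_density \<beta> q R (z :: real \<times> (real ^ 'n))) = R powr \<beta> * (R ^ CARD('n) * ?D)"
    by auto
qed

text \<open>The right-hand side is the decay left over by Young's inequality; it exceeds n by
  (\<beta> p + \<alpha>) / (p - 1), which makes the remainder integrable over space.\<close>

lemma Young_exponent_gt:
  fixes \<alpha> \<beta> p n :: real
  assumes "0 < \<alpha>" "0 < \<beta>" "1 < p"
  shows "n < ((n + \<beta>) * p - (n - \<alpha>)) / (p - 1)"
proof -
  have "0 < \<beta> * p" using assms by simp
  moreover have "(n + \<beta>) * p - (n - \<alpha>) = n * (p - 1) + (\<beta> * p + \<alpha>)" by (simp add: algebra_simps)
  ultimately have "n * (p - 1) < (n + \<beta>) * p - (n - \<alpha>)" using assms by linarith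
  then show ?thesis using assms by (simp add: field_simps)
qed

lemma error_density_Young:
  fixes v :: "real \<times> (real ^ 'n) \<Rightarrow> real" and \<alpha> \<beta> :: real
  assumes R: "0 < R" and p: "1 < p" and \<theta>: "0 < \<theta>" and k: "p / (p - 1) \<le> real (Suc k)"
  defines "q \<equiv> ((real CARD('n) + \<beta>) * p - (real CARD('n) - \<alpha>)) / (p - 1)"
  shows "R powr (- (\<alpha> + \<beta>)) * error_density \<beta> k v R z \<le>
    \<theta> * source_density \<alpha> \<beta> p (Suc k) v R z +
    \<theta> powr (- 1 / (p - 1)) * (R powr (- (\<alpha> + \<beta>) * p / (p - 1)) * decay_density \<beta> q R z)"
proof (cases "fst z \<in> {0<..<R powr \<beta>}")
  case False
  then show ?thesis by (simp add: error_density_def source_density_def decay_density_def)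
next
  case True
  define n where "n = real CARD('n)"
  define s where "s = 1 - fst z / R powr \<beta>"
  define W where "W = 1 + norm (snd z) / R"
  define K where "K = real (Suc k)"
  have s: "0 < s" "s \<le> 1" using True R by (auto simp: s_def)
  have W: "1 \<le> W" "0 < W" using R by (auto simp: W_def add_pos_nonneg)
  have sk: "s ^ k = s powr (K - 1)" "s ^ Suc k = s powr K"
    using s powr_realpow[of s k] powr_realpow[of s "Suc k"]
    by (simp add: K_def, simp only: K_def)
  \<comment> \<open>The factor \<open>a\<close> is the p-th root of the source density, and
    \<open>b\<close> is whatever is then missing from the left-hand side.\<close>
  define a where "a = \<bar>v z\<bar> * s powr (K / p) * W powr (- ((n - \<alpha>) / p))"
  define b where "b = R powr (- (\<alpha> + \<beta>)) * s powr (K - 1 - K / p) * W powr ((n - \<alpha>) / p - (n + \<beta>))"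
  have "a * b = R powr (- (\<alpha> + \<beta>)) * (\<bar>v z\<bar> * (s powr (K / p) * s powr (K - 1 - K / p)) *
      (W powr (- ((n - \<alpha>) / p)) * W powr ((n - \<alpha>) / p - (n + \<beta>))))"
    by (simp add: a_def b_def mult_ac)
  also have "\<dots> = R powr (- (\<alpha> + \<beta>)) * error_density \<beta> k v R z"
  proof -
    have "W powr (- ((n - \<alpha>) / p)) * W powr ((n - \<alpha>) / p - (n + \<beta>)) = W powr (- (n + \<beta>))"
      by (subst powr_add[symmetric], rule arg_cong[where f="(powr) W"]) simp
    moreover have "s powr (K / p) * s powr (K - 1 - K / p) = s ^ k"
      unfolding sk(1) by (subst powr_add[symmetric]) simp
    ultimately show ?thesis
      using True by (simp only: error_density_def s_def[symmetric] W_def[symmetric] n_def[symmetric])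
        (simp add: mult_ac)
  qed
  finally have ab: "a * b = R powr (- (\<alpha> + \<beta>)) * error_density \<beta> k v R z" .
  have "a powr p = \<bar>v z\<bar> powr p * s powr K * W powr (- (n - \<alpha>))"
    using s W p by (simp add: a_def powr_mult powr_powr)
  also have "\<dots> = source_density \<alpha> \<beta> p (Suc k) v R z"
    using True by (simp add: source_density_def s_def[symmetric] W_def[symmetric] sk(2)[symmetric] n_def[symmetric])
  finally have ap: "a powr p = source_density \<alpha> \<beta> p (Suc k) v R z" .
  have e1: "((n - \<alpha>) / p - (n + \<beta>)) * p / (p - 1) = - q"
    using p by (simp add: q_def n_def[symmetric] divide_simps)
  \<comment> \<open>The power of \<open>s\<close> left over is nonnegative because \<open>K \<ge> p / (p - 1)\<close>, hence that factor is at most \<open>1\<close>.\<close>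
  have e2: "(K - 1 - K / p) * p / (p - 1) = K - p / (p - 1)"
    using p by (simp add: divide_simps) (simp add: algebra_simps)
  have "b powr (p / (p - 1)) = R powr (- (\<alpha> + \<beta>) * p / (p - 1)) * s powr (K - p / (p - 1)) * W powr (- q)"
    using s W R unfolding b_def by (simp add: powr_mult powr_powr e1 e2)
  also have "\<dots> \<le> R powr (- (\<alpha> + \<beta>) * p / (p - 1)) * 1 * W powr (- q)"
    using s k by (intro mult_right_mono mult_left_mono powr_le1) (auto simp: K_def)
  also have "\<dots> = R powr (- (\<alpha> + \<beta>) * p / (p - 1)) * decay_density \<beta> q R z"
    using True by (simp add: decay_density_def W_def)
  finally have bp: "b powr (p / (p - 1)) \<le> R powr (- (\<alpha> + \<beta>) * p / (p - 1)) * decay_density \<beta> q R z" .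
  have "a * b \<le> \<theta> * a powr p + \<theta> powr (- 1 / (p - 1)) * b powr (p / (p - 1))"
    using s W p \<theta> by (intro weighted_Young) (auto simp: a_def b_def)
  also have "\<dots> \<le> \<theta> * a powr p + \<theta> powr (- 1 / (p - 1)) * (R powr (- (\<alpha> + \<beta>) * p / (p - 1)) * decay_density \<beta> q R z)"
    using bp by (intro add_left_mono mult_left_mono) auto
  finally show ?thesis unfolding ab ap .
qed

section \<open>Testing the equation\<close>

lemma bump_le_decay:
  assumes "0 \<le> N"
  shows "bump z \<le> 2 powr N * (1 + norm z) powr (- N)"
proof (cases "norm z \<le> 1")
  case True
  then show ?thesis using indicator_le_decay[of "norm z" N] bump_le_1[of z] assms by simp
next
  case False
  then show ?thesis by (simp add: bump_eq_0)
qed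

text \<open>The final time is \<open>S\<close>, where the time factor vanishes, so the test function
  is admissible.\<close>

lemma weak_solution_test_fun:
  fixes u :: "real \<times> (real ^ 'n) \<Rightarrow> real" and k :: nat
  assumes sol: "global_weak_solution \<alpha> \<beta> p u0 u" and S: "0 < S" and R: "0 < R"
  defines "\<psi> \<equiv> test_fun (Suc (Suc k)) S R"
  defines "Q \<equiv> {0<..<S} \<times> (UNIV :: (real ^ 'n) set)"
  defines "F \<equiv> \<lambda>z. indicator Q z * (enn2real (riesz_source \<alpha> p u z) * \<psi> z)"
    and "G \<equiv> \<lambda>z. indicator Q z * (u z * frac_laplacian \<beta> (slice \<psi> (fst z)) (snd z))"
    and "H \<equiv> \<lambda>z. indicator Q z * (u z * partial_t \<psi> z)"
  shows "integrable lebesgue F" "integrable lebesgue (\<lambda>x. u0 x * bump (x /\<^sub>R R))"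
    "integrable lebesgue G" "integrable lebesgue H"
    "(LINT z|lebesgue. F z) + (LINT x|lebesgue. u0 x * bump (x /\<^sub>R R)) =
      (LINT z|lebesgue. G z) - (LINT z|lebesgue. H z)"
proof -
  have psi0: "\<psi> (0, x) = bump (x /\<^sub>R R)" for x by (simp add: \<psi>_def test_fun_def)
  have "0 \<le> S \<and> ereal S < \<infinity> \<and> C12_tx \<infinity> \<psi> \<and> compactly_supported \<infinity> \<psi> \<and> (\<forall>x. \<psi> (S, x) = 0)"
    unfolding \<psi>_def using S R
    by (simp add: C12_tx_test_fun compactly_supported_test_fun del: power_Suc) (simp add: test_fun_def)
  then have "let F = (\<lambda>z. enn2real (riesz_source \<alpha> p u z) * \<psi> z);
             I0 = (\<lambda>x. u0 x * \<psi> (0, x));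
             G = (\<lambda>z. u z * frac_laplacian \<beta> (slice \<psi> (fst z)) (snd z));
             H = (\<lambda>z. u z * partial_t \<psi> z)
         in set_integrable lebesgue Q F \<and> integrable lebesgue I0 \<and>
            set_integrable lebesgue Q G \<and> set_integrable lebesgue Q H \<and>
            (LINT z:Q|lebesgue. F z) + (LINT x|lebesgue. I0 x) =
            (LINT z:Q|lebesgue. G z) - (LINT z:Q|lebesgue. H z)"
    using sol unfolding global_weak_solution_def weak_solution_def Q_def Let_def by blast
  then show "integrable lebesgue F" "integrable lebesgue (\<lambda>x. u0 x * bump (x /\<^sub>R R))"
    "integrable lebesgue G" "integrable lebesgue H"
    "(LINT z|lebesgue. F z) + (LINT x|lebesgue. u0 x * bump (x /\<^sub>R R)) =
      (LINT z|lebesgue. G z) - (LINT z|lebesgue. H z)"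
    unfolding Let_def set_integrable_def set_lebesgue_integral_def real_scaleR_def psi0 F_def G_def H_def
    by auto
qed

text \<open>The integrand \<open>F\<close> passes through \<open>enn2real\<close>, which would send
  an infinite potential to 0. Almost everywhere finiteness, part of the notion of weak solution,
  makes \<open>F\<close> the true source term. Its finite integral then forces X_R to be finite, as
  \<open>c\<close> is positive.\<close>

lemma source_term_lower_bound:
  fixes u v :: "real \<times> (real ^ 'n) \<Rightarrow> real" and k :: nat
  assumes sol: "global_weak_solution \<alpha> \<beta> p u0 u"
    and v: "v \<in> borel_measurable borel" and ae: "AE z in lborel. 0 < fst z \<longrightarrow> u z = v z"
    and a: "0 < \<alpha>" "\<alpha> < real CARD('n)" and R: "0 < R"
  defines "F \<equiv> \<lambda>z. indicator ({0<..<R powr \<beta>} \<times> UNIV) z *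
    (enn2real (riesz_source \<alpha> p u z) * test_fun k (R powr \<beta>) R z)"
  assumes F: "integrable lebesgue F"
  shows "integrable lborel (source_density \<alpha> \<beta> p k v R)"
    and "riesz_const CARD('n) \<alpha> * (27 / 64 * unit_ball_vol (real CARD('n)) / 2 ^ CARD('n)) * R powr \<alpha> *
      (LINT z|lborel. source_density \<alpha> \<beta> p k v R z) \<le> (LINT z|lebesgue. F z)"
proof -
  let ?X = "\<integral>\<^sup>+z. ennreal (source_density \<alpha> \<beta> p k v R z) \<partial>lborel"
  let ?Q = "{0<..<R powr \<beta>} \<times> (UNIV :: (real ^ 'n) set)"
  define c where "c = riesz_const CARD('n) \<alpha> * (27 / 64 * unit_ball_vol (real CARD('n)) / 2 ^ CARD('n)) * R powr \<alpha>"
  have c: "0 < c"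
    unfolding c_def using riesz_const_pos[OF a] R
    by (intro mult_pos_pos divide_pos_pos unit_ball_vol_pos) auto
  have Fnn: "0 \<le> F z" for z
    by (auto simp: F_def test_fun_def)
  have "AE z in lborel. z \<in> open_strip \<infinity> \<longrightarrow> riesz_source \<alpha> p u z < \<infinity>"
    using sol unfolding global_weak_solution_def weak_solution_def AE_completion_iff by blast
  with riesz_source_cong_AE[OF ae, of \<alpha> p]
  have eq: "AE z in lborel. indicator ?Q z * (riesz_source \<alpha> p v z * ennreal (test_fun k (R powr \<beta>) R z)) = ennreal (F z)"
  proof eventually_elim
    case (elim z)
    show ?case
    proof (cases "z \<in> ?Q")
      case True
      then have "0 < fst z" by auto
      with elim have "riesz_source \<alpha> p u z < \<infinity>" "riesz_source \<alpha> p u z = riesz_source \<alpha> p v z"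
        by (auto simp: open_strip_def)
      moreover have "ennreal (enn2real (riesz_source \<alpha> p u z) * test_fun k (R powr \<beta>) R z)
          = ennreal (enn2real (riesz_source \<alpha> p u z)) * ennreal (test_fun k (R powr \<beta>) R z)"
        by (rule ennreal_mult) (auto simp: test_fun_def)
      ultimately show ?thesis using True by (simp add: F_def)
    qed (simp add: F_def)
  qed
  have AB: "ennreal (riesz_const CARD('n) \<alpha> * R powr (- (real CARD('n) - \<alpha>))) *
      ennreal (27 / 64 * (unit_ball_vol (real CARD('n)) * (R / 2) ^ CARD('n))) = ennreal c"
  proof -
    have "R powr (- (real CARD('n) - \<alpha>)) * R ^ CARD('n) = R powr \<alpha>"
      using R by (simp add: powr_realpow[symmetric] powr_add[symmetric])
    then have eq: "c = riesz_const CARD('n) \<alpha> * R powr (- (real CARD('n) - \<alpha>)) *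
        (27 / 64 * (unit_ball_vol (real CARD('n)) * (R / 2) ^ CARD('n)))"
      unfolding c_def by (simp add: power_divide)
    show ?thesis
      unfolding eq using riesz_const_pos[OF a] R by (intro ennreal_mult[symmetric]) auto
  qed
  have "ennreal c * ?X \<le> (\<integral>\<^sup>+z. indicator ?Q z * (riesz_source \<alpha> p v z * ennreal (test_fun k (R powr \<beta>) R z)) \<partial>lborel)"
    using nn_integral_source_lower_bound[OF a R v, of \<beta> p k] unfolding AB .
  also have "\<dots> = (\<integral>\<^sup>+z. ennreal (F z) \<partial>lborel)" by (rule nn_integral_cong_AE[OF eq])
  also have "\<dots> = (\<integral>\<^sup>+z. ennreal (F z) \<partial>lebesgue)" by (simp add: nn_integral_completion)
  also have "\<dots> = ennreal (LINT z|lebesgue. F z)"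
    using F Fnn by (intro nn_integral_eq_integral) auto
  finally have le: "ennreal c * ?X \<le> ennreal (LINT z|lebesgue. F z)" .
  then have "?X < \<infinity>"
    using c by (cases "?X = \<infinity>") (auto simp: ennreal_mult_top top.not_eq_extremum top_unique)
  then show int: "integrable lborel (source_density \<alpha> \<beta> p k v R)"
    using borel_measurable_source_density[OF v]
    by (intro integrableI_nonneg AE_I2 source_density_nonneg R) auto
  have "?X = ennreal (LINT z|lborel. source_density \<alpha> \<beta> p k v R z)"
    by (intro nn_integral_eq_integral int AE_I2 source_density_nonneg R)
  with le c have "ennreal (c * (LINT z|lborel. source_density \<alpha> \<beta> p k v R z)) \<le> ennreal (LINT z|lebesgue. F z)"
    by (simp add: ennreal_mult source_density_nonneg[OF R] Bochner_Integration.integral_nonneg)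
  moreover have "0 \<le> (LINT z|lebesgue. F z)" using Fnn by (intro Bochner_Integration.integral_nonneg)
  ultimately show "riesz_const CARD('n) \<alpha> * (27 / 64 * unit_ball_vol (real CARD('n)) / 2 ^ CARD('n)) * R powr \<alpha> *
      (LINT z|lborel. source_density \<alpha> \<beta> p k v R z) \<le> (LINT z|lebesgue. F z)"
    by (simp add: ennreal_le_iff c_def)
qed

lemma integrable_error_density:
  fixes v :: "real \<times> (real ^ 'n) \<Rightarrow> real"
  assumes v: "v \<in> borel_measurable borel" and R: "0 < R" and "0 < \<alpha>" "0 < \<beta>" "1 < p"
    and k: "p / (p - 1) \<le> real (Suc k)"
    and int: "integrable lborel (source_density \<alpha> \<beta> p (Suc k) v R)"
  shows "integrable lborel (error_density \<beta> k v R)"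
proof -
  define q where "q = ((real CARD('n) + \<beta>) * p - (real CARD('n) - \<alpha>)) / (p - 1)"
  have q: "real CARD('n) < q" unfolding q_def by (rule Young_exponent_gt) fact+
  let ?g = "\<lambda>z :: real \<times> (real ^ 'n). 1 * source_density \<alpha> \<beta> p (Suc k) v R z +
    1 powr (- 1 / (p - 1)) * (R powr (- (\<alpha> + \<beta>) * p / (p - 1)) * decay_density \<beta> q R z)"
  have "integrable lborel (\<lambda>z. R powr (- (\<alpha> + \<beta>)) * error_density \<beta> k v R z)"
  proof (rule Bochner_Integration.integrable_bound)
    show "integrable lborel ?g"
      by (intro Bochner_Integration.integrable_add integrable_mult_right int decay_density_integral(1) R q)
    show "AE z in lborel. norm (R powr (- (\<alpha> + \<beta>)) * error_density \<beta> k v R z) \<le> norm (?g z)"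
    proof (rule AE_I2)
      fix z :: "real \<times> (real ^ 'n)"
      have "R powr (- (\<alpha> + \<beta>)) * error_density \<beta> k v R z \<le> ?g z"
        unfolding q_def by (rule error_density_Young[OF R \<open>1 < p\<close> _ k]) simp
      moreover have "0 \<le> R powr (- (\<alpha> + \<beta>)) * error_density \<beta> k v R z"
        by (intro mult_nonneg_nonneg error_density_nonneg R) simp
      ultimately show "norm (R powr (- (\<alpha> + \<beta>)) * error_density \<beta> k v R z) \<le> norm (?g z)"
        unfolding real_norm_def by linarith
    qed
  qed (use borel_measurable_error_density[OF v] in measurable)
  then show ?thesis using R by simp
qed

text \<open>Both terms with derivatives are bounded pointwise by R^(-\<beta>) times the error
  density: the fractional Laplacian by scaling, the time derivative because the horizon is
  R^\<beta>. The constants are chosen before \<open>R\<close>.\<close>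

proposition test_function_inequality:
  fixes u v :: "real \<times> (real ^ 'n) \<Rightarrow> real"
  assumes sol: "global_weak_solution \<alpha> \<beta> p u0 u"
    and v: "v \<in> borel_measurable borel" and ae: "AE z in lborel. 0 < fst z \<longrightarrow> u z = v z"
    and a: "0 < \<alpha>" "\<alpha> < real CARD('n)" and \<beta>: "0 < \<beta>" "\<beta> \<le> 2" and p: "1 < p"
    and k: "p / (p - 1) \<le> real (Suc (Suc k))"
  shows "\<exists>c>0. \<exists>C\<ge>0. \<forall>R>0.
    integrable lborel (source_density \<alpha> \<beta> p (Suc (Suc k)) v R) \<and>
    integrable lborel (error_density \<beta> (Suc k) v R) \<and>
    integrable lebesgue (\<lambda>x. u0 x * bump (x /\<^sub>R R)) \<and>
    c * R powr \<alpha> * (LINT z|lborel. source_density \<alpha> \<beta> p (Suc (Suc k)) v R z) +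
      (LINT x|lebesgue. u0 x * bump (x /\<^sub>R R))
    \<le> C * R powr (- \<beta>) * (LINT z|lborel. error_density \<beta> (Suc k) v R z)"
proof -
  define N where "N = real CARD('n) + \<beta>"
  obtain C0 where C0: "0 \<le> C0" and lap: "\<And>R c (x :: real ^ 'n). 0 < R \<Longrightarrow> 0 \<le> c \<Longrightarrow>
      \<bar>frac_laplacian \<beta> (\<lambda>x. c * bump (x /\<^sub>R R)) x\<bar> \<le> C0 * c * R powr (- \<beta>) * (1 + norm x / R) powr (- N)"
    using frac_laplacian_scaled_bump_bound[OF \<beta>, where 'n='n] unfolding N_def by metis
  define c where "c = riesz_const CARD('n) \<alpha> * (27 / 64 * unit_ball_vol (real CARD('n)) / 2 ^ CARD('n))"
  \<comment> \<open>The first summand comes from the fractional Laplacian. The second comes from the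
    time derivative: \<open>k + 2\<close> is the exponent of the time factor, and
    \<open>2 powr N\<close> turns the bump into a power decay.\<close>
  define C where "C = C0 + real (k + 2) * 2 powr N"
  have c: "0 < c"
    unfolding c_def using riesz_const_pos[OF a]
    by (intro mult_pos_pos divide_pos_pos unit_ball_vol_pos) auto
  have C: "0 \<le> C" unfolding C_def using C0 by (intro add_nonneg_nonneg mult_nonneg_nonneg) auto
  show ?thesis
  proof (rule exI[of _ c], intro conjI c, rule exI[of _ C], intro conjI C allI impI)
    fix R :: real assume R: "0 < R"
    define S where "S = R powr \<beta>"
    define \<psi> :: "real \<times> (real ^ 'n) \<Rightarrow> real" where "\<psi> = test_fun (Suc (Suc k)) S R"
    define Q where "Q = {0<..<S} \<times> (UNIV :: (real ^ 'n) set)"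
    have S: "0 < S" "1 / S = R powr (- \<beta>)" using R by (simp_all add: S_def powr_minus_divide)
    let ?F = "\<lambda>z. indicator Q z * (enn2real (riesz_source \<alpha> p u z) * \<psi> z)"
    let ?G = "\<lambda>z. indicator Q z * (u z * frac_laplacian \<beta> (slice \<psi> (fst z)) (snd z))"
    let ?H = "\<lambda>z. indicator Q z * (u z * partial_t \<psi> z)"
    let ?E = "error_density \<beta> (Suc k) v R"
    note ws = weak_solution_test_fun(1,3,4,5)[OF sol S(1) R, of k, folded \<psi>_def Q_def]
    note src = source_term_lower_bound[OF sol v ae a R, of "Suc (Suc k)", folded S_def,
        OF weak_solution_test_fun(1)[OF sol S(1) R], folded \<psi>_def Q_def]
    show int: "integrable lborel (source_density \<alpha> \<beta> p (Suc (Suc k)) v R)" by (rule src(1))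
    show int_err: "integrable lborel ?E"
      by (rule integrable_error_density[OF v R a(1) \<beta>(1) p k int])
    show "integrable lebesgue (\<lambda>x. u0 x * bump (x /\<^sub>R R))" 
      by (rule weak_solution_test_fun(2)[OF sol S(1) R])
    have "(LINT z|lebesgue. ?G z) - (LINT z|lebesgue. ?H z) = (LINT z|lebesgue. ?G z - ?H z)"
      by (rule Bochner_Integration.integral_diff[symmetric]; rule ws)
    also have "\<dots> \<le> (LINT z|lebesgue. C * R powr (- \<beta>) * ?E z)"
    proof (rule integral_mono_AE)
      show "integrable lebesgue (\<lambda>z. ?G z - ?H z)" by (intro Bochner_Integration.integrable_diff ws)
      show "integrable lebesgue (\<lambda>z. C * R powr (- \<beta>) * ?E z)"
        using int_err borel_measurable_error_density[OF v]
        by (intro integrable_mult_right) (simp add: integrable_completion)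
      have "AE z in lebesgue. 0 < fst z \<longrightarrow> u z = v z" using ae by (simp add: AE_completion_iff)
      then show "AE z in lebesgue. ?G z - ?H z \<le> C * R powr (- \<beta>) * ?E z"
      proof eventually_elim
        case (elim z)
        obtain t x where z: "z = (t, x)" by (cases z)
        show ?case
        proof (cases "z \<in> Q")
          case False
          have "0 \<le> C * R powr (- \<beta>) * ?E z"
            by (intro mult_nonneg_nonneg C error_density_nonneg R powr_ge_zero)
          then show ?thesis using False by simp
        next
          case True
          then have t: "0 < t" "t < S" by (auto simp: z Q_def)
          define s where "s = 1 - t / S"
          define D where "D = (1 + norm x / R) powr (- N)"
          have s: "0 < s" "s \<le> 1" using t S by (auto simp: s_def)
          have uv: "u z = v z" using elim t by (simp add: z)
          have E: "?E z = s ^ Suc k * (\<bar>v z\<bar> * D)"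
            using True by (simp add: error_density_def z Q_def S_def[symmetric] s_def D_def N_def)
          have sl: "slice \<psi> t = (\<lambda>x. s ^ Suc (Suc k) * bump (x /\<^sub>R R))"
            using s by (simp add: \<psi>_def test_fun_def s_def[symmetric] max_def)
          have "\<bar>frac_laplacian \<beta> (slice \<psi> t) x\<bar> \<le> C0 * s ^ Suc (Suc k) * R powr (- \<beta>) * D"
            unfolding sl D_def using s by (intro lap R) auto
          \<comment> \<open>One power of \<open>s\<close> is given away to match the time
            derivative, which has lost it.\<close>
          also have "\<dots> \<le> C0 * s ^ Suc k * R powr (- \<beta>) * D"
            using s C0 by (intro mult_right_mono mult_left_mono power_decreasing) (auto simp: D_def)
          finally have lb: "\<bar>frac_laplacian \<beta> (slice \<psi> t) x\<bar> \<le> C0 * R powr (- \<beta>) * s ^ Suc k * D"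
            by (simp only: mult_ac)
          have "norm (x /\<^sub>R R) = norm x / R" using R by (simp add: divide_inverse mult.commute)
          with bump_le_decay[of N "x /\<^sub>R R"] \<beta> have bd: "bump (x /\<^sub>R R) \<le> 2 powr N * D"
            by (simp add: D_def N_def)
          have "partial_t \<psi> z = - (real (k + 2) * R powr (- \<beta>)) * s ^ Suc k * bump (x /\<^sub>R R)"
            using partial_t_test_fun[of t k S R x] t s S(2)[symmetric]
            by (simp add: z \<psi>_def s_def[symmetric] max_def)
          then have "\<bar>partial_t \<psi> z\<bar> = real (k + 2) * R powr (- \<beta>) * s ^ Suc k * bump (x /\<^sub>R R)"
            using s by (simp add: abs_mult)
          also have "\<dots> \<le> real (k + 2) * R powr (- \<beta>) * s ^ Suc k * (2 powr N * D)"
            using s by (intro mult_left_mono bd) auto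
          finally have tb: "\<bar>partial_t \<psi> z\<bar> \<le> real (k + 2) * R powr (- \<beta>) * s ^ Suc k * (2 powr N * D)" .
          have "?G z - ?H z = v z * frac_laplacian \<beta> (slice \<psi> t) x - v z * partial_t \<psi> z"
            using True by (simp add: uv) (simp add: z)
          also have "\<dots> \<le> \<bar>v z\<bar> * \<bar>frac_laplacian \<beta> (slice \<psi> t) x\<bar> + \<bar>v z\<bar> * \<bar>partial_t \<psi> z\<bar>"
            by (simp only: abs_mult[symmetric])
          also have "\<dots> \<le> \<bar>v z\<bar> * (C0 * R powr (- \<beta>) * s ^ Suc k * D) +
              \<bar>v z\<bar> * (real (k + 2) * R powr (- \<beta>) * s ^ Suc k * (2 powr N * D))"
            by (intro add_mono mult_left_mono lb tb) auto
          also have "\<dots> = C * R powr (- \<beta>) * ?E z"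
            unfolding E C_def by (simp add: algebra_simps)
          finally show ?thesis .
        qed
      qed
    qed
    also have "\<dots> = C * R powr (- \<beta>) * (LINT z|lborel. ?E z)"
      using borel_measurable_error_density[OF v] by (simp add: integral_completion)
    finally have "(LINT z|lebesgue. ?G z) - (LINT z|lebesgue. ?H z) \<le> C * R powr (- \<beta>) * (LINT z|lborel. ?E z)" .
    with ws(4) src(2) show "c * R powr \<alpha> * (LINT z|lborel. source_density \<alpha> \<beta> p (Suc (Suc k)) v R z) +
        (LINT x|lebesgue. u0 x * bump (x /\<^sub>R R)) \<le> C * R powr (- \<beta>) * (LINT z|lborel. ?E z)"
      unfolding c_def by linarith
  qed
qed

section \<open>Nonexistence\<close>

text \<open>The first factor comes from the prefactor in Young's inequality, the others are the
  length of the time interval and the volume scale. The sign of the resulting exponent separates the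
  subcritical from the supercritical range.\<close>

lemma decay_scaling_exponent:
  fixes \<alpha> \<beta> p :: real
  assumes "0 < R" "1 < p"
  shows "R powr (- (\<alpha> + \<beta>) * p / (p - 1)) * (R powr \<beta> * R ^ n) =
    R powr (real n - \<alpha> - (\<alpha> + \<beta>) / (p - 1))"
proof -
  have e: "- (\<alpha> + \<beta>) * p / (p - 1) + (\<beta> + real n) = real n - \<alpha> - (\<alpha> + \<beta>) / (p - 1)"
    using assms by (simp add: divide_simps) (simp add: algebra_simps)
  show ?thesis
    unfolding e[symmetric] using assms by (simp only: powr_add powr_realpow)
qed

lemma integral_error_density_le:
  fixes v :: "real \<times> (real ^ 'n) \<Rightarrow> real" and \<alpha> \<beta> :: real
  assumes R: "0 < R" and p: "1 < p" and \<theta>: "0 < \<theta>" and k: "p / (p - 1) \<le> real (Suc k)"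
    and "0 < \<alpha>" "0 < \<beta>"
    and int: "integrable lborel (source_density \<alpha> \<beta> p (Suc k) v R)"
    and int_err: "integrable lborel (error_density \<beta> k v R)"
  defines "q \<equiv> ((real CARD('n) + \<beta>) * p - (real CARD('n) - \<alpha>)) / (p - 1)"
  shows "R powr (- (\<alpha> + \<beta>)) * (LINT z|lborel. error_density \<beta> k v R z) \<le>
    \<theta> * (LINT z|lborel. source_density \<alpha> \<beta> p (Suc k) v R z) +
    \<theta> powr (- 1 / (p - 1)) * ((LINT y|lborel. (1 + norm (y :: real ^ 'n)) powr (- q)) *
      R powr (real CARD('n) - \<alpha> - (\<alpha> + \<beta>) / (p - 1)))"
proof -
  let ?D = "LINT y|lborel. (1 + norm (y :: real ^ 'n)) powr (- q)"
  have q: "real CARD('n) < q" unfolding q_def by (rule Young_exponent_gt) fact+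
  note dec = decay_density_integral[OF R q, of \<beta>]
  have "R powr (- (\<alpha> + \<beta>)) * (LINT z|lborel. error_density \<beta> k v R z) =
      (LINT z|lborel. R powr (- (\<alpha> + \<beta>)) * error_density \<beta> k v R z)" by simp
  also have "\<dots> \<le> (LINT z|lborel. \<theta> * source_density \<alpha> \<beta> p (Suc k) v R z +
    \<theta> powr (- 1 / (p - 1)) * (R powr (- (\<alpha> + \<beta>) * p / (p - 1)) * decay_density \<beta> q R z))"
    unfolding q_def
    by (intro integral_mono error_density_Young[OF R p \<theta> k] Bochner_Integration.integrable_add
        integrable_mult_right int int_err dec(1)[unfolded q_def])
  also have "\<dots> = \<theta> * (LINT z|lborel. source_density \<alpha> \<beta> p (Suc k) v R z) +
    \<theta> powr (- 1 / (p - 1)) * (R powr (- (\<alpha> + \<beta>) * p / (p - 1)) * (LINT z|lborel. decay_density \<beta> q R (z :: real \<times> (real ^ 'n))))"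
    using int dec(1) by (subst Bochner_Integration.integral_add) auto
  also have "R powr (- (\<alpha> + \<beta>) * p / (p - 1)) * (LINT z|lborel. decay_density \<beta> q R (z :: real \<times> (real ^ 'n)))
      = ?D * (R powr (- (\<alpha> + \<beta>) * p / (p - 1)) * (R powr \<beta> * R ^ CARD('n)))"
    unfolding dec(2) by (simp add: mult_ac)
  also have "\<dots> = ?D * R powr (real CARD('n) - \<alpha> - (\<alpha> + \<beta>) / (p - 1))"
    by (subst decay_scaling_exponent[OF R p]) simp
  finally show ?thesis .
qed

lemma scaled_inequality:
  fixes c C X Y I R \<alpha> \<beta> :: real
  assumes "c * R powr \<alpha> * X + I \<le> C * R powr (- \<beta>) * Y" "0 < R"
  shows "c * X + R powr (- \<alpha>) * I \<le> C * (R powr (- (\<alpha> + \<beta>)) * Y)"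
proof -
  have "R powr (- \<alpha>) * (c * R powr \<alpha> * X + I) \<le> R powr (- \<alpha>) * (C * R powr (- \<beta>) * Y)"
    using assms by (intro mult_left_mono) auto
  moreover have "R powr (- \<alpha>) * (c * R powr \<alpha> * X + I) = c * X * (R powr (- \<alpha>) * R powr \<alpha>) + R powr (- \<alpha>) * I"
    by (simp only: algebra_simps)
  moreover have "R powr (- \<alpha>) * (C * R powr (- \<beta>) * Y) = C * ((R powr (- \<alpha>) * R powr (- \<beta>)) * Y)"
    by (simp only: mult_ac)
  moreover have "R powr (- \<alpha>) * R powr \<alpha> = 1" "R powr (- \<alpha>) * R powr (- \<beta>) = R powr (- (\<alpha> + \<beta>))"
    using assms by (simp_all add: powr_add[symmetric])
  ultimately show ?thesis by simp
qed

text \<open>Half of the source term absorbs the error. \<open>I\<close> stands for the tested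
  initial data and is left abstract, because it is estimated differently in the two parts of the
  theorem.\<close>

lemma source_growth_bound:
  fixes v :: "real \<times> (real ^ 'n) \<Rightarrow> real" and \<alpha> \<beta> :: real
  assumes p: "1 < p" and k: "p / (p - 1) \<le> real (Suc k)" and \<alpha>: "0 < \<alpha>" and \<beta>: "0 < \<beta>"
    and c: "0 < c" and C: "0 \<le> C"
    and int: "\<And>R. 0 < R \<Longrightarrow> integrable lborel (source_density \<alpha> \<beta> p (Suc k) v R)"
    and int_err: "\<And>R. 0 < R \<Longrightarrow> integrable lborel (error_density \<beta> k v R)"
    and ineq: "\<And>R. 0 < R \<Longrightarrow> c * R powr \<alpha> * (LINT z|lborel. source_density \<alpha> \<beta> p (Suc k) v R z) + I R
      \<le> C * R powr (- \<beta>) * (LINT z|lborel. error_density \<beta> k v R z)"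
  shows "\<exists>K\<ge>0. \<forall>R>0. c / 2 * (LINT z|lborel. source_density \<alpha> \<beta> p (Suc k) v R z) + R powr (- \<alpha>) * I R
    \<le> K * R powr (real CARD('n) - \<alpha> - (\<alpha> + \<beta>) / (p - 1))"
proof -
  define q where "q = ((real CARD('n) + \<beta>) * p - (real CARD('n) - \<alpha>)) / (p - 1)"
  define D where "D = (LINT y|lborel. (1 + norm (y :: real ^ 'n)) powr (- q))"
  \<comment> \<open>Chosen so that C * \<theta> \<le> c / 2; the summand 1 allows for
    \<open>C = 0\<close>.\<close>
  define \<theta> where "\<theta> = c / (2 * (C + 1))"
  have \<theta>: "0 < \<theta>" "C * \<theta> \<le> c / 2" using c C by (auto simp: \<theta>_def field_simps)
  have D: "0 \<le> D" unfolding D_def by (intro Bochner_Integration.integral_nonneg) auto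
  show ?thesis
  proof (rule exI[of _ "C * (\<theta> powr (- 1 / (p - 1)) * D)"], intro conjI allI impI)
    show "0 \<le> C * (\<theta> powr (- 1 / (p - 1)) * D)" using C D by simp
    fix R :: real assume R: "0 < R"
    let ?X = "LINT z|lborel. source_density \<alpha> \<beta> p (Suc k) v R z"
    let ?P = "R powr (real CARD('n) - \<alpha> - (\<alpha> + \<beta>) / (p - 1))"
    have X: "0 \<le> ?X" using source_density_nonneg[OF R] by (intro Bochner_Integration.integral_nonneg)
    have "c * ?X + R powr (- \<alpha>) * I R \<le> C * (R powr (- (\<alpha> + \<beta>)) * (LINT z|lborel. error_density \<beta> k v R z))"
      by (rule scaled_inequality[OF ineq[OF R] R])
    also have "\<dots> \<le> C * (\<theta> * ?X + \<theta> powr (- 1 / (p - 1)) * (D * ?P))"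
      unfolding D_def q_def
      by (intro mult_left_mono C integral_error_density_le R p \<theta>(1) k \<alpha> \<beta> int int_err)
    also have "\<dots> = (C * \<theta>) * ?X + C * (\<theta> powr (- 1 / (p - 1)) * D) * ?P" by (simp add: algebra_simps)
    also have "\<dots> \<le> c / 2 * ?X + C * (\<theta> powr (- 1 / (p - 1)) * D) * ?P"
      using X \<theta>(2) by (intro add_right_mono mult_right_mono)
    finally show "c / 2 * ?X + R powr (- \<alpha>) * I R \<le> C * (\<theta> powr (- 1 / (p - 1)) * D) * ?P" by linarith
  qed
qed

section \<open>Lower bounds for the tested initial data\<close>

text \<open>On the ball of radius R / 2 the bump is at least (3/4)^3 and 1 + |x|^2 \<le> 2 R^2, the
  latter because R \<ge> 1. Elsewhere the integrand is nonnegative.\<close>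

lemma integral_bump_slow_decay:
  fixes u0 :: "real ^ 'n \<Rightarrow> real"
  assumes \<epsilon>: "0 < \<epsilon>" and \<gamma>: "0 < \<gamma>" and lb: "AE x in lebesgue. \<epsilon> * (1 + (norm x)\<^sup>2) powr (- \<gamma> / 2) \<le> u0 x"
    and R: "1 \<le> R" and int: "integrable lebesgue (\<lambda>x. u0 x * bump (x /\<^sub>R R))"
  shows "\<epsilon> * 2 powr (- \<gamma> / 2) * (27 / 64) * (unit_ball_vol (real CARD('n)) / 2 ^ CARD('n)) * R powr (real CARD('n) - \<gamma>)
    \<le> (LINT x|lebesgue. u0 x * bump (x /\<^sub>R R))"
proof -
  define d where "d = \<epsilon> * 2 powr (- \<gamma> / 2) * R powr (- \<gamma>)"
  have d: "0 \<le> d" using \<epsilon> by (simp add: d_def)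
  let ?g = "\<lambda>x :: real ^ 'n. (d * (27 / 64)) * indicator (cball 0 (R / 2)) x"
  have int_g: "integrable lebesgue ?g"
    by (intro integrable_mult_right integrable_real_indicator) (use R in \<open>auto simp: emeasure_cball\<close>)
  have "(LINT x|lebesgue. ?g x) = d * (27 / 64) * measure lebesgue (cball (0 :: real ^ 'n) (R / 2))"
    by simp
  also have "measure lebesgue (cball (0 :: real ^ 'n) (R / 2)) = unit_ball_vol (real CARD('n)) * (R / 2) ^ CARD('n)"
    using R content_cball[of "R / 2" "0 :: real ^ 'n"] by simp
  also have "d * (27 / 64) * (unit_ball_vol (real CARD('n)) * (R / 2) ^ CARD('n)) =
      \<epsilon> * 2 powr (- \<gamma> / 2) * (27 / 64) * (unit_ball_vol (real CARD('n)) / 2 ^ CARD('n)) * (R powr (- \<gamma>) * R ^ CARD('n))"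
    by (simp add: d_def power_divide)
  also have "R powr (- \<gamma>) * R ^ CARD('n) = R powr (real CARD('n) - \<gamma>)"
    using R by (simp add: powr_realpow[symmetric] powr_add[symmetric])
  finally have eq: "(LINT x|lebesgue. ?g x) = \<epsilon> * 2 powr (- \<gamma> / 2) * (27 / 64) * (unit_ball_vol (real CARD('n)) / 2 ^ CARD('n)) * R powr (real CARD('n) - \<gamma>)" .
  have "AE x in lebesgue. ?g x \<le> u0 x * bump (x /\<^sub>R R)"
    using lb
  proof eventually_elim
    case (elim x)
    have u0: "0 \<le> u0 x" using elim \<epsilon> by (meson order_trans mult_nonneg_nonneg less_imp_le powr_ge_zero)
    show ?case
    proof (cases "norm x \<le> R / 2")
      case True
      have "(norm x)\<^sup>2 \<le> R\<^sup>2" using True R by (intro power_mono) auto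
      moreover have "1 \<le> R\<^sup>2" using R by simp
      ultimately have "1 + (norm x)\<^sup>2 \<le> 2 * R\<^sup>2" by linarith
      then have "(2 * R\<^sup>2) powr (- \<gamma> / 2) \<le> (1 + (norm x)\<^sup>2) powr (- \<gamma> / 2)"
        using \<gamma> by (intro powr_mono2') (auto simp: add_pos_nonneg)
      moreover have "(2 * R\<^sup>2) powr (- \<gamma> / 2) = 2 powr (- \<gamma> / 2) * R powr (- \<gamma>)"
        using R powr_powr[of R 2 "- \<gamma> / 2"] by (simp add: powr_mult)
      ultimately have "\<epsilon> * (2 powr (- \<gamma> / 2) * R powr (- \<gamma>)) \<le> \<epsilon> * (1 + (norm x)\<^sup>2) powr (- \<gamma> / 2)"
        using \<epsilon> by (intro mult_left_mono) auto
      then have "d \<le> u0 x" using elim by (simp add: d_def mult.assoc)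
      moreover have "27 / 64 \<le> bump (x /\<^sub>R R)"
        using True R by (intro bump_ge) (simp add: field_simps)
      ultimately have "d * (27 / 64) \<le> u0 x * bump (x /\<^sub>R R)" using u0 by (intro mult_mono) auto
      then show ?thesis using True by simp
    next
      case False
      then show ?thesis using u0 by simp
    qed
  qed
  from integral_mono_AE[OF int_g int this] show ?thesis unfolding eq .
qed

text \<open>The scaled bump is an average of indicators of balls of radius at most \<open>R\<close>,
  with levels of total length 1. A lower bound common to all these balls therefore passes to the
  bump, whatever the sign of \<open>u0\<close>.\<close>

lemma integral_scaled_bump_ge:
  fixes u0 :: "real ^ 'n \<Rightarrow> real"
  assumes loc: "L1_loc UNIV u0" and R: "0 < R" and B: "0 \<le> B"
    and lb: "\<And>r. 0 \<le> r \<Longrightarrow> r \<le> R \<Longrightarrow> - B \<le> (LINT x:cball 0 r|lebesgue. u0 x)"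
  shows "- B \<le> (LINT x|lebesgue. u0 x * bump (x /\<^sub>R R))"
proof -
  have "integrable lebesgue (\<lambda>x. indicator (cball 0 R) x * u0 x)"
    using loc unfolding L1_loc_def set_integrable_def by simp
  note int0 = this
  from completion_ex_borel_measurable_real[OF borel_measurable_integrable[OF int0]]
  obtain g where g: "g \<in> borel_measurable lborel"
    and ae: "AE x in lborel. indicator (cball 0 R) x * u0 x = g x" by blast
  have ae': "AE x in lebesgue. indicator (cball 0 R) x * u0 x = g x"
    using ae by (simp add: AE_completion_iff)
  from g have [measurable]: "g \<in> borel_measurable borel" by simp
  have "integrable lebesgue g"
    by (rule integrable_cong_AE_imp[OF int0 measurable_completion[OF g]]) (use ae' in \<open>auto simp: eq_commute\<close>)
  then have int_g: "integrable lborel g" using g by (simp add: integrable_completion)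
  define b where "b x = bump (x /\<^sub>R R)" for x :: "real ^ 'n"
  have [measurable]: "b \<in> borel_measurable borel"
    unfolding b_def by (intro borel_measurable_continuous_onI continuous_intros)
  have b01: "0 \<le> b x" "b x \<le> 1" for x by (auto simp: b_def bump_le_1)
  have I: "(LINT x|lebesgue. u0 x * bump (x /\<^sub>R R)) = (LINT x|lborel. b x * g x)"
  proof -
    have "(LINT x|lebesgue. u0 x * bump (x /\<^sub>R R)) = (LINT x|lebesgue. b x * (indicator (cball 0 R) x * u0 x))"
    proof (intro Bochner_Integration.integral_cong refl)
      fix x :: "real ^ 'n"
      show "u0 x * bump (x /\<^sub>R R) = b x * (indicator (cball 0 R) x * u0 x)"
        using bump_eq_0[of "x /\<^sub>R R"] R by (auto simp: b_def indicator_def field_simps)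
    qed
    also have "\<dots> = (LINT x|lebesgue. b x * g x)"
    proof (rule integral_cong_AE)
      show "(\<lambda>x. b x * (indicator (cball 0 R) x * u0 x)) \<in> borel_measurable lebesgue"
        by (rule borel_measurable_times[OF measurable_completion borel_measurable_integrable[OF int0]]) simp
      show "(\<lambda>x. b x * g x) \<in> borel_measurable lebesgue" by (intro measurable_completion) measurable
      show "AE x in lebesgue. b x * (indicator (cball 0 R) x * u0 x) = b x * g x"
        using ae' by eventually_elim simp
    qed
    also have "\<dots> = (LINT x|lborel. b x * g x)" by (rule integral_completion) measurable
    finally show ?thesis .
  qed
  \<comment> \<open>Layer cake: the superlevel sets of the radial bump are balls, where \<open>u0\<close> has controlled mass.\<close>
  define f where "f s x = indicator {0<..} s * indicator {y. s \<le> b y} x * g x" for s x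
  \<comment> \<open>The radius solves s = (1 - |y / R|^2)^3 for |y|.\<close>
  have ball: "{y. s \<le> b y} = cball 0 (R * sqrt (1 - root 3 s))" "0 \<le> R * sqrt (1 - root 3 s)"
    "R * sqrt (1 - root 3 s) \<le> R" if s: "0 < s" "s \<le> 1" for s
  proof -
    define r where "r = root 3 s"
    have r: "0 < r" "r \<le> 1" "r ^ 3 = s" using s by (auto simp: r_def)
    have key: "s \<le> b y \<longleftrightarrow> norm y \<le> R * sqrt (1 - r)" for y
    proof -
      have "s \<le> b y \<longleftrightarrow> r ^ 3 \<le> cutoff (y /\<^sub>R R) ^ 3" by (simp add: b_def bump_def r)
      also have "\<dots> \<longleftrightarrow> r \<le> cutoff (y /\<^sub>R R)" using r by (intro power_mono_iff) auto
      also have "\<dots> \<longleftrightarrow> (norm (y /\<^sub>R R))\<^sup>2 \<le> 1 - r" using r by (auto simp: cutoff_def)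
      also have "\<dots> \<longleftrightarrow> norm (y /\<^sub>R R) \<le> sqrt (1 - r)"
      proof
        show "norm (y /\<^sub>R R) \<le> sqrt (1 - r)" if "(norm (y /\<^sub>R R))\<^sup>2 \<le> 1 - r"
          using that by (rule real_le_rsqrt)
        show "(norm (y /\<^sub>R R))\<^sup>2 \<le> 1 - r" if "norm (y /\<^sub>R R) \<le> sqrt (1 - r)"
          using power_mono[OF that, of 2] r by simp
      qed
      also have "\<dots> \<longleftrightarrow> norm y \<le> R * sqrt (1 - r)" using R by (simp add: field_simps)
      finally show ?thesis .
    qed
    show "{y. s \<le> b y} = cball 0 (R * sqrt (1 - root 3 s))"
      unfolding r_def[symmetric] key by (rule set_eqI) simp
    show "0 \<le> R * sqrt (1 - root 3 s)" "R * sqrt (1 - root 3 s) \<le> R"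
      using r R by (auto simp: r_def)
  qed
  have fm: "case_prod f \<in> borel_measurable (lborel \<Otimes>\<^sub>M lborel)"
    unfolding f_def by measurable
  \<comment> \<open>As \<open>g\<close> may change sign, exchanging the integrals requires absolute
    integrability; the majorant is |g| on the levels between 0 and 1.\<close>
  have int_f: "integrable (lborel \<Otimes>\<^sub>M lborel) (case_prod f)"
  proof (rule lborel_pair.Fubini_integrable[OF fm])
    have *: "(LINT y|lborel. norm (case (s, y) of (s, y) \<Rightarrow> f s y)) = (LINT y|lborel. norm (f s y))" for s by simp
    have fb: "norm (f s y) \<le> indicator {0..1} s * norm (g y)" for s y
      using b01[of y] by (auto simp: f_def indicator_def abs_mult)
    have fg: "norm (f s y) \<le> norm (g y)" for s y
      by (auto simp: f_def indicator_def)
    show "AE s in lborel. integrable lborel (\<lambda>y. case (s, y) of (s, y) \<Rightarrow> f s y)"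
    proof (rule AE_I2)
      fix s :: real
      have "f s \<in> borel_measurable borel" unfolding f_def by measurable
      then show "integrable lborel (\<lambda>y. case (s, y) of (s, y) \<Rightarrow> f s y)"
        using fg by (intro Bochner_Integration.integrable_bound[OF int_g]) auto
    qed
    then have fi: "AE s in lborel. integrable lborel (f s)" by simp
    show "integrable lborel (\<lambda>s. LINT y|lborel. norm (case (s, y) of (s, y) \<Rightarrow> f s y))"
      unfolding *
    proof (rule Bochner_Integration.integrable_bound)
      show "integrable lborel (\<lambda>s :: real. indicator {0..1} s * (LINT y|lborel. norm (g y)))"
        by (intro integrable_mult_left integrable_real_indicator) auto
      have "(\<lambda>(s, y). norm (f s y)) \<in> borel_measurable (lborel \<Otimes>\<^sub>M lborel)"
        using measurable_compose[OF fm borel_measurable_norm] by (simp only: case_prod_unfold)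
      then show "(\<lambda>s. LINT y|lborel. norm (f s y)) \<in> borel_measurable lborel"
        by (rule lborel.borel_measurable_lebesgue_integral)
      show "AE s in lborel. norm (LINT y|lborel. norm (f s y)) \<le> norm (indicator {0..1} s * (LINT y|lborel. norm (g y)))"
        using fi
      proof eventually_elim
        case (elim s)
        have "(LINT y|lborel. norm (f s y)) \<le> (LINT y|lborel. indicator {0..1} s * norm (g y))"
          using elim int_g fb by (intro integral_mono) auto
        then show ?case by (simp add: Bochner_Integration.integral_nonneg)
      qed
    qed
  qed
  have inner: "(LINT s|lborel. f s x) = b x * g x" for x
  proof -
    have "f s x = g x * indicator {0<..b x} s" for s by (auto simp: f_def indicator_def)
    then show ?thesis using b01[of x] by simp
  qed
  have outer: "- B * indicator {0<..1} s \<le> (LINT x|lborel. f s x)" for s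
  proof (cases "0 < s \<and> s \<le> 1")
    case True
    then have s: "0 < s" "s \<le> 1" by auto
    let ?r = "R * sqrt (1 - root 3 s)"
    have sub: "cball 0 ?r \<subseteq> cball (0 :: real ^ 'n) R" using ball(3)[OF s] by auto
    have "(LINT x|lborel. f s x) = (LINT x|lborel. indicator (cball 0 ?r) x * g x)"
      using s unfolding f_def ball(1)[OF s] by simp
    also have "\<dots> = (LINT x|lebesgue. indicator (cball 0 ?r) x * g x)"
      by (rule integral_completion[symmetric]) (intro borel_measurable_times borel_measurable_indicator, use g in auto)
    also have "\<dots> = (LINT x|lebesgue. indicator (cball 0 ?r) x * u0 x)"
    proof (rule integral_cong_AE)
      show "(\<lambda>x. indicator (cball 0 ?r) x * g x) \<in> borel_measurable lebesgue"
        by (intro measurable_completion borel_measurable_times borel_measurable_indicator) (use g in auto)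
      show "(\<lambda>x. indicator (cball 0 ?r) x * u0 x) \<in> borel_measurable lebesgue"
        using loc unfolding L1_loc_def set_integrable_def
        by (auto dest!: spec[of _ "cball 0 ?r"] borel_measurable_integrable)
      show "AE x in lebesgue. indicator (cball 0 ?r) x * g x = indicator (cball 0 ?r) x * u0 x"
        using ae' by eventually_elim (use sub in \<open>auto simp: indicator_def split: if_splits\<close>)
    qed
    finally have "(LINT x|lborel. f s x) = (LINT x:cball 0 ?r|lebesgue. u0 x)"
      by (simp add: set_lebesgue_integral_def)
    then show ?thesis using lb[OF ball(2,3)[OF s]] s by simp
  next
    case False
    have "f s x = 0" for x using b01[of x] False by (auto simp: f_def indicator_def)
    then show ?thesis using False by simp
  qed
  have "- B = (LINT s|lborel. - B * indicator {0<..1 :: real} s)" by simp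
  also have "\<dots> \<le> (LINT s|lborel. LINT x|lborel. f s x)"
  proof (rule integral_mono)
    show "integrable lborel (\<lambda>s :: real. - B * indicator {0<..1} s)"
      by (intro integrable_mult_right integrable_real_indicator) auto
    show "integrable lborel (\<lambda>s. LINT x|lborel. f s x)" by (rule lborel_pair.integrable_fst[OF int_f])
  qed (rule outer)
  also have "\<dots> = (LINT x|lborel. LINT s|lborel. f s x)"
    by (rule lborel_pair.Fubini_integral[OF int_f, symmetric])
  also have "\<dots> = (LINT x|lebesgue. u0 x * bump (x /\<^sub>R R))" by (simp only: inner I)
  finally show ?thesis .
qed

section \<open>Integrability of |u|^p over space-time\<close>

lemma source_density_mono:
  fixes z :: "real \<times> (real ^ 'n)"
  assumes "0 < r" "r \<le> R" "0 < \<beta>" "\<alpha> < real CARD('n)"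
  shows "source_density \<alpha> \<beta> p k v r z \<le> source_density \<alpha> \<beta> p k v R z"
proof (cases "fst z \<in> {0<..<r powr \<beta>}")
  case True
  have le: "r powr \<beta> \<le> R powr \<beta>" using assms by (intro powr_mono2) auto
  have pos: "0 < r powr \<beta>" using assms by simp
  have "fst z / R powr \<beta> \<le> fst z / r powr \<beta>" 
    using True le pos by (intro divide_left_mono mult_pos_pos) auto
  then have 1: "(1 - fst z / r powr \<beta>) ^ k \<le> (1 - fst z / R powr \<beta>) ^ k"
    using True pos by (intro power_mono) (auto simp: field_simps)
  have "norm (snd z) / R \<le> norm (snd z) / r" using assms by (intro divide_left_mono) auto
  then have 2: "(1 + norm (snd z) / r) powr (- (real CARD('n) - \<alpha>)) \<le> (1 + norm (snd z) / R) powr (- (real CARD('n) - \<alpha>))"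
    using assms by (intro powr_mono2') (auto simp: add_pos_nonneg)
  have 0: "0 \<le> (1 - fst z / r powr \<beta>) ^ k" using True pos by (intro zero_le_power) (auto simp: field_simps)
  have "(1 - fst z / r powr \<beta>) ^ k * (\<bar>v z\<bar> powr p * (1 + norm (snd z) / r) powr (- (real CARD('n) - \<alpha>)))
    \<le> (1 - fst z / R powr \<beta>) ^ k * (\<bar>v z\<bar> powr p * (1 + norm (snd z) / R) powr (- (real CARD('n) - \<alpha>)))"
    using 0 order_trans[OF 0 1] by (intro mult_mono 1 2 mult_left_mono) auto
  moreover have "fst z \<in> {0<..<R powr \<beta>}" using True le by auto
  ultimately show ?thesis using True by (simp add: source_density_def)
next
  case False
  have "source_density \<alpha> \<beta> p k v r z = 0" unfolding source_density_def indicator_simps(2)[OF False] by simp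
  also have "0 \<le> source_density \<alpha> \<beta> p k v R z" using assms by (intro source_density_nonneg) auto
  finally show ?thesis .
qed

lemma source_density_le:
  fixes z :: "real \<times> (real ^ 'n)"
  assumes "0 < R" "\<alpha> < real CARD('n)"
  shows "source_density \<alpha> \<beta> p k v R z \<le> indicator {0<..} (fst z) * \<bar>v z\<bar> powr p"
proof (cases "fst z \<in> {0<..<R powr \<beta>}")
  case True
  have s: "0 \<le> 1 - fst z / R powr \<beta>" "1 - fst z / R powr \<beta> \<le> 1"
    using True assms by (auto simp: field_simps)
  have "(1 + norm (snd z) / R) powr (- (real CARD('n) - \<alpha>)) \<le> 1 powr (- (real CARD('n) - \<alpha>))"
    using assms by (intro powr_mono2') auto
  then have "(1 - fst z / R powr \<beta>) ^ k * (\<bar>v z\<bar> powr p * (1 + norm (snd z) / R) powr (- (real CARD('n) - \<alpha>)))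
    \<le> 1 * (\<bar>v z\<bar> powr p * 1)"
    using s by (intro mult_mono power_le_one) auto
  then show ?thesis using True by (simp add: source_density_def)
next
  case False
  have "source_density \<alpha> \<beta> p k v R z = 0" unfolding source_density_def indicator_simps(2)[OF False] by simp
  then show ?thesis by simp
qed

text \<open>In the first half of the time interval the time factor is at least 1/2, and for |x|
  \<le> R the spatial weight is at least 2^(\<alpha>-n).\<close>

lemma source_density_ge:
  fixes z :: "real \<times> (real ^ 'n)"
  assumes "0 < R" "\<alpha> < real CARD('n)" "0 < fst z" "fst z \<le> R powr \<beta> / 2" "norm (snd z) \<le> R"
  shows "\<bar>v z\<bar> powr p \<le> 2 ^ k * 2 powr (real CARD('n) - \<alpha>) * source_density \<alpha> \<beta> p k v R z"
proof -
  let ?s = "real CARD('n) - \<alpha>"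
  have S: "0 < R powr \<beta>" using assms by simp
  have t: "fst z \<in> {0<..<R powr \<beta>}" using assms S by auto
  have "1 / 2 \<le> 1 - fst z / R powr \<beta>" using assms S by (simp add: field_simps)
  then have 1: "(1 / 2) ^ k \<le> (1 - fst z / R powr \<beta>) ^ k" by (intro power_mono) auto
  have "2 powr (- ?s) \<le> (1 + norm (snd z) / R) powr (- ?s)"
    using assms by (intro powr_mono2') (auto simp: field_simps add_pos_nonneg)
  with 1 have "(1 / 2) ^ k * (\<bar>v z\<bar> powr p * 2 powr (- ?s)) \<le> source_density \<alpha> \<beta> p k v R z"
    unfolding source_density_def indicator_simps(1)[OF t] mult_1
    by (intro mult_mono mult_left_mono) (auto intro: order_trans[OF _ 1])
  then have "2 ^ k * 2 powr ?s * ((1 / 2) ^ k * (\<bar>v z\<bar> powr p * 2 powr (- ?s)))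
      \<le> 2 ^ k * 2 powr ?s * source_density \<alpha> \<beta> p k v R z"
    by (intro mult_left_mono) auto
  moreover have "2 ^ k * 2 powr ?s * ((1 / 2) ^ k * (\<bar>v z\<bar> powr p * 2 powr (- ?s))) = \<bar>v z\<bar> powr p"
  proof -
    have "2 ^ k * 2 powr ?s * ((1 / 2) ^ k * (\<bar>v z\<bar> powr p * 2 powr (- ?s))) =
        (2 ^ k * (1 / 2) ^ k) * (2 powr ?s * 2 powr (- ?s)) * \<bar>v z\<bar> powr p"
      by (simp only: mult_ac)
    moreover have "2 ^ k * (1 / 2 :: real) ^ k = 1" by (simp only: power_mult_distrib[symmetric]) simp
    moreover have "2 powr ?s * 2 powr (- ?s) = 1" by (simp only: powr_add[symmetric]) simp
    ultimately show ?thesis by (simp only: mult_1)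
  qed
  ultimately show ?thesis by linarith
qed

text \<open>Fatou's lemma along the exhausting sets \<open>B m\<close>, on each of which |v|^p is
  bounded by a fixed multiple of the source density. Using \<open>Suc m\<close> as radius keeps it
  at least 1, where \<open>bound\<close> applies.\<close>

lemma integrable_from_source_bound:
  fixes v :: "real \<times> (real ^ 'n) \<Rightarrow> real"
  assumes v: "v \<in> borel_measurable borel" and \<alpha>: "\<alpha> < real CARD('n)" and \<beta>: "0 < \<beta>"
    and int: "\<And>R. 0 < R \<Longrightarrow> integrable lborel (source_density \<alpha> \<beta> p k v R)"
    and bound: "\<And>R. 1 \<le> R \<Longrightarrow> (LINT z|lborel. source_density \<alpha> \<beta> p k v R z) \<le> L"
  shows "integrable lborel (\<lambda>z. indicator {0<..} (fst z) * \<bar>v z\<bar> powr p)"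
proof -
  define f where "f z = indicator {0<..} (fst z) * \<bar>v z\<bar> powr p" for z :: "real \<times> (real ^ 'n)"
  define A where "A = (2 ^ k * 2 powr (real CARD('n) - \<alpha>) :: real)"
  define B where "B m = {z :: real \<times> (real ^ 'n). fst z \<le> real (Suc m) powr \<beta> / 2 \<and> norm (snd z) \<le> real (Suc m)}" for m
  have A: "0 \<le> A" by (simp add: A_def)
  have fm: "f \<in> borel_measurable borel"
    using v unfolding f_def borel_prod[symmetric] by measurable
  have Bm: "B m \<in> sets borel" for m
  proof -
    have "closed (B m)"
      unfolding B_def by (intro closed_Collect_conj closed_Collect_le continuous_intros)
    then show ?thesis by simp
  qed
  have le: "(\<integral>\<^sup>+z. ennreal (indicator (B m) z * f z) \<partial>lborel) \<le> ennreal (A * L)" for m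
  proof -
    have pt: "indicator (B m) z * f z \<le> A * source_density \<alpha> \<beta> p k v (real (Suc m)) z" for z
    proof (cases "z \<in> B m \<and> 0 < fst z")
      case True
      then show ?thesis
        using source_density_ge[of "real (Suc m)" \<alpha> z \<beta> v p k] \<alpha>
        by (simp add: f_def A_def B_def)
    next
      case False
      then show ?thesis using A source_density_nonneg[of "real (Suc m)" \<alpha> \<beta> p k v z]
        by (auto simp: f_def indicator_def)
    qed
    have "(\<integral>\<^sup>+z. ennreal (indicator (B m) z * f z) \<partial>lborel) \<le>
        (\<integral>\<^sup>+z. ennreal (A * source_density \<alpha> \<beta> p k v (real (Suc m)) z) \<partial>lborel)"
      by (intro nn_integral_mono ennreal_leI pt)
    also have "\<dots> = ennreal (LINT z|lborel. A * source_density \<alpha> \<beta> p k v (real (Suc m)) z)"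
      by (intro nn_integral_eq_integral integrable_mult_right int AE_I2 mult_nonneg_nonneg A source_density_nonneg) auto
    also have "\<dots> \<le> ennreal (A * L)"
      using bound[of "real (Suc m)"] A by (intro ennreal_leI) (simp add: mult_left_mono)
    finally show ?thesis .
  qed
  have ev: "\<forall>\<^sub>F m in sequentially. ennreal (indicator (B m) z * f z) = ennreal (f z)" for z
  proof -
    have "filterlim (\<lambda>m. real (Suc m) powr \<beta>) at_top sequentially"
      using \<beta> by (intro filterlim_compose[OF real_powr_at_top] filterlim_compose[OF filterlim_real_sequentially] filterlim_Suc)
    then have "\<forall>\<^sub>F m in sequentially. 2 * fst z \<le> real (Suc m) powr \<beta>"
      by (simp add: filterlim_at_top)
    moreover have "\<forall>\<^sub>F m in sequentially. norm (snd z) \<le> real (Suc m)"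
      using filterlim_compose[OF filterlim_real_sequentially filterlim_Suc] by (simp add: filterlim_at_top)
    ultimately show ?thesis by eventually_elim (simp add: B_def)
  qed
  have lim: "liminf (\<lambda>m. ennreal (indicator (B m) z * f z)) = ennreal (f z)" for z
    by (intro lim_imp_Liminf tendsto_eventually ev) simp
  have "(\<integral>\<^sup>+z. ennreal (f z) \<partial>lborel) = (\<integral>\<^sup>+z. liminf (\<lambda>m. ennreal (indicator (B m) z * f z)) \<partial>lborel)"
    by (simp only: lim)
  also have "\<dots> \<le> liminf (\<lambda>m. \<integral>\<^sup>+z. ennreal (indicator (B m) z * f z) \<partial>lborel)"
  proof (rule nn_integral_liminf)
    fix m
    note [measurable] = fm Bm
    show "(\<lambda>z. ennreal (indicator (B m) z * f z)) \<in> borel_measurable lborel"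
      unfolding measurable_lborel1 by measurable
  qed
  also have "\<dots> \<le> liminf (\<lambda>m :: nat. ennreal (A * L))"
    by (intro Liminf_mono always_eventually allI le)
  also have "\<dots> < \<infinity>" by (simp add: Liminf_const)
  finally show ?thesis
    using fm unfolding f_def[abs_def, symmetric] by (intro integrableI_nonneg) (auto simp: f_def)
qed

section \<open>Vanishing up to the critical exponent\<close>

text \<open>On \<open>B\<close> the crude bound |v| \<le> 1 + |v|^p suffices: \<open>B\<close> will
  be a fixed ball, and the prefactor R^(-\<alpha>-\<beta>) tends to 0. Outside \<open>B\<close>
  Young's inequality is used, and \<theta> may be large since it multiplies only the part of |v|^p
  off \<open>B\<close>.\<close>

lemma error_density_split:
  fixes v :: "real \<times> (real ^ 'n) \<Rightarrow> real" and \<alpha> \<beta> :: real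
  assumes R: "0 < R" and p: "1 < p" and \<theta>: "0 < \<theta>" and k: "p / (p - 1) \<le> real (Suc k)"
    and \<alpha>: "\<alpha> < real CARD('n)" and \<beta>: "0 < \<beta>"
  defines "q \<equiv> ((real CARD('n) + \<beta>) * p - (real CARD('n) - \<alpha>)) / (p - 1)"
    and "f \<equiv> \<lambda>z. indicator {0<..} (fst z) * \<bar>v z\<bar> powr p"
  shows "R powr (- (\<alpha> + \<beta>)) * error_density \<beta> k v R z \<le>
    R powr (- (\<alpha> + \<beta>)) * (indicator B z + f z) + \<theta> * (indicator (- B) z * f z) +
    \<theta> powr (- 1 / (p - 1)) * (R powr (- (\<alpha> + \<beta>) * p / (p - 1)) * decay_density \<beta> q R z)"
proof -
  have f: "0 \<le> f z" by (simp add: f_def)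
  have dec: "0 \<le> \<theta> powr (- 1 / (p - 1)) * (R powr (- (\<alpha> + \<beta>) * p / (p - 1)) * decay_density \<beta> q R z)"
    by (intro mult_nonneg_nonneg decay_density_nonneg) auto
  show ?thesis
  proof (cases "z \<in> B")
    case True
    have "error_density \<beta> k v R z \<le> 1 + f z"
    proof (cases "fst z \<in> {0<..<R powr \<beta>}")
      case t: True
      have s: "0 \<le> 1 - fst z / R powr \<beta>" "1 - fst z / R powr \<beta> \<le> 1"
        using t R by (auto simp: field_simps)
      have "(1 + norm (snd z) / R) powr (- (real CARD('n) + \<beta>)) \<le> 1 powr (- (real CARD('n) + \<beta>))"
        using R \<beta> by (intro powr_mono2') auto
      then have "(1 - fst z / R powr \<beta>) ^ k * (\<bar>v z\<bar> * (1 + norm (snd z) / R) powr (- (real CARD('n) + \<beta>)))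
        \<le> 1 * (\<bar>v z\<bar> * 1)"
        using s by (intro mult_mono power_le_one) auto
      moreover have "\<bar>v z\<bar> \<le> 1 + \<bar>v z\<bar> powr p"
      proof (cases "\<bar>v z\<bar> \<le> 1")
        case False
        then have "\<bar>v z\<bar> powr 1 \<le> \<bar>v z\<bar> powr p" using p by (intro powr_mono) auto
        then show ?thesis using False by simp
      qed (simp add: add_increasing2)
      ultimately show ?thesis using t by (simp add: error_density_def f_def)
    next
      case False
      have "error_density \<beta> k v R z = 0" unfolding error_density_def indicator_simps(2)[OF False] by simp
      then show ?thesis using f by simp
    qed
    then have "R powr (- (\<alpha> + \<beta>)) * error_density \<beta> k v R z \<le> R powr (- (\<alpha> + \<beta>)) * (indicator B z + f z)"
      using True by (intro mult_left_mono) auto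
    moreover have "\<theta> * (indicator (- B) z * f z) = 0" using True by simp
    ultimately show ?thesis using dec by linarith
  next
    case False
    have "R powr (- (\<alpha> + \<beta>)) * error_density \<beta> k v R z \<le>
      \<theta> * source_density \<alpha> \<beta> p (Suc k) v R z +
      \<theta> powr (- 1 / (p - 1)) * (R powr (- (\<alpha> + \<beta>) * p / (p - 1)) * decay_density \<beta> q R z)"
      unfolding q_def by (rule error_density_Young[OF R p \<theta> k])
    also have "\<theta> * source_density \<alpha> \<beta> p (Suc k) v R z \<le> \<theta> * f z"
      unfolding f_def using \<theta> by (intro mult_left_mono source_density_le R \<alpha>) auto
    finally have "R powr (- (\<alpha> + \<beta>)) * error_density \<beta> k v R z \<le> \<theta> * f z +
      \<theta> powr (- 1 / (p - 1)) * (R powr (- (\<alpha> + \<beta>) * p / (p - 1)) * decay_density \<beta> q R z)" by simp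
    moreover have "\<theta> * (indicator (- B) z * f z) = \<theta> * f z" using False by simp
    moreover have "0 \<le> R powr (- (\<alpha> + \<beta>)) * (indicator B z + f z)" using f by simp
    ultimately show ?thesis by linarith
  qed
qed

lemma integral_outside_cball_tendsto_0:
  fixes f :: "'a::euclidean_space \<Rightarrow> real"
  assumes "integrable lborel f"
  shows "(\<lambda>m. LINT z|lborel. indicator (- cball 0 (real m)) z * f z) \<longlonglongrightarrow> 0"
proof -
  have fm: "f \<in> borel_measurable borel" using assms borel_measurable_integrable by fastforce
  have "(\<lambda>m. LINT z|lborel. indicator (- cball 0 (real m)) z * f z) \<longlonglongrightarrow> (LINT z|(lborel :: 'a measure). 0 :: real)"
  proof (rule integral_dominated_convergence)
    show "integrable lborel (\<lambda>z. norm (f z))" using assms by (rule integrable_norm)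
    show "AE z in lborel. (\<lambda>m. indicator (- cball 0 (real m)) z * f z) \<longlonglongrightarrow> 0"
    proof (rule AE_I2)
      fix z :: 'a
      have "\<forall>\<^sub>F m in sequentially. norm z \<le> real m"
        using filterlim_real_sequentially by (simp add: filterlim_at_top)
      then have "\<forall>\<^sub>F m in sequentially. indicator (- cball 0 (real m)) z * f z = 0"
        by eventually_elim simp
      then show "(\<lambda>m. indicator (- cball 0 (real m)) z * f z) \<longlonglongrightarrow> 0" by (rule tendsto_eventually)
    qed
    show "(\<lambda>z. indicator (- cball 0 (real m)) z * f z) \<in> borel_measurable lborel" for m
      using fm by (intro borel_measurable_times borel_measurable_indicator) auto
  qed (auto simp: indicator_def)
  then show ?thesis by simp
qed

lemma eventually_powr_neg_small:
  fixes a K e :: real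
  assumes "0 < a" "0 < e"
  shows "\<forall>\<^sub>F R in at_top. K * R powr (- a) < e"
proof -
  have "((\<lambda>R::real. R powr (- a)) \<longlongrightarrow> 0) at_top"
    using assms by (intro tendsto_neg_powr filterlim_ident) auto
  then have "((\<lambda>R. K * R powr (- a)) \<longlongrightarrow> K * 0) at_top" by (intro tendsto_intros)
  then show ?thesis using assms by (simp add: order_tendstoD(2))
qed

context
  fixes v :: "real \<times> (real ^ 'n) \<Rightarrow> real" and \<alpha> \<beta> p c C :: real and I :: "real \<Rightarrow> real" and k :: nat
  assumes v: "v \<in> borel_measurable borel"
    and \<alpha>: "0 < \<alpha>" "\<alpha> < real CARD('n)" and \<beta>: "0 < \<beta>" and p: "1 < p" and k: "p / (p - 1) \<le> real (Suc k)"
    and c: "0 < c" and C: "0 \<le> C"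
    and int: "\<And>R. 0 < R \<Longrightarrow> integrable lborel (source_density \<alpha> \<beta> p (Suc k) v R)"
    and int_err: "\<And>R. 0 < R \<Longrightarrow> integrable lborel (error_density \<beta> k v R)"
    and ineq: "\<And>R. 0 < R \<Longrightarrow> c * R powr \<alpha> * (LINT z|lborel. source_density \<alpha> \<beta> p (Suc k) v R z) + I R
      \<le> C * R powr (- \<beta>) * (LINT z|lborel. error_density \<beta> k v R z)"
    and critical: "real CARD('n) - \<alpha> - (\<alpha> + \<beta>) / (p - 1) \<le> 0"
    and data: "\<And>\<delta>. 0 < \<delta> \<Longrightarrow> \<exists>M\<ge>0. \<forall>R>0. - \<delta> * R powr \<alpha> - M \<le> I R"
begin

lemma data_scaled:
  assumes "0 < \<delta>"
  obtains M where "0 \<le> M" "\<And>R. 0 < R \<Longrightarrow> - \<delta> - M * R powr (- \<alpha>) \<le> R powr (- \<alpha>) * I R"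
proof -
  obtain M where M: "0 \<le> M" "\<And>R. 0 < R \<Longrightarrow> - \<delta> * R powr \<alpha> - M \<le> I R" using data[OF assms] by blast
  have "- \<delta> - M * R powr (- \<alpha>) \<le> R powr (- \<alpha>) * I R" if "0 < R" for R
  proof -
    have "R powr (- \<alpha>) * (- \<delta> * R powr \<alpha> - M) \<le> R powr (- \<alpha>) * I R"
      using M(2)[OF that] by (intro mult_left_mono) auto
    moreover have "R powr (- \<alpha>) * (- \<delta> * R powr \<alpha> - M) = - \<delta> * (R powr (- \<alpha>) * R powr \<alpha>) - M * R powr (- \<alpha>)"
      by (simp add: algebra_simps)
    moreover have "R powr (- \<alpha>) * R powr \<alpha> = 1" using that by (simp add: powr_add[symmetric])
    ultimately show ?thesis by simp
  qed
  with M(1) show thesis by (rule that)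
qed

lemma integrable_solution_power:
  "integrable lborel (\<lambda>z. indicator {0<..} (fst z) * \<bar>v z\<bar> powr p)"
proof -
  obtain K where K: "0 \<le> K" and bound: "\<And>R. 0 < R \<Longrightarrow>
      c / 2 * (LINT z|lborel. source_density \<alpha> \<beta> p (Suc k) v R z) + R powr (- \<alpha>) * I R
      \<le> K * R powr (real CARD('n) - \<alpha> - (\<alpha> + \<beta>) / (p - 1))"
    using source_growth_bound[OF p k \<alpha>(1) \<beta> c C int int_err ineq] by blast
  obtain M where M: "0 \<le> M" "\<And>R. 0 < R \<Longrightarrow> - 1 - M * R powr (- \<alpha>) \<le> R powr (- \<alpha>) * I R"
    using data_scaled[of 1] by auto
  have "(LINT z|lborel. source_density \<alpha> \<beta> p (Suc k) v R z) \<le> 2 * (K + 1 + M) / c" if R: "1 \<le> R" for R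
  proof -
    have "R powr (real CARD('n) - \<alpha> - (\<alpha> + \<beta>) / (p - 1)) \<le> R powr 0"
      using R critical by (intro powr_mono) auto
    then have "K * R powr (real CARD('n) - \<alpha> - (\<alpha> + \<beta>) / (p - 1)) \<le> K * 1"
      using K R by (intro mult_left_mono) auto
    moreover have "R powr (- \<alpha>) \<le> R powr 0" using R \<alpha> by (intro powr_mono) auto
    then have "M * R powr (- \<alpha>) \<le> M * 1" using M(1) R by (intro mult_left_mono) auto
    ultimately have "c / 2 * (LINT z|lborel. source_density \<alpha> \<beta> p (Suc k) v R z) \<le> K + 1 + M"
      using bound[of R] M(2)[of R] R by linarith
    then show ?thesis using c by (simp add: field_simps)
  qed
  with v \<alpha>(2) \<beta> int show ?thesis by (rule integrable_from_source_bound)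
qed

text \<open>The order of choices is essential: \<theta> is taken large to make the remainder small,
  the ball \<open>B\<close> is taken large to make \<theta> times the tail small, and
  \<open>R\<close> comes last. The five summands \<open>e\<close> come from the ball, the tail, the
  remainder and the two error terms of the data.\<close>

lemma source_integral_eventually_small:
  assumes e: "0 < e"
  shows "\<forall>\<^sub>F R in at_top. c * (LINT z|lborel. source_density \<alpha> \<beta> p (Suc k) v R z) \<le> 5 * e"
proof -
  define q where "q = ((real CARD('n) + \<beta>) * p - (real CARD('n) - \<alpha>)) / (p - 1)"
  define D where "D = (LINT y|lborel. (1 + norm (y :: real ^ 'n)) powr (- q))"
  define f where "f z = indicator {0<..} (fst z) * \<bar>v z\<bar> powr p" for z
  \<comment> \<open>With this \<theta> the factor \<theta>^(-1/(p-1)) equals 1 / G, and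
    \<open>G\<close> is large enough for C * D / G \<le> e. The summand 1 keeps \<open>G\<close>
    positive when C * D = 0.\<close>
  define G where "G = C * D / e + 1"
  define \<theta> where "\<theta> = G powr (p - 1)"
  have q: "real CARD('n) < q" unfolding q_def by (rule Young_exponent_gt[OF \<alpha>(1) \<beta> p])
  have f_int: "integrable lborel f" unfolding f_def by (rule integrable_solution_power)
  have D: "0 \<le> D" unfolding D_def by (intro Bochner_Integration.integral_nonneg) auto
  have G: "0 < G" "C * D \<le> e * G" 
    using mult_nonneg_nonneg[OF C D] e by (auto simp: G_def field_simps add_pos_nonneg)
  have \<theta>: "0 < \<theta>" using G by (simp add: \<theta>_def)
  have \<theta>': "C * (\<theta> powr (- 1 / (p - 1)) * D) \<le> e"
    using G p by (simp add: \<theta>_def powr_powr powr_minus field_simps)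
  define T where "T m = (LINT z|lborel. indicator (- cball 0 (real m)) z * f z)" for m :: nat
  have "T \<longlonglongrightarrow> 0" unfolding T_def by (rule integral_outside_cball_tendsto_0[OF f_int])
  then have "(\<lambda>m. C * (\<theta> * T m)) \<longlonglongrightarrow> C * (\<theta> * 0)" by (intro tendsto_intros)
  then have "\<forall>\<^sub>F m in sequentially. C * (\<theta> * T m) < e" using e by (simp add: order_tendstoD(2))
  then obtain m where m: "C * (\<theta> * T m) < e" by (auto simp: eventually_sequentially)
  define B :: "(real \<times> (real ^ 'n)) set" where "B = cball 0 (real m)"
  define L where "L = (LINT z|lborel. indicator B z + f z)"
  have B_int: "integrable lborel (indicator B :: _ \<Rightarrow> real)"
    unfolding B_def by (intro integrable_real_indicator) (auto simp: emeasure_cball)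
  have T_int: "integrable lborel (\<lambda>z. indicator (- B) z * f z)"
  proof (rule Bochner_Integration.integrable_bound[OF f_int])
    show "(\<lambda>z. indicator (- B) z * f z) \<in> borel_measurable lborel"
      using borel_measurable_integrable[OF f_int] unfolding B_def
      by (intro borel_measurable_times borel_measurable_indicator) auto
  qed (auto simp: indicator_def)
  obtain M where M: "0 \<le> M" "\<And>R. 0 < R \<Longrightarrow> - e - M * R powr (- \<alpha>) \<le> R powr (- \<alpha>) * I R"
    using data_scaled[OF e] by auto
  have "\<forall>\<^sub>F R in at_top. C * L * R powr (- (\<alpha> + \<beta>)) < e"
    using \<alpha> \<beta> e by (intro eventually_powr_neg_small) auto
  moreover have "\<forall>\<^sub>F R in at_top. M * R powr (- \<alpha>) < e"
    using \<alpha> e by (intro eventually_powr_neg_small) auto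
  moreover have "\<forall>\<^sub>F R :: real in at_top. 1 \<le> R" by (rule eventually_ge_at_top)
  ultimately show ?thesis
  proof eventually_elim
    case (elim R)
    then have R: "0 < R" by simp
    note dec = decay_density_integral[OF R q, of \<beta>]
    let ?P = "R powr (real CARD('n) - \<alpha> - (\<alpha> + \<beta>) / (p - 1))"
    let ?Z = "R powr (- (\<alpha> + \<beta>) * p / (p - 1))"
    have "?P \<le> R powr 0" using elim critical by (intro powr_mono) auto
    then have P: "?P \<le> 1" using R by simp
    have "R powr (- (\<alpha> + \<beta>)) * (LINT z|lborel. error_density \<beta> k v R z) =
      (LINT z|lborel. R powr (- (\<alpha> + \<beta>)) * error_density \<beta> k v R z)" by simp
    also have "\<dots> \<le> (LINT z|lborel. R powr (- (\<alpha> + \<beta>)) * (indicator B z + f z) + \<theta> * (indicator (- B) z * f z) +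
        \<theta> powr (- 1 / (p - 1)) * (?Z * decay_density \<beta> q R z))"
    proof (rule integral_mono)
      fix z
      show "R powr (- (\<alpha> + \<beta>)) * error_density \<beta> k v R z \<le>
        R powr (- (\<alpha> + \<beta>)) * (indicator B z + f z) + \<theta> * (indicator (- B) z * f z) +
        \<theta> powr (- 1 / (p - 1)) * (?Z * decay_density \<beta> q R z)"
        unfolding f_def q_def by (rule error_density_split[OF R p \<theta> k \<alpha>(2) \<beta>])
    qed (intro Bochner_Integration.integrable_add integrable_mult_right int_err R B_int f_int T_int dec(1))+
    also have "\<dots> = R powr (- (\<alpha> + \<beta>)) * L + \<theta> * T m +
        \<theta> powr (- 1 / (p - 1)) * (?Z * (LINT z|lborel. decay_density \<beta> q R (z :: real \<times> (real ^ 'n))))"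
      using B_int f_int T_int dec(1) by (simp add: L_def T_def B_def)
    also have "?Z * (LINT z|lborel. decay_density \<beta> q R (z :: real \<times> (real ^ 'n))) = D * (?Z * (R powr \<beta> * R ^ CARD('n)))"
      unfolding dec(2) D_def by (simp add: mult_ac)
    also have "\<dots> = D * ?P" by (subst decay_scaling_exponent[OF R p]) simp
    finally have Y: "R powr (- (\<alpha> + \<beta>)) * (LINT z|lborel. error_density \<beta> k v R z) \<le>
        R powr (- (\<alpha> + \<beta>)) * L + \<theta> * T m + \<theta> powr (- 1 / (p - 1)) * (D * ?P)" .
    have "c * (LINT z|lborel. source_density \<alpha> \<beta> p (Suc k) v R z) + R powr (- \<alpha>) * I R
        \<le> C * (R powr (- (\<alpha> + \<beta>)) * (LINT z|lborel. error_density \<beta> k v R z))"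
      by (rule scaled_inequality[OF ineq[OF R] R])
    also have "\<dots> \<le> C * (R powr (- (\<alpha> + \<beta>)) * L + \<theta> * T m + \<theta> powr (- 1 / (p - 1)) * (D * ?P))"
      by (intro mult_left_mono Y C)
    also have "\<dots> = C * L * R powr (- (\<alpha> + \<beta>)) + C * (\<theta> * T m) + C * (\<theta> powr (- 1 / (p - 1)) * D) * ?P"
      by (simp add: algebra_simps)
    also have "C * (\<theta> powr (- 1 / (p - 1)) * D) * ?P \<le> e * 1"
      using e C D by (intro mult_mono \<theta>' P) auto
    finally show ?case using elim m M(2)[OF R] by linarith
  qed
qed

lemma solution_vanishes: "AE z in lborel. 0 < fst z \<longrightarrow> v z = 0"
proof -
  have X0: "(LINT z|lborel. source_density \<alpha> \<beta> p (Suc k) v r z) = 0" if r: "0 < r" for r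
  proof -
    let ?X = "\<lambda>R. LINT z|lborel. source_density \<alpha> \<beta> p (Suc k) v R z"
    have "c * ?X r \<le> 0 + e" if "0 < e" for e
    proof -
      have "\<forall>\<^sub>F R in at_top. c * ?X R \<le> 5 * (e / 5)"
        using that by (intro source_integral_eventually_small) auto
      then have "\<forall>\<^sub>F R in at_top. c * ?X R \<le> e \<and> r \<le> R"
        using eventually_ge_at_top[of r] by eventually_elim simp
      then obtain R where R: "c * ?X R \<le> e" "r \<le> R"
        by (auto simp: eventually_at_top_linorder)
      have "?X r \<le> ?X R"
        using r R \<beta> \<alpha> by (intro integral_mono source_density_mono int) auto
      then have "c * ?X r \<le> c * ?X R" using c by simp
      then show ?thesis using R by simp
    qed
    then have "c * ?X r \<le> 0" by (rule field_le_epsilon)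
    then have "?X r \<le> 0" using c by (simp add: mult_le_0_iff)
    moreover have "0 \<le> ?X r" using source_density_nonneg[OF r] by (intro Bochner_Integration.integral_nonneg)
    ultimately show ?thesis by simp
  qed
  \<comment> \<open>Integer radii reach every positive time and leave only countably many
    exceptional sets.\<close>
  have "AE z in lborel. source_density \<alpha> \<beta> p (Suc k) v (real (Suc m)) z = 0" for m
  proof -
    have R: "0 < real (Suc m)" by simp
    have "AE z in lborel. 0 \<le> source_density \<alpha> \<beta> p (Suc k) v (real (Suc m)) z"
      by (intro AE_I2 source_density_nonneg R)
    from integral_nonneg_eq_0_iff_AE[OF int[OF R] this] X0[OF R] show ?thesis by blast
  qed
  then have "AE z in lborel. \<forall>m. source_density \<alpha> \<beta> p (Suc k) v (real (Suc m)) z = 0"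
    by (simp add: AE_all_countable)
  then show ?thesis
  proof eventually_elim
    case (elim z)
    show ?case
    proof
      assume t: "0 < fst z"
      have "filterlim (\<lambda>m. real (Suc m) powr \<beta>) at_top sequentially"
        using \<beta> by (intro filterlim_compose[OF real_powr_at_top] filterlim_compose[OF filterlim_real_sequentially] filterlim_Suc)
      then have "\<forall>\<^sub>F m in sequentially. fst z + 1 \<le> real (Suc m) powr \<beta>"
        by (simp add: filterlim_at_top)
      then obtain m where m: "fst z + 1 \<le> real (Suc m) powr \<beta>" by (auto simp: eventually_sequentially)
      define R where "R = real (Suc m)"
      have R: "0 < R" "fst z < R powr \<beta>" using m by (auto simp: R_def)
      have "0 < 1 + norm (snd z) / R" using R by (simp add: add_pos_nonneg)
      moreover have "source_density \<alpha> \<beta> p (Suc k) v R z = 0" using elim unfolding R_def by blast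
      ultimately show "v z = 0"
        using t R by (auto simp: source_density_def)
    qed
  qed
qed

end

text \<open>The liminf controls only balls of radius at least some \<open>r1\<close>, whereas the
  superlevel sets of the bump include small balls. Those have mass at least -M, where M is the
  integral of |u0| over the ball of radius \<open>r1\<close>. Both cases together give one bound for
  all radii up to \<open>R\<close>.\<close>

lemma liminf_ball_average_lower_bound:
  fixes u0 :: "real ^ 'n \<Rightarrow> real"
  assumes loc: "L1_loc UNIV u0" and \<alpha>: "0 < \<alpha>"
    and lim: "0 \<le> Liminf at_top (\<lambda>R. ereal (R powr (- \<alpha>) * (LINT x:cball 0 R|lebesgue. u0 x)))"
    and \<delta>: "0 < \<delta>"
  shows "\<exists>M\<ge>0. \<forall>R>0. - \<delta> * R powr \<alpha> - M \<le> (LINT x|lebesgue. u0 x * bump (x /\<^sub>R R))"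
proof -
  let ?A = "\<lambda>R. LINT x:cball 0 R|lebesgue. u0 x"
  have int: "integrable lebesgue (\<lambda>x. indicator (cball 0 r) x * u0 x)" for r
    using loc unfolding L1_loc_def set_integrable_def by simp
  have "\<forall>\<^sub>F R in at_top. ereal (- \<delta>) < ereal (R powr (- \<alpha>) * ?A R)"
    using lim \<delta> unfolding le_Liminf_iff by (auto dest: spec[of _ "ereal (- \<delta>)"])
  then obtain r0 where r0: "\<And>R. r0 \<le> R \<Longrightarrow> - \<delta> < R powr (- \<alpha>) * ?A R"
    by (auto simp: eventually_at_top_linorder)
  define r1 where "r1 = max 1 r0"
  define M where "M = (LINT x|lebesgue. norm (indicator (cball 0 r1) x * u0 x))"
  have M: "0 \<le> M" unfolding M_def by (intro Bochner_Integration.integral_nonneg) auto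
  show ?thesis
  proof (rule exI[of _ M], intro conjI M allI impI)
    fix R :: real assume R: "0 < R"
    have "- (\<delta> * R powr \<alpha> + M) \<le> (LINT x|lebesgue. u0 x * bump (x /\<^sub>R R))"
    proof (rule integral_scaled_bump_ge[OF loc R])
      show "0 \<le> \<delta> * R powr \<alpha> + M" using \<delta> M by simp
      fix r :: real assume r: "0 \<le> r" "r \<le> R"
      show "- (\<delta> * R powr \<alpha> + M) \<le> ?A r"
      proof (cases "r1 \<le> r")
        case True
        then have "0 < r" "r0 \<le> r" by (auto simp: r1_def)
        have "- \<delta> * r powr \<alpha> \<le> (r powr (- \<alpha>) * ?A r) * r powr \<alpha>"
          using r0[OF \<open>r0 \<le> r\<close>] by (intro mult_right_mono) auto
        also have "\<dots> = (r powr (- \<alpha>) * r powr \<alpha>) * ?A r" by (simp only: mult_ac)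
        also have "r powr (- \<alpha>) * r powr \<alpha> = 1" using \<open>0 < r\<close> by (simp add: powr_add[symmetric])
        finally have "- \<delta> * r powr \<alpha> \<le> ?A r" by simp
        moreover have "\<delta> * r powr \<alpha> \<le> \<delta> * R powr \<alpha>"
          using r \<delta> \<alpha> by (intro mult_left_mono powr_mono2) auto
        ultimately show ?thesis using M by linarith
      next
        case False
        have "\<bar>?A r\<bar> \<le> (LINT x|lebesgue. norm (indicator (cball 0 r) x * u0 x))"
          unfolding set_lebesgue_integral_def real_scaleR_def
          using integral_norm_bound[of lebesgue "\<lambda>x. indicator (cball 0 r) x * u0 x"] by simp
        also have "\<dots> \<le> M"
          unfolding M_def
        proof (rule integral_mono)
          fix x :: "real ^ 'n"
          show "norm (indicator (cball 0 r) x * u0 x) \<le> norm (indicator (cball 0 r1) x * u0 x)"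
            using False by (auto simp: indicator_def)
        qed (intro integrable_norm int)+
        finally have "- M \<le> ?A r" by linarith
        moreover have "0 \<le> \<delta> * R powr \<alpha>" using \<delta> by simp
        ultimately show ?thesis by linarith
      qed
    qed
    then show "- \<delta> * R powr \<alpha> - M \<le> (LINT x|lebesgue. u0 x * bump (x /\<^sub>R R))" by simp
  qed
qed

theorem theorem1p9:
  fixes \<alpha> \<beta> p :: real and u0 :: "real ^ 'n \<Rightarrow> real"
  assumes "0 < \<alpha>" and "\<alpha> < real CARD('n)"
    and "0 < \<beta>" and "\<beta> \<le> 2" and "1 < p"
    and "L1_loc UNIV u0"
  shows
    "(0 \<le> Liminf at_top (\<lambda>R. ereal (R powr (- \<alpha>) * (LINT x:cball 0 R|lebesgue. u0 x))) \<and>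
      p \<le> p_Fuj CARD('n) \<beta> \<alpha> \<longrightarrow>
      \<not> (\<exists>u. global_weak_solution \<alpha> \<beta> p u0 u \<and> nonnegative_ae \<infinity> u \<and> nontrivial \<infinity> u)) \<and>
     (\<forall>\<epsilon> \<gamma>. 0 < \<epsilon> \<and> 0 < \<gamma> \<and>
        (AE x in lebesgue. \<epsilon> * (1 + (norm x)\<^sup>2) powr (- \<gamma> / 2) \<le> u0 x) \<and>
        p < p_star \<gamma> \<beta> \<alpha> \<longrightarrow>
      \<not> (\<exists>u. global_weak_solution \<alpha> \<beta> p u0 u))"
proof -
  obtain k :: nat where "p / (p - 1) \<le> real k" using real_arch_simple by blast
  then have k: "p / (p - 1) \<le> real (Suc (Suc k))" by simp
  define E where "E = real CARD('n) - \<alpha> - (\<alpha> + \<beta>) / (p - 1)"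
  show ?thesis
  proof (intro conjI impI allI notI)
    assume hyp: "0 \<le> Liminf at_top (\<lambda>R. ereal (R powr (- \<alpha>) * (LINT x:cball 0 R|lebesgue. u0 x))) \<and>
      p \<le> p_Fuj CARD('n) \<beta> \<alpha>"
      and "\<exists>u. global_weak_solution \<alpha> \<beta> p u0 u \<and> nonnegative_ae \<infinity> u \<and> nontrivial \<infinity> u"
    then obtain u where sol: "global_weak_solution \<alpha> \<beta> p u0 u" and nontriv: "nontrivial \<infinity> u" by blast
    have "L1_loc (open_strip \<infinity>) u" using sol by (simp add: global_weak_solution_def weak_solution_def)
    then obtain v where v: "v \<in> borel_measurable borel" and uv: "AE z in lborel. 0 < fst z \<longrightarrow> u z = v z"
      by (rule borel_representative)
    obtain c C where cC: "0 < c" "0 \<le> C" and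
      key: "\<And>R. 0 < R \<Longrightarrow> integrable lborel (source_density \<alpha> \<beta> p (Suc (Suc k)) v R)"
        "\<And>R. 0 < R \<Longrightarrow> integrable lborel (error_density \<beta> (Suc k) v R)"
        "\<And>R. 0 < R \<Longrightarrow> c * R powr \<alpha> * (LINT z|lborel. source_density \<alpha> \<beta> p (Suc (Suc k)) v R z) +
          (LINT x|lebesgue. u0 x * bump (x /\<^sub>R R)) \<le> C * R powr (- \<beta>) * (LINT z|lborel. error_density \<beta> (Suc k) v R z)"
      using test_function_inequality[OF sol v uv assms(1-5) k] by blast
    have "(p - 1) * (real CARD('n) - \<alpha>) \<le> \<alpha> + \<beta>"
      using hyp assms by (simp add: p_Fuj_def field_simps)
    \<comment> \<open>The Fujita condition, rewritten as the sign of the scaling exponent.\<close>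
    then have "E \<le> 0" using assms by (simp add: E_def field_simps)
    then have "AE z in lborel. 0 < fst z \<longrightarrow> v z = 0"
      unfolding E_def
      by (intro solution_vanishes[OF v assms(1,2,3,5) k cC key] liminf_ball_average_lower_bound[OF assms(6,1)])
        (use hyp in auto)
    with uv have "AE z in lborel. 0 < fst z \<longrightarrow> u z = 0" by eventually_elim simp
    then have "AE z in lebesgue. z \<in> open_strip \<infinity> \<longrightarrow> u z = 0"
      by (simp add: AE_completion_iff open_strip_def)
    with nontriv show False by (simp add: nontrivial_def)
  next
    fix \<epsilon> \<gamma> :: real
    assume hyp: "0 < \<epsilon> \<and> 0 < \<gamma> \<and> (AE x in lebesgue. \<epsilon> * (1 + (norm x)\<^sup>2) powr (- \<gamma> / 2) \<le> u0 x) \<and>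
        p < p_star \<gamma> \<beta> \<alpha>"
      and "\<exists>u. global_weak_solution \<alpha> \<beta> p u0 u"
    then obtain u where sol: "global_weak_solution \<alpha> \<beta> p u0 u" by blast
    have "L1_loc (open_strip \<infinity>) u" using sol by (simp add: global_weak_solution_def weak_solution_def)
    then obtain v where v: "v \<in> borel_measurable borel" and uv: "AE z in lborel. 0 < fst z \<longrightarrow> u z = v z"
      by (rule borel_representative)
    obtain c C where cC: "0 < c" "0 \<le> C" and
      key: "\<And>R. 0 < R \<Longrightarrow> integrable lborel (source_density \<alpha> \<beta> p (Suc (Suc k)) v R)"
        "\<And>R. 0 < R \<Longrightarrow> integrable lborel (error_density \<beta> (Suc k) v R)"
        "\<And>R. 0 < R \<Longrightarrow> c * R powr \<alpha> * (LINT z|lborel. source_density \<alpha> \<beta> p (Suc (Suc k)) v R z) +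
          (LINT x|lebesgue. u0 x * bump (x /\<^sub>R R)) \<le> C * R powr (- \<beta>) * (LINT z|lborel. error_density \<beta> (Suc k) v R z)"
      and int0: "\<And>R. 0 < R \<Longrightarrow> integrable lebesgue (\<lambda>x. u0 x * bump (x /\<^sub>R R))"
      using test_function_inequality[OF sol v uv assms(1-5) k] by blast
    obtain K where K: "0 \<le> K" "\<And>R. 0 < R \<Longrightarrow>
        c / 2 * (LINT z|lborel. source_density \<alpha> \<beta> p (Suc (Suc k)) v R z) +
        R powr (- \<alpha>) * (LINT x|lebesgue. u0 x * bump (x /\<^sub>R R)) \<le> K * R powr E"
      using source_growth_bound[OF assms(5) k assms(1,3) cC key] unfolding E_def by blast
    define d where "d = \<epsilon> * 2 powr (- \<gamma> / 2) * (27 / 64) * (unit_ball_vol (real CARD('n)) / 2 ^ CARD('n))"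
    have d: "0 < d"
      unfolding d_def using hyp by (intro mult_pos_pos divide_pos_pos unit_ball_vol_pos) auto
    \<comment> \<open>This is (n - \<gamma> - \<alpha>) - E, the rate by which the growth of the
      data term exceeds that of the upper bound. It is positive exactly when p < p_*.\<close>
    define \<kappa> where "\<kappa> = (\<alpha> + \<beta>) / (p - 1) - \<gamma>"
    have "p - 1 < (\<beta> + \<alpha>) / \<gamma>" using hyp by (simp add: p_star_def)
    then have "(p - 1) * \<gamma> < \<alpha> + \<beta>" using hyp by (simp add: pos_less_divide_eq add.commute)
    then have \<kappa>: "0 < \<kappa>" using assms by (simp add: \<kappa>_def field_simps)
    have upper: "d * R powr \<kappa> \<le> K" if R: "1 \<le> R" for R
    proof -
      have "0 \<le> c / 2 * (LINT z|lborel. source_density \<alpha> \<beta> p (Suc (Suc k)) v R z)"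
        using cC R by (intro mult_nonneg_nonneg Bochner_Integration.integral_nonneg source_density_nonneg) auto
      then have "R powr (- \<alpha>) * (LINT x|lebesgue. u0 x * bump (x /\<^sub>R R)) \<le> K * R powr E"
        using K(2)[of R] R by linarith
      moreover have "R powr (- \<alpha>) * (d * R powr (real CARD('n) - \<gamma>)) \<le>
          R powr (- \<alpha>) * (LINT x|lebesgue. u0 x * bump (x /\<^sub>R R))"
        unfolding d_def using hyp R int0[of R] by (intro mult_left_mono integral_bump_slow_decay) auto
      ultimately have "R powr (- \<alpha>) * (d * R powr (real CARD('n) - \<gamma>)) \<le> K * R powr E" by linarith
      then have "R powr (- E) * (R powr (- \<alpha>) * (d * R powr (real CARD('n) - \<gamma>))) \<le> R powr (- E) * (K * R powr E)"
        by (intro mult_left_mono) auto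
      moreover have "R powr (- E) * (R powr (- \<alpha>) * (d * R powr (real CARD('n) - \<gamma>))) = d * R powr \<kappa>"
        by (simp add: powr_add[symmetric] E_def \<kappa>_def)
      moreover have "R powr (- E) * (K * R powr E) = K" using R by (simp add: powr_add[symmetric])
      ultimately show ?thesis by simp
    qed
    have "filterlim (\<lambda>R::real. R powr \<kappa>) at_top at_top" using \<kappa> by (rule real_powr_at_top)
    then have "\<forall>\<^sub>F R :: real in at_top. K / d + 1 \<le> R powr \<kappa>" by (simp add: filterlim_at_top)
    then have "\<forall>\<^sub>F R :: real in at_top. K / d + 1 \<le> R powr \<kappa> \<and> 1 \<le> R"
      using eventually_ge_at_top[of 1] by eventually_elim simp
    then obtain R :: real where R: "K / d + 1 \<le> R powr \<kappa>" "1 \<le> R"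
      by (auto simp: eventually_at_top_linorder)
    have "d * (K / d + 1) \<le> d * R powr \<kappa>" using R d by (intro mult_left_mono) auto
    then show False using upper[OF R(2)] d by (simp add: algebra_simps)
  qed
qed

end
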